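(* For every $k\in\frac12\mathbb Z$ the element $S_k^{(2)}$ lies in the centre of $\hat U_2$.
   Context: Let $A=\mathbb C[[a]]$, $Q=\mathbb C((a))$ and $K_2=\mathbb C[[t,s]][\frac1{ts}]$, an $A$-algebra via $a=t-s$. For $n\in\mathbb Z$ put $u_n=t^ns^n$, $v_n=t^ns^{n+1}$, $x_n=t^ns^n$, $y_n=t^{n+1}s^n$. For $m\in\frac12\mathbb Z$ put $w_m=u_m$, $z_m=x_m$ if $m\in\mathbb Z$, and $w_m=v_{m-1/2}$, $z_m=y_{m-1/2}$ if $m\notin\mathbb Z$. Let $R_2\subset K_2$ be the $A$-span of the $w_m$, $m\in\frac12\mathbb Z$; it is an $A$-subalgebra, free over $A$ with basis $(w_m)$, and stable under the $A$-linear derivation $f\mapsto f'$ with $t'=s'=1$. Let $E_t:K_2\to Q((t))$ be the expansion obtained by substituting $s=t-a$, and $E_s:K_2\to Q((s))$ the expansion obtained by substituting $t=s+a$. Put $\mathrm{Res}_2(f)=(\text{coefficient of }t^{-1}\text{ in }E_t(f))+(\text{coefficient of }s^{-1}\text{ in }E_s(f))$; it takes values in $A$. Let $\mathfrak g=\mathfrak{sl}_2(\mathbb C)$ with Killing form $\kappa$. Let $\hat{\mathfrak g}_2=\mathfrak g\otimes_{\mathbb C}R_2\oplus A\,C_2$ be the Lie algebra over $A$ with $C_2$ central and $[xf,yg]=[x,y]fg+\mathrm{Res}_2(f'g)\,\kappa(x,y)\,C_2$ for $x,y\in\mathfrak g$, $f,g\in R_2$. Let $U_2$ be its enveloping algebra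 over $A$, and for $n\ge0$ let $J_2(n)$ be the left ideal of $U_2$ generated by the elements $xw_m$ with $x\in\mathfrak g$, $m\ge n$. Put $\bar U_2=\varprojlim_n U_2/J_2(n)$, which is an associative algebra (the product of $U_2$ extended by continuity), and $\hat U_2=\bar U_2/(C_2+\frac12)$. Let $\{J^\alpha\}$ be a basis of $\mathfrak g$ and $\{J_\alpha\}$ the dual basis with respect to $\kappa$. For $e_1,e_2\in\mathfrak g$ and $m_1,m_2\in\frac12\mathbb Z$ the normal ordered product is $:(e_1w_{m_1})(e_2w_{m_2}):\;=(e_1w_{m_1})(e_2w_{m_2})$ if $m_1\le m_2$ and $=(e_2w_{m_2})(e_1w_{m_1})$ if $m_1>m_2$, extended $A$-bilinearly to $\mathfrak g\otimes R_2$. For $k\in\frac12\mathbb Z$ the two-variable Sugawara operator is the (convergent) series $$S^{(2)}_k=\sum_{n\in\frac12\mathbb Z,\ \alpha}:(J^\alpha w_n)\,(J_\alpha z_{-n-\frac12}w_k):\ \in\hat U_2 .$$ *)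

theory Defs
  imports "HOL-Analysis.Analysis" "HOL-Computational_Algebra.Computational_Algebra" "HOL-Library.Poly_Mapping"
begin

no_notation fps_nth (infixl \<open>$\<close> 75)

text \<open>
  \<open>complex fps fps\<close> serves as the ring of power series in two variables. As \<open>\<complex>[[t, s]]\<close> the inner
  variable is \<open>t\<close> and the outer one \<open>s\<close>; as \<open>A[[t]]\<close> or \<open>A[[s]]\<close>, with \<open>A = \<complex>[[a]]\<close>, the inner variable is
  \<open>a\<close>. \<open>cf2 f i j\<close> is the coefficient of (inner variable)\<open>^i\<close> (outer variable)\<open>^j\<close>.
\<close>

definition cf2 :: "complex fps fps \<Rightarrow> nat \<Rightarrow> nat \<Rightarrow> complex"
  where "cf2 f i j = fps_nth (fps_nth f j) i"

text \<open>
  \<open>subst2 f g h\<close> substitutes \<open>g\<close> for the inner and \<open>h\<close> for the outer variable of \<open>f\<close>. It is meant for \<open>g, h\<close>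
  without constant term; then \<open>g^i h^j\<close> has no terms of total degree below \<open>i + j\<close>, so that
  \<open>i, j \<le> m + n\<close> exhausts the contributions to the coefficient at \<open>(m, n)\<close>.
\<close>

definition subst2 :: "complex fps fps \<Rightarrow> complex fps fps \<Rightarrow> complex fps fps \<Rightarrow> complex fps fps"
  where "subst2 f g h = Abs_fps (\<lambda>n. Abs_fps (\<lambda>m.
     \<Sum>i\<le>m+n. \<Sum>j\<le>m+n. cf2 f i j * cf2 (g ^ i * h ^ j) m n))"

definition ord_ge :: "complex fps fps \<Rightarrow> nat \<Rightarrow> bool"
  where "ord_ge f d \<longleftrightarrow> (\<forall>m n. m + n < d \<longrightarrow> cf2 f m n = 0)"

lemma cf2_eqI: "(\<And>m n. cf2 f m n = cf2 g m n) \<Longrightarrow> f = g"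
  by (simp add: cf2_def fps_eq_iff)

lemma cf2_simps [simp]:
  "cf2 0 m n = 0" "cf2 (f + g) m n = cf2 f m n + cf2 g m n"
  "cf2 (f - g) m n = cf2 f m n - cf2 g m n" "cf2 (- f) m n = - cf2 f m n"
  "cf2 (fps_const (fps_const c) * f) m n = c * cf2 f m n"
  by (simp_all add: cf2_def)

lemma cf2_sum: "cf2 (sum f A) m n = (\<Sum>x\<in>A. cf2 (f x) m n)"
  by (induction A rule: infinite_finite_induct) simp_all

lemma cf2_mult: "cf2 (f * g) m n = (\<Sum>j\<le>n. \<Sum>i\<le>m. cf2 f i j * cf2 g (m - i) (n - j))"
  by (simp add: cf2_def fps_mult_nth fps_sum_nth atLeast0AtMost)

lemma cf2_subst2: "cf2 (subst2 f g h) m n =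
    (\<Sum>i\<le>m+n. \<Sum>j\<le>m+n. cf2 f i j * cf2 (g ^ i * h ^ j) m n)"
  by (simp add: cf2_def subst2_def)

lemma ord_ge_0 [simp]: "ord_ge f 0"
  by (simp add: ord_ge_def)

lemma ord_ge_zero [simp]: "ord_ge 0 d"
  by (simp add: ord_ge_def)

lemma ord_ge_mono: "ord_ge f d \<Longrightarrow> e \<le> d \<Longrightarrow> ord_ge f e"
  by (auto simp: ord_ge_def)

lemma ord_ge_add: "ord_ge f d \<Longrightarrow> ord_ge g d \<Longrightarrow> ord_ge (f + g) d"
  by (simp add: ord_ge_def)

lemma ord_ge_minus: "ord_ge f d \<Longrightarrow> ord_ge (- f) d"
  by (simp add: ord_ge_def)

lemma ord_ge_diff: "ord_ge f d \<Longrightarrow> ord_ge g d \<Longrightarrow> ord_ge (f - g) d"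
  by (simp add: ord_ge_def)

lemma ord_ge_sum: "(\<And>x. x \<in> A \<Longrightarrow> ord_ge (f x) d) \<Longrightarrow> ord_ge (sum f A) d"
  by (simp add: ord_ge_def cf2_sum)

lemma ord_ge_mult:
  assumes "ord_ge f d" "ord_ge g e"
  shows "ord_ge (f * g) (d + e)"
  unfolding ord_ge_def cf2_mult
proof (intro allI impI sum.neutral ballI)
  fix m n i j assume "m + n < d + e" "j \<in> {..n}" "i \<in> {..m}"
  then have "i + j < d \<or> (m - i) + (n - j) < e" by auto
  then show "cf2 f i j * cf2 g (m - i) (n - j) = 0"
    using assms unfolding ord_ge_def by auto
qed

lemma ord_ge_mult_left: "ord_ge g e \<Longrightarrow> ord_ge (f * g) e"
  using ord_ge_mult[of f 0 g e] by simp

lemma ord_ge_mult_right: "ord_ge g e \<Longrightarrow> ord_ge (g * f) e"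
  using ord_ge_mult[of g e f 0] by simp

lemma ord_ge_power: "ord_ge f 1 \<Longrightarrow> ord_ge (f ^ n) n"
proof (induction n)
  case (Suc n)
  then show ?case using ord_ge_mult[of f 1 "f ^ n" n] by simp
qed simp

lemma ord_ge_eqI: "(\<And>N. ord_ge (f - g) N) \<Longrightarrow> f = g"
proof (rule cf2_eqI)
  fix m n assume "\<And>N. ord_ge (f - g) N"
  from this[of "m + n + 1"] show "cf2 f m n = cf2 g m n" by (simp add: ord_ge_def)
qed

definition psum2 :: "nat \<Rightarrow> complex fps fps \<Rightarrow> complex fps fps \<Rightarrow> complex fps fps \<Rightarrow> complex fps fps"
  where "psum2 N f g h = (\<Sum>i\<le>N. \<Sum>j\<le>N. fps_const (fps_const (cf2 f i j)) * (g ^ i * h ^ j))"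

lemma subst2_psum2:
  assumes "ord_ge g 1" "ord_ge h 1"
  shows "ord_ge (subst2 f g h - psum2 N f g h) (Suc N)"
  unfolding ord_ge_def
proof (intro allI impI)
  fix m n assume mn: "m + n < Suc N"
  have z: "cf2 (g ^ i * h ^ j) m n = 0" if "m + n < i + j" for i j
    using ord_ge_mult[OF ord_ge_power[OF assms(1), of i] ord_ge_power[OF assms(2), of j]] that
    by (simp add: ord_ge_def)
  have "(\<Sum>i\<le>N. \<Sum>j\<le>N. cf2 f i j * cf2 (g ^ i * h ^ j) m n)
      = (\<Sum>i\<le>m+n. \<Sum>j\<le>N. cf2 f i j * cf2 (g ^ i * h ^ j) m n)"
    by (rule sum.mono_neutral_right) (use mn z in auto)
  also have "\<dots> = (\<Sum>i\<le>m+n. \<Sum>j\<le>m+n. cf2 f i j * cf2 (g ^ i * h ^ j) m n)"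
    by (intro sum.cong refl sum.mono_neutral_right) (use mn z in auto)
  finally show "cf2 (subst2 f g h - psum2 N f g h) m n = 0"
    by (simp add: cf2_subst2 psum2_def cf2_sum)
qed

lemma const2_sum: "fps_const (fps_const (sum f A)) = (\<Sum>x\<in>A. fps_const (fps_const (f x)))"
  by (induction A rule: infinite_finite_induct) (simp_all flip: fps_const_add)

lemma psum2_mult:
  assumes "ord_ge g 1" "ord_ge h 1"
  shows "ord_ge (psum2 N f g h * psum2 N f' g h - psum2 N (f * f') g h) (Suc N)"
proof -
  define F where "F = (\<lambda>((i,j),(i',j')). fps_const (fps_const (cf2 f i j * cf2 f' i' j')) * (g ^ (i+i') * h ^ (j+j')))"
  define Q where "Q = ({..N} \<times> {..N}) \<times> ({..N} \<times> {..N})"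
  define Q0 where "Q0 = {((i,j),(i',j')). i + i' \<le> N \<and> j + j' \<le> N}"
  have QQ: "Q0 \<subseteq> Q" by (auto simp: Q0_def Q_def)
  have fQ: "finite Q" by (auto simp: Q_def)
  have p1: "psum2 N f g h * psum2 N f' g h = sum F Q"
    unfolding psum2_def sum.cartesian_product Q_def sum_product F_def
    by (intro sum.cong refl) (auto simp: power_add algebra_simps simp flip: fps_const_mult)
  have "psum2 N (f * f') g h = (\<Sum>I\<le>N. \<Sum>J\<le>N. \<Sum>j\<le>J. \<Sum>i\<le>I. F ((i,j),(I-i,J-j)))"
    unfolding psum2_def
    by (intro sum.cong refl, unfold cf2_mult F_def)
       (simp add: const2_sum sum_distrib_right)
  also have "\<dots> = (\<Sum>(I,J,j,i)\<in>(SIGMA I:{..N}. SIGMA J:{..N}. SIGMA j:{..J}. {..I}). F ((i,j),(I-i,J-j)))"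
    by (simp add: sum.Sigma)
  also have "\<dots> = sum F Q0"
    by (rule sum.reindex_bij_witness[where i="\<lambda>((i,j),(i',j')). (i+i',j+j',j,i)" and j="\<lambda>(I,J,j,i). ((i,j),(I-i,J-j))"])
       (auto simp: Q0_def)
  finally have p2: "psum2 N (f * f') g h = sum F Q0" .
  have "psum2 N f g h * psum2 N f' g h - psum2 N (f * f') g h = sum F (Q - Q0)"
    using p1 p2 sum_diff[OF fQ QQ, of F] by simp
  also have "ord_ge \<dots> (Suc N)"
  proof (rule ord_ge_sum)
    fix x assume x: "x \<in> Q - Q0"
    obtain i j i' j' where [simp]: "x = ((i,j),(i',j'))" by (metis prod.exhaust)
    have "ord_ge (g ^ (i+i') * h ^ (j+j')) ((i+i')+(j+j'))"
      by (intro ord_ge_mult ord_ge_power assms)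
    moreover have "Suc N \<le> (i+i')+(j+j')" using x by (auto simp: Q0_def)
    ultimately have "ord_ge (g ^ (i+i') * h ^ (j+j')) (Suc N)" by (rule ord_ge_mono)
    then show "ord_ge (F x) (Suc N)"
      unfolding F_def by (simp add: ord_ge_mult_left)
  qed
  finally show ?thesis .
qed

lemma subst2_add: "subst2 (f + f') g h = subst2 f g h + subst2 f' g h"
  by (rule cf2_eqI) (simp add: cf2_subst2 algebra_simps sum.distrib)

lemma subst2_minus: "subst2 (- f) g h = - subst2 f g h"
  by (rule cf2_eqI) (simp add: cf2_subst2 sum_negf)

lemma subst2_0 [simp]: "subst2 0 g h = 0"
  by (rule cf2_eqI) (simp add: cf2_subst2)

lemma subst2_mult:
  assumes "ord_ge g 1" "ord_ge h 1"
  shows "subst2 (f * f') g h = subst2 f g h * subst2 f' g h"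
proof (rule ord_ge_eqI)
  fix N
  let ?s = "\<lambda>f. subst2 f g h" and ?p = "\<lambda>f. psum2 N f g h"
  have e: "?s (f * f') - ?s f * ?s f' = (?s (f * f') - ?p (f * f')) - (?p f * ?p f' - ?p (f * f'))
     - (?s f - ?p f) * ?s f' - ?p f * (?s f' - ?p f')"
    by (simp add: algebra_simps)
  have "ord_ge (?s (f * f') - ?s f * ?s f') (Suc N)"
    unfolding e by (intro ord_ge_diff psum2_mult subst2_psum2 assms ord_ge_mult_left ord_ge_mult_right)
  then show "ord_ge (?s (f * f') - ?s f * ?s f') N" by (rule ord_ge_mono) simp
qed

lemma cf2_const: "cf2 (fps_const (fps_const c)) i j = (if i = 0 \<and> j = 0 then c else 0)"
  by (simp add: cf2_def)

lemma cf2_1: "cf2 1 i j = (if i = 0 \<and> j = 0 then 1 else 0)"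
  by (simp add: cf2_def)

lemma subst2_const [simp]: "subst2 (fps_const (fps_const c)) g h = fps_const (fps_const c)"
proof (rule cf2_eqI)
  fix m n
  have "cf2 (subst2 (fps_const (fps_const c)) g h) m n
     = (\<Sum>i\<le>m+n. \<Sum>j\<le>m+n. if i = 0 then if j = 0 then c * cf2 1 m n else 0 else 0)"
    unfolding cf2_subst2 by (intro sum.cong refl) (auto simp: cf2_const)
  also have "\<dots> = (\<Sum>i\<le>m+n. if i = 0 then \<Sum>j\<le>m+n. if j = 0 then c * cf2 1 m n else 0 else 0)"
    by (intro sum.cong refl) auto
  also have "\<dots> = cf2 (fps_const (fps_const c)) m n" by (simp add: cf2_const cf2_1)
  finally show "cf2 (subst2 (fps_const (fps_const c)) g h) m n = cf2 (fps_const (fps_const c)) m n" .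
qed

lemma subst2_1 [simp]: "subst2 1 g h = 1"
  using subst2_const[of 1 g h] by simp

lemma cf2_X_outer: "cf2 fps_X i j = (if i = 0 \<and> j = 1 then 1 else 0)"
  by (simp add: cf2_def fps_X_def)

lemma cf2_X_inner: "cf2 (fps_const fps_X) i j = (if i = 1 \<and> j = 0 then 1 else 0)"
  by (simp add: cf2_def fps_X_def)

lemma ord_ge_X [simp]: "ord_ge fps_X (Suc 0)" "ord_ge (fps_const fps_X) (Suc 0)"
  by (simp_all add: ord_ge_def cf2_X_outer cf2_X_inner)

lemma subst2_mono:
  assumes "ord_ge g 1" "ord_ge h 1"
    and f: "\<And>i j. cf2 f i j = (if i = a \<and> j = b then 1 else 0)"
  shows "subst2 f g h = g ^ a * h ^ b"
proof (rule cf2_eqI)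
  fix m n
  have z: "cf2 (g ^ a * h ^ b) m n = 0" if "m + n < a + b"
    using ord_ge_mult[OF ord_ge_power[OF assms(1), of a] ord_ge_power[OF assms(2), of b]] that
    by (simp add: ord_ge_def)
  have "cf2 (subst2 f g h) m n = (\<Sum>i\<le>m+n. \<Sum>j\<le>m+n. if i = a then if j = b then cf2 (g ^ a * h ^ b) m n else 0 else 0)"
    unfolding cf2_subst2 by (intro sum.cong refl) (auto simp: f)
  also have "\<dots> = (\<Sum>i\<le>m+n. if i = a then \<Sum>j\<le>m+n. if j = b then cf2 (g ^ a * h ^ b) m n else 0 else 0)"
    by (intro sum.cong refl) auto
  also have "\<dots> = cf2 (g ^ a * h ^ b) m n" using z by auto
  finally show "cf2 (subst2 f g h) m n = cf2 (g ^ a * h ^ b) m n" .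
qed

lemma subst2_X_outer: "ord_ge g 1 \<Longrightarrow> ord_ge h 1 \<Longrightarrow> subst2 fps_X g h = h"
  using subst2_mono[of g h fps_X 0 1] by (simp add: cf2_X_outer)

lemma subst2_X_inner: "ord_ge g 1 \<Longrightarrow> ord_ge h 1 \<Longrightarrow> subst2 (fps_const fps_X) g h = g"
  using subst2_mono[of g h "fps_const fps_X" 1 0] by (simp add: cf2_X_inner)

lemma subst2_power: "ord_ge g 1 \<Longrightarrow> ord_ge h 1 \<Longrightarrow> subst2 (f ^ n) g h = subst2 f g h ^ n"
  by (induction n) (simp_all add: subst2_mult)

abbreviation tt :: "complex fps fps" where "tt \<equiv> fps_const fps_X"
abbreviation ss :: "complex fps fps" where "ss \<equiv> fps_X"

type_synonym K = "complex fps fps fract"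

definition emb :: "complex fps fps \<Rightarrow> K" where "emb f = Fract f 1"

text \<open>
  \<open>K2\<close> is the localisation of \<open>\<complex>[[t, s]]\<close> at \<open>ts\<close>, inside the fraction field \<open>K\<close>; \<open>A_K\<close> is its structure map
  as an algebra over \<open>\<complex>[[a]]\<close>, given by \<open>a = t - s\<close>. In it, \<open>p(a)\<close> is read as a series \<open>fps_const p\<close> in the
  inner variable only, so what is substituted for the outer variable is irrelevant.
\<close>

definition K2 :: "K set" where "K2 = {Fract f ((tt * ss) ^ n) | f n. True}"

definition A_K :: "complex fps \<Rightarrow> K"
  where "A_K p = emb (subst2 (fps_const p) (tt - ss) 0)"

lemma ord_ge_ts [simp]: "ord_ge (tt - ss) (Suc 0)" "ord_ge (tt + ss) (Suc 0)"
  by (simp_all add: ord_ge_diff ord_ge_add)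

lemma emb_simps [simp]: "emb 0 = 0" "emb 1 = 1" "emb (f + g) = emb f + emb g"
  "emb (f * g) = emb f * emb g" "emb (- f) = - emb f" "emb (f - g) = emb f - emb g"
  "emb f = emb g \<longleftrightarrow> f = g"
  by (simp_all add: emb_def Zero_fract_def One_fract_def eq_fract)

lemma emb_power [simp]: "emb (f ^ n) = emb f ^ n"
  by (induction n) auto

lemma Fract_emb: "Fract f g = emb f / emb g"
  by (simp add: emb_def)

lemma A_K_add [simp]: "A_K (p + q) = A_K p + A_K q"
  by (simp add: A_K_def subst2_add flip: fps_const_add)
lemma A_K_mult [simp]: "A_K (p * q) = A_K p * A_K q"
  by (simp add: A_K_def subst2_mult flip: fps_const_mult)
lemma A_K_minus [simp]: "A_K (- p) = - A_K p"
  by (simp add: A_K_def subst2_minus flip: fps_const_neg)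
lemma A_K_diff [simp]: "A_K (p - q) = A_K p - A_K q"
  using A_K_add[of p "- q"] by simp
lemma A_K_0 [simp]: "A_K 0 = 0"
  by (simp add: A_K_def)
lemma A_K_1 [simp]: "A_K 1 = 1"
  by (simp add: A_K_def)
lemma A_K_X: "A_K fps_X = emb tt - emb ss"
  by (simp add: A_K_def subst2_X_inner)

definition der_ts :: "complex fps fps \<Rightarrow> complex fps fps"
  where "der_ts f = Abs_fps (\<lambda>j. fps_deriv (fps_nth f j)) + fps_deriv f"

lemma der0_add: "der_ts (f + g) = der_ts f + der_ts g"
  by (simp add: der_ts_def fps_eq_iff algebra_simps)

lemma der0_mult: "der_ts (f * g) = der_ts f * g + f * der_ts g"
proof -
  have "Abs_fps (\<lambda>j. fps_deriv (fps_nth (f * g) j)) =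
     Abs_fps (\<lambda>j. fps_deriv (fps_nth f j)) * g + f * Abs_fps (\<lambda>j. fps_deriv (fps_nth g j))"
    by (rule fps_ext) (simp add: fps_mult_nth fps_deriv_sum sum.distrib add.commute)
  then show ?thesis by (simp add: der_ts_def algebra_simps)
qed

lemma der0_minus: "der_ts (- f) = - der_ts f"
  by (simp add: der_ts_def fps_eq_iff algebra_simps)

lemma der0_diff: "der_ts (f - g) = der_ts f - der_ts g"
  using der0_add[of f "-g"] by (simp add: der0_minus)

lemma der0_const: "der_ts (fps_const (fps_const c)) = 0"
  by (simp add: der_ts_def fps_eq_iff)

lemma der0_1 [simp]: "der_ts 1 = 0"
  using der0_const[of 1] by simp

lemma der0_0 [simp]: "der_ts 0 = 0"
  using der0_const[of 0] by simp

lemma der0_sum: "der_ts (sum f A) = (\<Sum>x\<in>A. der_ts (f x))"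
  by (induction A rule: infinite_finite_induct) (simp_all add: der0_add)

lemma der0_t [simp]: "der_ts tt = 1" and der0_s [simp]: "der_ts ss = 1"
  by (auto simp: der_ts_def fps_eq_iff fps_X_def)

lemma der0_power: "der_ts (f ^ n) = of_nat n * f ^ (n - 1) * der_ts f"
proof (induction n)
  case (Suc n)
  then show ?case by (cases n) (simp_all add: der0_mult algebra_simps)
qed simp

lemma cf2_der0: "cf2 (der_ts f) m n = of_nat (Suc m) * cf2 f (Suc m) n + of_nat (Suc n) * cf2 f m (Suc n)"
  by (simp add: cf2_def der_ts_def fps_of_nat[symmetric] del: of_nat_Suc)

lemma ord_ge_der0: "ord_ge f (Suc d) \<Longrightarrow> ord_ge (der_ts f) d"
  by (simp add: ord_ge_def cf2_der0)

lemma der0_A: "der_ts (subst2 (fps_const p) (tt - ss) 0) = 0"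
proof (rule ord_ge_eqI)
  fix N
  let ?S = "subst2 (fps_const p) (tt - ss) 0" and ?P = "psum2 N (fps_const p) (tt - ss) 0"
  have "der_ts ?P = 0"
    unfolding psum2_def der0_sum
    by (intro sum.neutral ballI) (simp add: der0_mult der0_const der0_power der0_diff power_0_left)
  then have "der_ts ?S - 0 = der_ts (?S - ?P)" by (simp add: der0_diff)
  also have "ord_ge \<dots> N"
    by (intro ord_ge_der0 subst2_psum2) simp_all
  finally show "ord_ge (der_ts ?S - 0) N" .
qed

text \<open>\<open>der_K\<close> extends \<open>\<partial>/\<partial>t + \<partial>/\<partial>s\<close> by the quotient rule; it is linear over \<open>A\<close> by \<open>der_A_mult\<close> below.\<close>

definition der_K :: "K \<Rightarrow> K"
  where "der_K f = (THE g. \<exists>p q. q \<noteq> 0 \<and> f = Fract p q \<and> g = Fract (der_ts p * q - p * der_ts q) (q * q))"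

lemma der_Fract:
  assumes "q \<noteq> 0"
  shows "der_K (Fract p q) = Fract (der_ts p * q - p * der_ts q) (q * q)"
  unfolding der_K_def
proof (rule the_equality)
  fix g assume "\<exists>p' q'. q' \<noteq> 0 \<and> Fract p q = Fract p' q' \<and> g = Fract (der_ts p' * q' - p' * der_ts q') (q' * q')"
  then obtain p' q' where q': "q' \<noteq> 0" and e: "Fract p q = Fract p' q'"
    and g: "g = Fract (der_ts p' * q' - p' * der_ts q') (q' * q')" by blast
  have e1: "p * q' = p' * q" using e assms q' by (simp add: eq_fract)
  then have "der_ts (p * q') = der_ts (p' * q)" by simp
  then have e2: "der_ts p * q' + p * der_ts q' = der_ts p' * q + p' * der_ts q" by (simp add: der0_mult)
  have "(der_ts p' * q' - p' * der_ts q') * (q * q) = q' * q * (der_ts p' * q) - der_ts q' * q * (p' * q)"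
    by (simp add: algebra_simps)
  also have "\<dots> = q' * q * (der_ts p * q' + p * der_ts q' - p' * der_ts q) - der_ts q' * q * (p * q')"
    by (simp add: e1[symmetric] e2 eq_diff_eq)
  also have "\<dots> = q' * q' * q * der_ts p - q' * der_ts q * (p' * q)"
    by (simp add: algebra_simps)
  also have "\<dots> = (der_ts p * q - p * der_ts q) * (q' * q')"
    by (simp add: e1[symmetric] algebra_simps)
  finally show "g = Fract (der_ts p * q - p * der_ts q) (q * q)"
    using g assms q' by (simp add: eq_fract)
qed (use assms in blast)

lemma der_emb: "der_K (emb f) = emb (der_ts f)"
  by (simp add: emb_def der_Fract)

lemma der_add [simp]: "der_K (f + g) = der_K f + der_K g"
proof -
  obtain p q where f: "f = Fract p q" "q \<noteq> 0" by (metis Fract_cases)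
  obtain p' q' where g: "g = Fract p' q'" "q' \<noteq> 0" by (metis Fract_cases)
  show ?thesis using f g by (simp add: der_Fract eq_fract der0_add der0_mult algebra_simps)
qed

lemma der_mult: "der_K (f * g) = der_K f * g + f * der_K g"
proof -
  obtain p q where f: "f = Fract p q" "q \<noteq> 0" by (metis Fract_cases)
  obtain p' q' where g: "g = Fract p' q'" "q' \<noteq> 0" by (metis Fract_cases)
  show ?thesis using f g by (simp add: der_Fract eq_fract der0_add der0_mult algebra_simps)
qed

lemma der_A [simp]: "der_K (A_K p) = 0"
  by (simp add: A_K_def der_emb der0_A)

lemma der_A_mult: "der_K (A_K p * f) = A_K p * der_K f"
  by (simp add: der_mult)

lemma der_0 [simp]: "der_K 0 = 0"
  using der_emb[of 0] by simp
lemma der_1 [simp]: "der_K 1 = 0"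
  using der_emb[of 1] by simp

text \<open>
  With \<open>Q = \<complex>((a))\<close>, both \<open>Q((t))\<close> and \<open>Q((s))\<close> are the type \<open>complex fls fls\<close> (inner variable \<open>a\<close>).
  A substitution \<open>\<phi>\<close> out of \<open>\<complex>[[t, s]]\<close> extends to \<open>K2\<close> by inverting \<open>\<phi> (ts)\<close>. In \<open>E_t\<close> the outer variable is
  \<open>t\<close> and \<open>s\<close> becomes \<open>t - a\<close>; in \<open>E_s\<close> the outer variable is \<open>s\<close> and \<open>t\<close> becomes \<open>s + a\<close>.
\<close>

definition to_Q :: "complex fps fps \<Rightarrow> complex fls fls"
  where "to_Q f = fps_to_fls (Abs_fps (\<lambda>n. fps_to_fls (fps_nth f n)))"

definition expand_K2 :: "(complex fps fps \<Rightarrow> complex fps fps) \<Rightarrow> K \<Rightarrow> complex fls fls"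
  where "expand_K2 \<phi> f = (THE y. \<exists>p n. f = Fract p ((tt * ss) ^ n) \<and> y = to_Q (\<phi> p) / to_Q (\<phi> ((tt * ss) ^ n)))"

definition E_t :: "K \<Rightarrow> complex fls fls"
  where "E_t = expand_K2 (\<lambda>f. subst2 f fps_X (fps_X - fps_const fps_X))"
definition E_s :: "K \<Rightarrow> complex fls fls"
  where "E_s = expand_K2 (\<lambda>f. subst2 f (fps_X + fps_const fps_X) fps_X)"

definition Res2 :: "K \<Rightarrow> complex fls"
  where "Res2 f = fls_nth (E_t f) (- 1) + fls_nth (E_s f) (- 1)"

lemma fps_to_fls_sum': "fps_to_fls (sum f A) = (\<Sum>x\<in>A. fps_to_fls (f x))"
  by (induction A rule: infinite_finite_induct) simp_all

lemma A_Q_simps [simp]: "to_Q 0 = 0" "to_Q 1 = 1" "to_Q (f + g) = to_Q f + to_Q g"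
  "to_Q (f * g) = to_Q f * to_Q g" "to_Q (- f) = - to_Q f"
proof -
  have z: "Abs_fps (\<lambda>n. fps_to_fls (fps_nth (f * g) n))
     = Abs_fps (\<lambda>n. fps_to_fls (fps_nth f n)) * Abs_fps (\<lambda>n. fps_to_fls (fps_nth g n))"
    by (rule fps_ext) (simp add: fps_mult_nth fps_to_fls_sum' fls_times_fps_to_fls)
  show "to_Q (f * g) = to_Q f * to_Q g"
    unfolding to_Q_def z by (simp add: fls_times_fps_to_fls)
  have z: "Abs_fps (\<lambda>n. fps_to_fls (fps_nth (f + g) n))
     = Abs_fps (\<lambda>n. fps_to_fls (fps_nth f n)) + Abs_fps (\<lambda>n. fps_to_fls (fps_nth g n))"
    by (rule fps_ext) (simp)
  show "to_Q (f + g) = to_Q f + to_Q g"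
    unfolding to_Q_def z by (simp)
  have z: "Abs_fps (\<lambda>n. fps_to_fls (fps_nth (- f) n))
     = - Abs_fps (\<lambda>n. fps_to_fls (fps_nth f n))"
    by (rule fps_ext) (simp)
  show "to_Q (- f) = - to_Q f"
    unfolding to_Q_def z by (simp)
  have z: "Abs_fps (\<lambda>n. fps_to_fls (fps_nth (1::complex fps fps) n)) = 1"
    by (rule fps_ext) auto
  show "to_Q 1 = 1" unfolding to_Q_def z by simp
  have z: "Abs_fps (\<lambda>n. fps_to_fls (fps_nth (0::complex fps fps) n)) = 0"
    by (rule fps_ext) auto
  show "to_Q 0 = 0" unfolding to_Q_def z by simp
qed

lemma A_Q_power [simp]: "to_Q (f ^ n) = to_Q f ^ n"
  by (induction n) auto

lemma A_Q_eq_0 [simp]: "to_Q f = 0 \<longleftrightarrow> f = 0"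
proof
  assume "to_Q f = 0"
  then have "Abs_fps (\<lambda>n. fps_to_fls (fps_nth f n)) = 0"
    by (simp add: to_Q_def)
  then show "f = 0" by (simp add: fps_eq_iff)
qed simp

lemma A_Q_const: "to_Q (fps_const p) = fls_const (fps_to_fls p)"
proof -
  have "Abs_fps (\<lambda>n. fps_to_fls (fps_nth (fps_const p) n)) = fps_const (fps_to_fls p)"
    by (rule fps_ext) auto
  then show ?thesis by (simp add: to_Q_def)
qed

lemma fls_nth_A_Q_neg: "n < 0 \<Longrightarrow> fls_nth (to_Q f) n = 0"
  by (simp add: to_Q_def)

definition shom :: "(complex fps fps \<Rightarrow> complex fps fps) \<Rightarrow> bool"
  where "shom \<phi> \<longleftrightarrow> (\<forall>f g. \<phi> (f + g) = \<phi> f + \<phi> g) \<and> (\<forall>f g. \<phi> (f * g) = \<phi> f * \<phi> g) \<and> \<phi> 1 = 1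
     \<and> \<phi> (tt * ss) \<noteq> 0"

lemma shom_power: "shom \<phi> \<Longrightarrow> \<phi> (f ^ n) = \<phi> f ^ n"
  by (induction n) (auto simp: shom_def)

lemma tsn0 [simp]: "tt \<noteq> 0" "tt * ss \<noteq> 0" "emb tt \<noteq> 0" "emb ss \<noteq> 0"
  using emb_simps(7)[of tt 0] emb_simps(7)[of ss 0] by auto

lemma expand_Fract:
  assumes \<phi>: "shom \<phi>"
  shows "expand_K2 \<phi> (Fract p ((tt * ss) ^ n)) = to_Q (\<phi> p) / to_Q (\<phi> (tt * ss)) ^ n"
  unfolding expand_K2_def
proof (rule the_equality)
  show "\<exists>p' n'. Fract p ((tt * ss) ^ n) = Fract p' ((tt * ss) ^ n') \<and> to_Q (\<phi> p) / to_Q (\<phi> (tt * ss)) ^ n = to_Q (\<phi> p') / to_Q (\<phi> ((tt * ss) ^ n'))"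
    using shom_power[OF \<phi>] by (metis A_Q_power)
next
  fix y assume "\<exists>p' n'. Fract p ((tt * ss) ^ n) = Fract p' ((tt * ss) ^ n') \<and> y = to_Q (\<phi> p') / to_Q (\<phi> ((tt * ss) ^ n'))"
  then obtain p' n' where e: "Fract p ((tt * ss) ^ n) = Fract p' ((tt * ss) ^ n')" and y: "y = to_Q (\<phi> p') / to_Q (\<phi> (tt * ss)) ^ n'"
    using shom_power[OF \<phi>] by auto
  from e have "p * (tt * ss) ^ n' = p' * (tt * ss) ^ n" by (subst (asm) eq_fract) simp_all
  then have "\<phi> (p * (tt * ss) ^ n') = \<phi> (p' * (tt * ss) ^ n)" by simp
  then have "\<phi> p * \<phi> (tt * ss) ^ n' = \<phi> p' * \<phi> (tt * ss) ^ n"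
    using \<phi> shom_power[OF \<phi>, of "tt * ss"] unfolding shom_def by metis
  then have "to_Q (\<phi> p * \<phi> (tt * ss) ^ n') = to_Q (\<phi> p' * \<phi> (tt * ss) ^ n)" by simp
  moreover have "to_Q (\<phi> (tt * ss)) \<noteq> 0" using \<phi> unfolding shom_def A_Q_eq_0 by blast
  ultimately show "y = to_Q (\<phi> p) / to_Q (\<phi> (tt * ss)) ^ n"
    unfolding y by (simp add: frac_eq_eq)
qed

lemma K2_cases: assumes "f \<in> K2" obtains p n where "f = Fract p ((tt * ss) ^ n)"
  using assms unfolding K2_def by blast

lemma K2_emb [simp]: "emb f \<in> K2"
  unfolding K2_def emb_def by (rule CollectI, rule exI[of _ f], rule exI[of _ 0]) simp

lemma K2_mult: "f \<in> K2 \<Longrightarrow> g \<in> K2 \<Longrightarrow> f * g \<in> K2"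
proof -
  assume "f \<in> K2" "g \<in> K2"
  then obtain p n q m where "f = Fract p ((tt * ss) ^ n)" "g = Fract q ((tt * ss) ^ m)"
    unfolding K2_def by blast
  then have "f * g = Fract (p * q) ((tt * ss) ^ (n + m))"
    by (simp only: mult_fract power_add)
  then show "f * g \<in> K2" unfolding K2_def by blast
qed

lemma K2_add: "f \<in> K2 \<Longrightarrow> g \<in> K2 \<Longrightarrow> f + g \<in> K2"
proof -
  assume "f \<in> K2" "g \<in> K2"
  then obtain p n q m where "f = Fract p ((tt * ss) ^ n)" "g = Fract q ((tt * ss) ^ m)"
    unfolding K2_def by blast
  then have "f + g = Fract (p * (tt * ss) ^ m + q * (tt * ss) ^ n) ((tt * ss) ^ (n + m))"
    by (simp only: add_fract tsn0 power_not_zero not_False_eq_True power_add)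
  then show "f + g \<in> K2" unfolding K2_def by blast
qed

lemma K2_A [simp]: "A_K p \<in> K2"
  by (simp add: A_K_def)

lemma frac_add_aux:
  fixes P Q c :: "'a::field" assumes "c \<noteq> 0"
  shows "(P * c ^ m + Q * c ^ n) / c ^ (n + m) = P / c ^ n + Q / c ^ m"
  using assms by (simp add: field_simps power_add)

lemma expand_add:
  assumes \<phi>: "shom \<phi>" and "f \<in> K2" "g \<in> K2"
  shows "expand_K2 \<phi> (f + g) = expand_K2 \<phi> f + expand_K2 \<phi> g"
proof -
  obtain p n q m where f: "f = Fract p ((tt * ss) ^ n)" and g: "g = Fract q ((tt * ss) ^ m)"
    using assms unfolding K2_def by blast
  have e: "f + g = Fract (p * (tt * ss) ^ m + q * (tt * ss) ^ n) ((tt * ss) ^ (n + m))"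
    unfolding f g by (simp only: add_fract tsn0 power_not_zero not_False_eq_True power_add)
  have nz: "to_Q (\<phi> (tt * ss)) \<noteq> 0" using \<phi> unfolding shom_def A_Q_eq_0 by blast
  have h: "\<phi> (p * (tt * ss) ^ m + q * (tt * ss) ^ n) = \<phi> p * \<phi> (tt * ss) ^ m + \<phi> q * \<phi> (tt * ss) ^ n"
    using \<phi> shom_power[OF \<phi>, of "tt * ss"] unfolding shom_def by metis
  show ?thesis unfolding e unfolding f g expand_Fract[OF \<phi>] h
    unfolding A_Q_simps A_Q_power by (rule frac_add_aux[OF nz])
qed

lemma expand_mult:
  assumes \<phi>: "shom \<phi>" and "f \<in> K2" "g \<in> K2"
  shows "expand_K2 \<phi> (f * g) = expand_K2 \<phi> f * expand_K2 \<phi> g"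
proof -
  obtain p n q m where f: "f = Fract p ((tt * ss) ^ n)" and g: "g = Fract q ((tt * ss) ^ m)"
    using assms unfolding K2_def by blast
  have e: "f * g = Fract (p * q) ((tt * ss) ^ (n + m))"
    unfolding f g by (simp only: mult_fract power_add)
  have h: "\<phi> (p * q) = \<phi> p * \<phi> q" using \<phi> unfolding shom_def by metis
  show ?thesis unfolding e unfolding f g expand_Fract[OF \<phi>] h
    unfolding A_Q_simps A_Q_power power_add times_divide_times_eq ..
qed

lemma expand_emb:
  assumes \<phi>: "shom \<phi>"
  shows "expand_K2 \<phi> (emb f) = to_Q (\<phi> f)"
  using expand_Fract[OF \<phi>, of f 0] by (simp add: emb_def)

lemma cf2_tsn: "cf2 (tt ^ i * ss ^ j) m n = (if m = i \<and> n = j then 1 else 0)"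
  by (simp add: cf2_def fps_const_power fps_X_power_mult_right_nth fps_X_power_iff)

lemma subst2_id: "subst2 f tt ss = f"
proof (rule cf2_eqI)
  fix m n
  have "cf2 (subst2 f tt ss) m n = (\<Sum>i\<le>m+n. \<Sum>j\<le>m+n. if i = m then if j = n then cf2 f m n else 0 else 0)"
    unfolding cf2_subst2 cf2_tsn by (intro sum.cong refl) auto
  also have "\<dots> = (\<Sum>i\<le>m+n. if i = m then \<Sum>j\<le>m+n. if j = n then cf2 f m n else 0 else 0)"
    by (intro sum.cong refl) auto
  also have "\<dots> = cf2 f m n" by simp
  finally show "cf2 (subst2 f tt ss) m n = cf2 f m n" .
qed

lemma ord_ge_subst2:
  assumes "ord_ge g 1" "ord_ge h 1" "ord_ge f d"
  shows "ord_ge (subst2 f g h) d"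
  unfolding ord_ge_def cf2_subst2
proof (intro allI impI sum.neutral ballI)
  fix m n i j :: nat assume mn: "m + n < d"
  show "cf2 f i j * cf2 (g ^ i * h ^ j) m n = 0"
  proof (cases "i + j < d")
    case True then show ?thesis using assms(3) by (simp add: ord_ge_def)
  next
    case False
    then have "m + n < i + j" using mn by simp
    then show ?thesis
      using ord_ge_mult[OF ord_ge_power[OF assms(1), of i] ord_ge_power[OF assms(2), of j]]
      by (simp add: ord_ge_def)
  qed
qed

lemma subst2_sum: "subst2 (sum f A) g h = (\<Sum>x\<in>A. subst2 (f x) g h)"
  by (induction A rule: infinite_finite_induct) (simp_all add: subst2_add)

lemma subst2_diff: "subst2 (f - f') g h = subst2 f g h - subst2 f' g h"
  using subst2_add[of f "- f'" g h] by (simp add: subst2_minus)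

lemma subst2_A:
  assumes o: "ord_ge g 1" "ord_ge h 1" and gh: "g - h = tt"
  shows "subst2 (subst2 (fps_const p) (tt - ss) 0) g h = fps_const p"
proof (rule ord_ge_eqI)
  fix N
  let ?S = "subst2 (fps_const p) (tt - ss) 0" and ?P = "psum2 N (fps_const p) (tt - ss) 0"
  have e: "subst2 ?P g h = psum2 N (fps_const p) tt ss"
    unfolding psum2_def subst2_sum
  proof (intro sum.cong refl)
    fix i j
    show "subst2 (fps_const (fps_const (cf2 (fps_const p) i j)) * ((tt - ss) ^ i * 0 ^ j)) g h
      = fps_const (fps_const (cf2 (fps_const p) i j)) * (tt ^ i * ss ^ j)"
      by (cases "j = 0") (simp_all add: subst2_mult[OF o] subst2_power[OF o] subst2_diff
           subst2_X_inner[OF o] subst2_X_outer[OF o] gh cf2_def)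
  qed
  have "ord_ge (subst2 (?S - ?P) g h) (Suc N)"
    by (intro ord_ge_subst2 o subst2_psum2) auto
  moreover have "ord_ge (subst2 (fps_const p) tt ss - psum2 N (fps_const p) tt ss) (Suc N)"
    by (intro subst2_psum2) auto
  ultimately have "ord_ge (subst2 (?S - ?P) g h - (subst2 (fps_const p) tt ss - psum2 N (fps_const p) tt ss)) (Suc N)"
    by (rule ord_ge_diff)
  then have "ord_ge (subst2 ?S g h - fps_const p) (Suc N)"
    by (simp only: subst2_diff e subst2_id diff_diff_eq2 diff_add_cancel)
  then show "ord_ge (subst2 ?S g h - fps_const p) N" by (rule ord_ge_mono) simp
qed

lemma ord_ge_ts' [simp]: "ord_ge (ss - tt) (Suc 0)" "ord_ge (ss + tt) (Suc 0)"
  by (simp_all add: ord_ge_diff ord_ge_add)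

lemma st_nz: "ss - tt \<noteq> 0" "ss + tt \<noteq> 0"
proof -
  have "cf2 (ss - tt) 0 1 \<noteq> 0" "cf2 (ss + tt) 0 1 \<noteq> 0"
    by (simp_all add: cf2_X_inner cf2_X_outer)
  then show "ss - tt \<noteq> 0" "ss + tt \<noteq> 0" by (metis cf2_simps(1))+
qed

lemma shom_subst2:
  assumes "ord_ge g 1" "ord_ge h 1" "g \<noteq> 0" "h \<noteq> 0"
  shows "shom (\<lambda>f. subst2 f g h)"
  unfolding shom_def subst2_mult[OF assms(1,2)] subst2_add subst2_X_inner[OF assms(1,2)]
    subst2_X_outer[OF assms(1,2)] subst2_1 using assms by (auto simp only: mult_eq_0_iff)

lemma shom_t: "shom (\<lambda>f. subst2 f ss (ss - tt))"
  by (rule shom_subst2) (use st_nz in auto)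

lemma shom_s: "shom (\<lambda>f. subst2 f (ss + tt) ss)"
  by (rule shom_subst2) (use st_nz in auto)

lemma E_t_A: "E_t (A_K p) = fls_const (fps_to_fls p)"
  unfolding E_t_def A_K_def expand_emb[OF shom_t] by (simp add: subst2_A A_Q_const)

lemma E_s_A: "E_s (A_K p) = fls_const (fps_to_fls p)"
  unfolding E_s_def A_K_def expand_emb[OF shom_s] by (simp add: subst2_A A_Q_const)

lemma Res2_add: "f \<in> K2 \<Longrightarrow> g \<in> K2 \<Longrightarrow> Res2 (f + g) = Res2 f + Res2 g"
  by (simp add: Res2_def E_t_def E_s_def expand_add[OF shom_t] expand_add[OF shom_s])

lemma Res2_A: "f \<in> K2 \<Longrightarrow> Res2 (A_K p * f) = fps_to_fls p * Res2 f"
  using expand_mult[OF shom_t, of "A_K p" f] expand_mult[OF shom_s, of "A_K p" f]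
  by (simp add: Res2_def E_t_A E_s_A E_t_def[symmetric] E_s_def[symmetric] algebra_simps)

lemma Res2_emb: "Res2 (emb f) = 0"
  by (simp add: Res2_def E_t_def E_s_def expand_emb[OF shom_t] expand_emb[OF shom_s] fls_nth_A_Q_neg)

definition u_K :: "int \<Rightarrow> K" where "u_K n = emb tt powi n * emb ss powi n"
definition v_K :: "int \<Rightarrow> K" where "v_K n = emb tt powi n * emb ss powi (n + 1)"
definition x_K :: "int \<Rightarrow> K" where "x_K n = emb tt powi n * emb ss powi n"
definition y_K :: "int \<Rightarrow> K" where "y_K n = emb tt powi (n + 1) * emb ss powi n"

text \<open>
  Half-integral indices are doubled throughout: \<open>w_K i\<close> is \<open>w\<^sub>m\<close> and \<open>z_K i\<close> is \<open>z\<^sub>m\<close> with \<open>m = i/2\<close>.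
\<close>

definition w_K :: "int \<Rightarrow> K" where "w_K i = (if even i then u_K (i div 2) else v_K ((i - 1) div 2))"
definition z_K :: "int \<Rightarrow> K" where "z_K i = (if even i then x_K (i div 2) else y_K ((i - 1) div 2))"

interpretation AK: module "\<lambda>p f. A_K p * f"
  by unfold_locales (simp_all add: algebra_simps)

lemma K2_power: "f \<in> K2 \<Longrightarrow> f ^ n \<in> K2"
  by (induction n) (use K2_emb[of 1] in \<open>auto intro: K2_mult\<close>)

lemma K2_inverse_ts: "inverse (emb tt) \<in> K2" "inverse (emb ss) \<in> K2"
proof -
  have "inverse (emb tt) = Fract ss ((tt * ss) ^ 1)" "inverse (emb ss) = Fract tt ((tt * ss) ^ 1)"
    using tsn0(3,4) unfolding Fract_emb power_one_right emb_simps by (simp_all add: field_simps)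
  then show "inverse (emb tt) \<in> K2" "inverse (emb ss) \<in> K2" unfolding K2_def by blast+
qed

lemma K2_powi: "emb tt powi n \<in> K2" "emb ss powi n \<in> K2"
  by (auto simp: power_int_def intro!: K2_power K2_inverse_ts)

lemma u_K2 [simp]: "u_K n \<in> K2" and v_K2 [simp]: "v_K n \<in> K2"
  by (auto simp: u_K_def v_K_def intro!: K2_mult K2_powi)

lemma w_K2 [simp]: "w_K n \<in> K2"
  by (simp add: w_K_def)

abbreviation a_K :: K where "a_K \<equiv> A_K fps_X"

lemma t_eq: "emb tt = emb ss + a_K"
  by (simp add: A_K_X)

lemma uv_rules:
  "u_K m * u_K n = u_K (m + n)"
  "u_K m * v_K n = v_K (m + n)" "v_K n * u_K m = v_K (m + n)"
  "v_K m * v_K n = u_K (m + n + 1) - a_K * v_K (m + n)"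
  "y_K n = v_K n + a_K * u_K n"
  "v_K n = emb ss * u_K n"
proof -
  have s: "emb ss powi (k + 1) = emb ss powi k * emb ss" "emb tt powi (k + 1) = emb tt powi k * emb tt" for k
    by (simp_all add: power_int_add)
  show "u_K m * u_K n = u_K (m + n)"
    by (simp add: u_K_def power_int_add)
  then show 1: "u_K m * v_K n = v_K (m + n)"
    by (simp add: u_K_def v_K_def power_int_add)
  show "v_K n * u_K m = v_K (m + n)" unfolding 1[symmetric] by (rule mult.commute)
  show "y_K n = v_K n + a_K * u_K n"
    unfolding y_K_def v_K_def u_K_def s A_K_X by (simp add: algebra_simps)
  show "v_K n = emb ss * u_K n"
    unfolding v_K_def u_K_def s by (simp add: algebra_simps)
  show "v_K m * v_K n = u_K (m + n + 1) - a_K * v_K (m + n)"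
    unfolding u_K_def v_K_def s A_K_X power_int_add[OF disjI1[OF tsn0(3)]] power_int_add[OF disjI1[OF tsn0(4)]]
    by (simp add: algebra_simps)
qed

definition Rge :: "int \<Rightarrow> K set" where "Rge N = AK.span (w_K ` {N..})"

lemma Rge_w: "N \<le> i \<Longrightarrow> w_K i \<in> Rge N"
  unfolding Rge_def by (intro AK.span_base) auto
lemma Rge_mono: "N \<le> M \<Longrightarrow> f \<in> Rge M \<Longrightarrow> f \<in> Rge N"
  unfolding Rge_def by (rule subsetD[OF AK.span_mono]) auto

lemma w_mult: "w_K i * w_K j = (if odd i \<and> odd j then w_K (i + j) - a_K * w_K (i + j - 1) else w_K (i + j))"
proof -
  consider m n where "i = 2 * m" "j = 2 * n" | m n where "i = 2 * m" "j = 2 * n + 1"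
    | m n where "i = 2 * m + 1" "j = 2 * n" | m n where "i = 2 * m + 1" "j = 2 * n + 1"
    by (metis evenE oddE)
  then show ?thesis
  proof cases
    case 4
    have "i + j = 2 * (m + n + 1)" "i + j - 1 = 2 * (m + n) + 1" using 4 by auto
    then have "w_K (i + j) = u_K (m + n + 1)" "w_K (i + j - 1) = v_K (m + n)"
      unfolding w_K_def by simp_all
    then show ?thesis using 4 uv_rules(4)[of m n] by (simp add: w_K_def)
  next
    case 3
    then have e: "i + j = 2 * (m + n) + 1" by simp
    then show ?thesis unfolding e using 3 by (simp add: w_K_def uv_rules add.commute)
  next
    case 2
    then have e: "i + j = 2 * (m + n) + 1" by simp
    then show ?thesis unfolding e using 2 by (simp add: w_K_def uv_rules)
  next
    case 1
    then have e: "i + j = 2 * (m + n)" by simp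
    then show ?thesis unfolding e using 1 by (simp add: w_K_def uv_rules)
  qed
qed

lemma Rge_mult: assumes "f \<in> Rge N" "g \<in> Rge M" shows "f * g \<in> Rge (N + M - 1)"
proof -
  let ?S = "Rge (N + M - 1)"
  have 1: "w_K i * w_K j \<in> ?S" if "N \<le> i" "M \<le> j" for i j
  proof (cases "odd i \<and> odd j")
    case True
    have "w_K (i + j) - a_K * w_K (i + j - 1) \<in> ?S" unfolding Rge_def
      by (intro AK.span_diff AK.span_scale AK.span_base) (use that in auto)
    then show ?thesis using True by (simp add: w_mult)
  next
    case False
    have "w_K (i + j) \<in> ?S" by (rule Rge_w) (use that in auto)
    then show ?thesis by (simp only: w_mult False if_False)
  qed
  have 2: "f * w_K j \<in> ?S" if "M \<le> j" for j
    using assms(1) unfolding Rge_def[of N]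
  proof (induction rule: AK.span_induct)
    case base
    show ?case unfolding AK.subspace_def Rge_def
      by (auto simp: distrib_right mult.assoc AK.span_zero intro: AK.span_add AK.span_scale)
  next
    case (step x) then show ?case using 1 that by auto
  qed
  show ?thesis using assms(2) unfolding Rge_def[of M]
  proof (induction rule: AK.span_induct)
    case base
    show ?case unfolding AK.subspace_def Rge_def
      by (auto simp: distrib_left mult.left_commute[of f] AK.span_zero intro: AK.span_add AK.span_scale)
  next
    case (step x) then show ?case using 2 by auto
  qed
qed

typedef R2 = "AK.span (range w_K)" morphisms K_of_R2 Abs_R2
  by (rule exI[of _ 0]) (rule AK.span_zero)

setup_lifting type_definition_R2

lemma span_Rge: "f \<in> AK.span (range w_K) \<Longrightarrow> \<exists>N. f \<in> Rge N"
proof (induction rule: AK.span_induct)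
  case base
  show ?case unfolding AK.subspace_def
  proof (safe)
    show "\<exists>N. 0 \<in> Rge N" by (auto simp: Rge_def AK.span_zero)
    fix x y N M assume "x \<in> Rge N" "y \<in> Rge M"
    then have "x \<in> Rge (min N M)" "y \<in> Rge (min N M)" by (auto elim: Rge_mono[rotated])
    then show "\<exists>N. x + y \<in> Rge N" unfolding Rge_def by (blast intro: AK.span_add)
  next
    fix c x N assume "x \<in> Rge N" then show "\<exists>N. A_K c * x \<in> Rge N"
      unfolding Rge_def by (blast intro: AK.span_scale)
  qed
next
  case (step x) then show ?case using Rge_w by auto
qed

lemma Rge_span: "f \<in> Rge N \<Longrightarrow> f \<in> AK.span (range w_K)"
  unfolding Rge_def using AK.span_mono[of "w_K ` {N..}" "range w_K"] by auto

lemma span_w_mult: "f \<in> AK.span (range w_K) \<Longrightarrow> g \<in> AK.span (range w_K) \<Longrightarrow> f * g \<in> AK.span (range w_K)"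
  using span_Rge[of f] span_Rge[of g] Rge_mult Rge_span by blast

lemma w_K_0: "w_K 0 = 1"
  by (simp add: w_K_def u_K_def)

lemma span_w_A: "A_K p \<in> AK.span (range w_K)"
  using AK.span_scale[OF AK.span_base[OF rangeI[of w_K 0]], of p] by (simp add: w_K_0)

instantiation R2 :: comm_ring_1
begin
lift_definition zero_R2 :: R2 is 0 by (rule AK.span_zero)
lift_definition one_R2 :: R2 is 1 using span_w_A[of 1] by simp
lift_definition plus_R2 :: "R2 \<Rightarrow> R2 \<Rightarrow> R2" is "(+)" by (rule AK.span_add)
lift_definition minus_R2 :: "R2 \<Rightarrow> R2 \<Rightarrow> R2" is "(-)" by (rule AK.span_diff)
lift_definition uminus_R2 :: "R2 \<Rightarrow> R2" is uminus by (rule AK.span_neg)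
lift_definition times_R2 :: "R2 \<Rightarrow> R2 \<Rightarrow> R2" is "(*)" by (rule span_w_mult)
instance by standard (transfer; simp add: algebra_simps)+
end

lift_definition A_R2 :: "complex fps \<Rightarrow> R2" is A_K by (rule span_w_A)
lift_definition w2 :: "int \<Rightarrow> R2" is w_K by (rule AK.span_base) simp

lemma z_K: "z_K i = (if even i then w_K i else w_K i + a_K * w_K (i - 1))"
  by (simp add: z_K_def w_K_def uv_rules) (simp add: x_K_def u_K_def)

lift_definition z2 :: "int \<Rightarrow> R2" is z_K
proof -
  fix i
  have "w_K i + a_K * w_K (i - 1) \<in> AK.span (range w_K)" "w_K i \<in> AK.span (range w_K)"
    by (intro AK.span_add AK.span_scale AK.span_base rangeI)+
  then show "z_K i \<in> AK.span (range w_K)" unfolding z_K by simp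
qed

lemma der_powi:
  assumes "x \<noteq> 0" "der_K x = 1"
  shows "der_K (x powi n) = of_int n * x powi (n - 1)"
proof (induction n rule: int_induct[where k=0])
  case base then show ?case by simp
next
  case (step1 i)
  have "x powi (i + 1) = x powi i * x" "x powi i = x powi (i - 1) * x"
    using assms(1) by (simp_all add: power_int_add power_int_diff)
  then show ?case using step1(2) assms by (simp add: der_mult algebra_simps)
next
  case (step2 i)
  have e: "x powi i = x powi (i - 1) * x" "x powi (i - 1) = x powi (i - 2) * x"
    using assms(1) by (simp_all add: power_int_diff power2_eq_square)
  then have "der_K (x powi (i - 1)) * x + x powi (i - 1) = of_int i * x powi (i - 1)"
    using step2(2) assms by (simp add: der_mult)
  then have "der_K (x powi (i - 1)) * x = of_int (i - 1) * x powi (i - 2) * x"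
    using e(2) by (simp add: algebra_simps)
  then have "der_K (x powi (i - 1)) = of_int (i - 1) * x powi (i - 2)" using assms(1) by simp
  then show ?case by simp
qed

lemma der_u: "der_K (u_K n) = of_int n * (2 * v_K (n - 1) + a_K * u_K (n - 1))"
proof -
  have s: "emb tt powi n = emb tt * emb tt powi (n-1)" "emb ss powi n = emb ss * emb ss powi (n-1)"
    by (simp_all add: power_int_diff)
  have "der_K (u_K n) = of_int n * (emb tt powi (n-1) * emb ss powi n + emb tt powi n * emb ss powi (n-1))"
    unfolding u_K_def der_mult by (simp add: der_powi der_emb algebra_simps)
  also have "\<dots> = of_int n * (emb ss * u_K (n-1) + emb tt * u_K (n-1))"
    unfolding s u_K_def by (simp only: mult_ac)
  finally show ?thesis unfolding t_eq uv_rules(6) by (simp add: algebra_simps)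
qed

lemma der_v: "der_K (v_K n) = (2 * of_int n + 1) * u_K n - of_int n * a_K * v_K (n - 1)"
proof -
  have v: "v_K n = v_K 0 * u_K n" "v_K 0 * v_K (n - 1) = u_K n - a_K * v_K (n - 1)"
    using uv_rules(3)[of 0 n] uv_rules(4)[of 0 "n-1"] by simp_all
  have v0: "v_K 0 = emb ss" by (simp add: v_K_def)
  have "der_K (v_K n) = u_K n + v_K 0 * der_K (u_K n)"
    unfolding v(1) der_mult unfolding v0 der_emb by simp
  also have "\<dots> = u_K n + of_int n * (2 * (v_K 0 * v_K (n - 1)) + a_K * (v_K 0 * u_K (n - 1)))"
    unfolding der_u by (simp only: algebra_simps)
  also have "\<dots> = (2 * of_int n + 1) * u_K n - of_int n * a_K * v_K (n - 1)"
    unfolding v(2) uv_rules(3) by (simp add: algebra_simps)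
  finally show ?thesis .
qed

lemma A_K_of_nat: "A_K (of_nat n) = of_nat n" by (induction n) simp_all
lemma A_K_of_int: "A_K (of_int n) = of_int n"
  by (cases n rule: int_diff_cases) (simp add: A_K_of_nat)

lemma der_w: "der_K (w_K i) \<in> Rge (i - 2)"
proof (cases "even i")
  case True
  then obtain n where i: "i = 2 * n" by (rule evenE)
  have "w_K (i - 1) = v_K (n - 1)" "w_K (i - 2) = u_K (n - 1)" unfolding i w_K_def by (simp_all add: algebra_simps)
  then have "der_K (w_K i) = A_K (of_int n * of_int 2) * w_K (i - 1) + A_K (of_int n * fps_X) * w_K (i - 2)"
    unfolding A_K_mult A_K_of_int using i by (simp add: w_K_def der_u algebra_simps)
  also have "\<dots> \<in> Rge (i - 2)" unfolding Rge_def
    by (intro AK.span_add AK.span_scale AK.span_base) auto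
  finally show ?thesis .
next
  case False
  then obtain n where i: "i = 2 * n + 1" by (rule oddE)
  have "w_K (i - 1) = u_K n" "w_K (i - 2) = v_K (n - 1)" unfolding i w_K_def by (simp_all add: algebra_simps)
  then have "der_K (w_K i) = A_K (of_int (2 * n + 1)) * w_K (i - 1) - A_K (of_int n * fps_X) * w_K (i - 2)"
    unfolding A_K_mult A_K_of_int using i by (simp add: w_K_def der_v)
  also have "\<dots> \<in> Rge (i - 2)" unfolding Rge_def
    by (intro AK.span_diff AK.span_scale AK.span_base) auto
  finally show ?thesis .
qed

lift_definition deriv_R2 :: "R2 \<Rightarrow> R2" is der_K
proof -
  fix f assume "f \<in> AK.span (range w_K)"
  then show "der_K f \<in> AK.span (range w_K)"
  proof (induction rule: AK.span_induct)
    case base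
    show ?case unfolding AK.subspace_def
      by (auto simp: der_A_mult AK.span_zero intro: AK.span_add AK.span_scale)
  next
    case (step x) then show ?case using der_w Rge_span by auto
  qed
qed

lift_definition Res_R2 :: "R2 \<Rightarrow> complex fls" is Res2 .
text \<open>
  \<open>Res2\<close> takes values in \<open>A\<close> on \<open>R2\<close>, so passing to the regular part only changes the type from \<open>Q\<close> to \<open>A\<close>.
\<close>

definition res2 :: "R2 \<Rightarrow> complex fps" where "res2 f = fls_regpart (Res_R2 f)"


text \<open>
  \<open>'a sl2\<close> is \<open>\<ss>\<ll>\<^sub>2\<close> over the commutative ring \<open>'a\<close>. The Lie algebra \<open>\<gg>\<close> is \<open>complex sl2\<close>, and \<open>\<gg> \<otimes>\<^sub>\<complex> R2\<close> is
  \<open>R2 sl2\<close>: by \<open>tens_basis\<close> below its elements are sums of the pure tensors \<open>tens x f\<close>,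
  and the coefficients with respect to a basis of \<open>\<gg>\<close> are free in \<open>R2\<close>.
\<close>

typedef (overloaded) 'a sl2 = "{X :: 'a::comm_ring_1 ^ 2 ^ 2. trace X = 0}"
  morphisms mat_of Abs_sl2
  by (rule exI[of _ 0]) (simp add: trace_def)

setup_lifting type_definition_sl2

instantiation sl2 :: (comm_ring_1) ab_group_add
begin
lift_definition zero_sl2 :: "'a sl2" is 0 by (simp add: trace_def)
lift_definition plus_sl2 :: "'a sl2 \<Rightarrow> 'a sl2 \<Rightarrow> 'a sl2" is "(+)" by (simp add: trace_add)
lift_definition minus_sl2 :: "'a sl2 \<Rightarrow> 'a sl2 \<Rightarrow> 'a sl2" is "(-)" by (simp add: trace_sub)
lift_definition uminus_sl2 :: "'a sl2 \<Rightarrow> 'a sl2" is uminus by (simp add: trace_def sum_negf)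
instance by standard (transfer; simp)+
end

lift_definition sl_scale :: "'a::comm_ring_1 \<Rightarrow> 'a sl2 \<Rightarrow> 'a sl2" is "\<lambda>c X. \<chi> i j. c * X $ i $ j"
proof -
  fix c :: 'a and X :: "'a ^ 2 ^ 2" assume "trace X = 0"
  moreover have "trace (\<chi> i j. c * X $ i $ j) = c * trace X"
    unfolding trace_def sum_distrib_left by simp
  ultimately show "trace (\<chi> i j. c * X $ i $ j) = 0" by simp
qed

lift_definition lie :: "'a::comm_ring_1 sl2 \<Rightarrow> 'a sl2 \<Rightarrow> 'a sl2" is "\<lambda>X Y. X ** Y - Y ** X"
  unfolding trace_sub by (subst trace_mul_sym) simp

lift_definition sl_h :: "'a::comm_ring_1 sl2" is "vector [vector [1, 0], vector [0, - 1]]"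
  by (simp add: trace_def sum_2)
lift_definition sl_e :: "'a::comm_ring_1 sl2" is "vector [vector [0, 1], vector [0, 0]]"
  by (simp add: trace_def sum_2)
lift_definition sl_f :: "'a::comm_ring_1 sl2" is "vector [vector [0, 0], vector [1, 0]]"
  by (simp add: trace_def sum_2)

text \<open>
  The trace of \<open>ad X \<circ> ad Y\<close> in the basis \<open>sl_h, sl_e, sl_f\<close>: the coordinates of a traceless matrix in this
  basis are its entries at \<open>(1,1)\<close>, \<open>(1,2)\<close> and \<open>(2,1)\<close>, see \<open>sl2_basis\<close>. On \<open>R2 sl2\<close> this is the \<open>R2\<close>-bilinear
  extension of the Killing form of \<open>\<gg>\<close>.
\<close>

definition killing :: "'a::comm_ring_1 sl2 \<Rightarrow> 'a sl2 \<Rightarrow> 'a"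
  where "killing X Y =
    mat_of (lie X (lie Y sl_h)) $ 1 $ 1 + mat_of (lie X (lie Y sl_e)) $ 1 $ 2 + mat_of (lie X (lie Y sl_f)) $ 2 $ 1"

lemma sl2_22: "mat_of X $ 2 $ 2 = - mat_of X $ 1 $ 1"
  by transfer (simp add: trace_def sum_2 add_eq_0_iff)

lemma sl2_basis: "X = sl_scale (mat_of X $ 1 $ 1) sl_h + sl_scale (mat_of X $ 1 $ 2) sl_e + sl_scale (mat_of X $ 2 $ 1) sl_f"
  by (transfer) (auto simp: vec_eq_iff forall_2 trace_def sum_2 add_eq_0_iff)

lemma mat_of_lie: "mat_of (lie X Y) $ i $ j =
   (mat_of X $ i $ 1 * mat_of Y $ 1 $ j + mat_of X $ i $ 2 * mat_of Y $ 2 $ j)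
   - (mat_of Y $ i $ 1 * mat_of X $ 1 $ j + mat_of Y $ i $ 2 * mat_of X $ 2 $ j)"
  by transfer (simp add: matrix_matrix_mult_def sum_2)

lemma killing_eq: "killing X Y = 8 * mat_of X $ 1 $ 1 * mat_of Y $ 1 $ 1
    + 4 * mat_of X $ 1 $ 2 * mat_of Y $ 2 $ 1 + 4 * mat_of X $ 2 $ 1 * mat_of Y $ 1 $ 2"
  unfolding killing_def mat_of_lie sl2_22
  by (simp add: sl_h.rep_eq sl_e.rep_eq sl_f.rep_eq algebra_simps)

lift_definition tens :: "complex sl2 \<Rightarrow> R2 \<Rightarrow> R2 sl2" is
  "\<lambda>x f. \<chi> i j. A_R2 (fps_const (x $ i $ j)) * f"
proof -
  fix x :: "complex ^ 2 ^ 2" and f :: R2 assume "trace x = 0"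
  then have "A_R2 (fps_const (x $ 1 $ 1)) * f + A_R2 (fps_const (x $ 2 $ 2)) * f = 0"
    by (simp add: trace_def sum_2 flip: distrib_right) (transfer, simp flip: A_K_add)
  then show "trace (\<chi> i j. A_R2 (fps_const (x $ i $ j)) * f) = 0"
    by (simp add: trace_def sum_2)
qed

lemma deriv_R_add: "deriv_R2 (f + g) = deriv_R2 f + deriv_R2 g"
  by transfer simp

lift_definition der_sl :: "R2 sl2 \<Rightarrow> R2 sl2" is "\<lambda>X. \<chi> i j. deriv_R2 (X $ i $ j)"
proof -
  fix X :: "R2 ^ 2 ^ 2" assume "trace X = 0"
  moreover have "deriv_R2 0 = 0" by transfer simp
  ultimately show "trace (\<chi> i j. deriv_R2 (X $ i $ j)) = 0"
    by (simp add: trace_def sum_2 flip: deriv_R_add)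
qed

text \<open>
  \<open>(X, c)\<close> stands for \<open>X + c C\<^sub>2\<close>. On pure tensors \<open>g2_lie\<close> is the defining formula
  \<open>[x f, y g] = [x, y] f g + Res\<^sub>2 (f' g) \<kappa>(x, y) C\<^sub>2\<close>; see \<open>g2_lie_tens\<close>.
\<close>

type_synonym g2hat = "R2 sl2 \<times> complex fps"

definition g2_scale :: "complex fps \<Rightarrow> g2hat \<Rightarrow> g2hat"
  where "g2_scale p = (\<lambda>(X, c). (sl_scale (A_R2 p) X, p * c))"

definition g2_lie :: "g2hat \<Rightarrow> g2hat \<Rightarrow> g2hat"
  where "g2_lie = (\<lambda>(X, c) (Y, d). (lie X Y, res2 (killing (der_sl X) Y)))"

text \<open>
  The enveloping algebra over \<open>A\<close> is the free associative \<open>A\<close>-algebra on the set \<open>g2hat\<close> (finitely supported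
  functions on words) modulo the relations that make \<open>fgen\<close> linear over \<open>A\<close>, which yields the tensor
  algebra, and turn the commutator into the bracket.
\<close>

datatype 'b fword = FWord "'b list"

instantiation fword :: (type) monoid_add
begin
definition zero_fword :: "'a fword" where "zero_fword = FWord []"
fun plus_fword :: "'a fword \<Rightarrow> 'a fword \<Rightarrow> 'a fword" where "plus_fword (FWord x) (FWord y) = FWord (x @ y)"
instance
proof
  fix a b c :: "'a fword"
  show "a + b + c = a + (b + c)" by (cases a; cases b; cases c) simp
  show "0 + a = a" "a + 0 = a" by (cases a; simp add: zero_fword_def)+
qed
end

type_synonym free2 = "g2hat fword \<Rightarrow>\<^sub>0 complex fps"

definition fgen :: "g2hat \<Rightarrow> free2" where "fgen X = Poly_Mapping.single (FWord [X]) 1"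
definition fscal :: "complex fps \<Rightarrow> free2" where "fscal p = Poly_Mapping.single 0 p"

definition is_ideal :: "'a::ring_1 set \<Rightarrow> bool"
  where "is_ideal I \<longleftrightarrow> 0 \<in> I \<and> (\<forall>x\<in>I. \<forall>y\<in>I. x + y \<in> I) \<and> (\<forall>x\<in>I. \<forall>a. a * x \<in> I \<and> x * a \<in> I)"

definition is_left_ideal :: "'a::ring_1 set \<Rightarrow> bool"
  where "is_left_ideal I \<longleftrightarrow> 0 \<in> I \<and> (\<forall>x\<in>I. \<forall>y\<in>I. x + y \<in> I) \<and> (\<forall>x\<in>I. \<forall>a. a * x \<in> I)"

lemma is_ideal_hull: "is_ideal (is_ideal hull S)"
  by (rule hull_in) (auto simp: is_ideal_def)
lemma is_left_ideal_hull: "is_left_ideal (is_left_ideal hull S)"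
  by (rule hull_in) (auto simp: is_left_ideal_def)

lemma is_ideal_left: "is_ideal I \<Longrightarrow> is_left_ideal I"
  by (simp add: is_ideal_def is_left_ideal_def)

lemma left_idealD:
  assumes "is_left_ideal I"
  shows "0 \<in> I" "x \<in> I \<Longrightarrow> y \<in> I \<Longrightarrow> x + y \<in> I" "x \<in> I \<Longrightarrow> a * x \<in> I" "x \<in> I \<Longrightarrow> - x \<in> I"
    "x \<in> I \<Longrightarrow> y \<in> I \<Longrightarrow> x - y \<in> I"
proof -
  show *: "0 \<in> I" "x \<in> I \<Longrightarrow> y \<in> I \<Longrightarrow> x + y \<in> I" "x \<in> I \<Longrightarrow> a * x \<in> I" for x y a
    using assms by (auto simp: is_left_ideal_def)
  show m: "x \<in> I \<Longrightarrow> - x \<in> I" for x using *(3)[of x "-1"] by simp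
  show "x \<in> I \<Longrightarrow> y \<in> I \<Longrightarrow> x - y \<in> I" using *(2)[of x "- y"] m by simp
qed

lemma ideal_congs:
  assumes I: "is_ideal I"
  shows "equivp (\<lambda>x y. x - y \<in> I)"
    "x - x' \<in> I \<Longrightarrow> y - y' \<in> I \<Longrightarrow> (x + y) - (x' + y') \<in> I"
    "x - x' \<in> I \<Longrightarrow> y - y' \<in> I \<Longrightarrow> (x - y) - (x' - y') \<in> I"
    "x - x' \<in> I \<Longrightarrow> y - y' \<in> I \<Longrightarrow> (x * y) - (x' * y') \<in> I"
    "x - x' \<in> I \<Longrightarrow> (- x) - (- x') \<in> I"
proof -
  note L = left_idealD[OF is_ideal_left[OF I]]
  have R: "x \<in> I \<Longrightarrow> x * a \<in> I" for x a using I by (simp add: is_ideal_def)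
  show "equivp (\<lambda>x y. x - y \<in> I)"
  proof (rule equivpI)
    show "reflp (\<lambda>x y. x - y \<in> I)" by (rule reflpI) (simp add: L)
    show "symp (\<lambda>x y. x - y \<in> I)" by (rule sympI) (metis L(4) minus_diff_eq)
    show "transp (\<lambda>x y. x - y \<in> I)" by (rule transpI) (metis L(2) diff_add_cancel add_diff_eq)
  qed
  show "x - x' \<in> I \<Longrightarrow> y - y' \<in> I \<Longrightarrow> (x + y) - (x' + y') \<in> I" by (simp add: add_diff_add L)
  show "x - x' \<in> I \<Longrightarrow> y - y' \<in> I \<Longrightarrow> (x - y) - (x' - y') \<in> I"
    using L(5)[of "x - x'" "y - y'"] by (simp add: algebra_simps)
  show "x - x' \<in> I \<Longrightarrow> (- x) - (- x') \<in> I" using L(4)[of "x - x'"] by (simp add: algebra_simps)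
  show "x - x' \<in> I \<Longrightarrow> y - y' \<in> I \<Longrightarrow> (x * y) - (x' * y') \<in> I"
    using L(2)[of "(x - x') * y" "x' * (y - y')"] R[of "x - x'" y] L(3)[of "y - y'" x'] by (simp add: algebra_simps)
qed

definition U2_rels :: "free2 set"
  where "U2_rels =
     {fgen (X + Y) - (fgen X + fgen Y) | X Y. True}
   \<union> {fgen (g2_scale p X) - fscal p * fgen X | p X. True}
   \<union> {fgen X * fgen Y - fgen Y * fgen X - fgen (g2_lie X Y) | X Y. True}"

definition U2_ideal :: "free2 set" where "U2_ideal = is_ideal hull U2_rels"

lemma U2_ideal: "is_ideal U2_ideal" unfolding U2_ideal_def by (rule is_ideal_hull)

quotient_type U2 = free2 / "\<lambda>x y. x - y \<in> U2_ideal"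
  by (rule ideal_congs(1)[OF U2_ideal])

definition aug :: "free2 \<Rightarrow> complex fps" where "aug f = Poly_Mapping.lookup f 0"

lemma aug_add: "aug (f + g) = aug f + aug g" and aug_diff: "aug (f - g) = aug f - aug g"
  and aug_1: "aug 1 = 1" and aug_0: "aug 0 = 0" and aug_fgen: "aug (fgen X) = 0"
  and aug_minus: "aug (- f) = - aug f"
  by (simp_all add: aug_def lookup_add lookup_minus lookup_one fgen_def lookup_single zero_fword_def)

lemma fword_add_0: "0 = x + y \<longleftrightarrow> x = 0 \<and> y = (0 :: 'b fword)"
  by (cases x; cases y) (auto simp: zero_fword_def)

lemma aug_mult: "aug (f * g) = aug f * aug g"
proof -
  have *: "(\<Sum>q. Poly_Mapping.lookup g q when 0 = l + q) = (Poly_Mapping.lookup g 0 when l = 0)" for l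
    by (cases "l = 0") (simp_all add: fword_add_0)
  show ?thesis unfolding aug_def lookup_mult * by (simp add: mult_when)
qed

lemma aug_ideal: "f \<in> U2_ideal \<Longrightarrow> aug f = 0"
  unfolding U2_ideal_def
proof (erule hull_induct)
  show "is_ideal {x. aug x = 0}" by (auto simp: is_ideal_def aug_0 aug_add aug_mult)
  show "aug x = 0" if "x \<in> U2_rels" for x
    using that by (auto simp: U2_rels_def aug_add aug_mult aug_diff aug_fgen)
qed

instantiation U2 :: ring_1
begin
lift_definition zero_U2 :: U2 is 0 .
lift_definition one_U2 :: U2 is 1 .
lift_definition plus_U2 :: "U2 \<Rightarrow> U2 \<Rightarrow> U2" is "(+)" by (rule ideal_congs(2)[OF U2_ideal])
lift_definition minus_U2 :: "U2 \<Rightarrow> U2 \<Rightarrow> U2" is "(-)" by (rule ideal_congs(3)[OF U2_ideal])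
lift_definition uminus_U2 :: "U2 \<Rightarrow> U2" is "uminus" by (rule ideal_congs(5)[OF U2_ideal])
lift_definition times_U2 :: "U2 \<Rightarrow> U2 \<Rightarrow> U2" is "(*)" by (rule ideal_congs(4)[OF U2_ideal])
instance
proof
  note Z = left_idealD(1)[OF is_ideal_left[OF U2_ideal]]
  fix a b c :: U2
  show "a + b + c = a + (b + c)" by transfer (simp add: add.assoc Z)
  show "a + b = b + a" by transfer (simp add: add.commute Z)
  show "0 + a = a" by transfer (simp add: Z)
  show "- a + a = 0" by transfer (simp add: Z)
  show "a - b = a + - b" by transfer (simp add: Z)
  show "a * b * c = a * (b * c)" by transfer (simp add: mult.assoc Z)
  show "1 * a = a" "a * 1 = a" by (transfer; simp add: Z)+
  show "(a + b) * c = a * c + b * c" by transfer (simp add: distrib_right Z)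
  show "a * (b + c) = a * b + a * c" by transfer (simp add: distrib_left Z)
  show "(0::U2) \<noteq> 1" by transfer (auto dest!: aug_ideal simp: aug_minus aug_1)
qed
end

lift_definition U2_gen :: "g2hat \<Rightarrow> U2" is fgen .
lift_definition U2_scal :: "complex fps \<Rightarrow> U2" is fscal .

lemma incl_rules:
  "U2_gen (X + Y) = U2_gen X + U2_gen Y"
  "U2_gen (g2_scale p X) = U2_scal p * U2_gen X"
  "U2_gen X * U2_gen Y - U2_gen Y * U2_gen X = U2_gen (g2_lie X Y)"
  by (transfer, unfold U2_ideal_def, rule hull_inc, unfold U2_rels_def, blast)+

lemma incl_0 [simp]: "U2_gen 0 = 0"
  using incl_rules(1)[of 0 0] by simp

lemma sl2_eqI: "(\<And>i j. mat_of X $ i $ j = mat_of Y $ i $ j) \<Longrightarrow> X = Y"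
  by transfer (simp add: vec_eq_iff)

lemma A_R_simps [simp]: "A_R2 0 = 0" "A_R2 1 = 1" "A_R2 (p + q) = A_R2 p + A_R2 q" "A_R2 (- p) = - A_R2 p"
    "A_R2 (p * q) = A_R2 p * A_R2 q"
  by (transfer, simp)+

lemma tens_rules:
  "tens x (f + g) = tens x f + tens x g" "tens x 0 = 0"
  "tens x (A_R2 p * f) = sl_scale (A_R2 p) (tens x f)"
  by (rule sl2_eqI; simp add: tens.rep_eq plus_sl2.rep_eq zero_sl2.rep_eq sl_scale.rep_eq algebra_simps)+

lemma fps_const_m1: "fps_const (- 1) = (- 1 :: complex fps)"
  by (simp flip: fps_const_neg)

lemma tens_basis: "X = tens sl_h (mat_of X $ 1 $ 1) + tens sl_e (mat_of X $ 1 $ 2) + tens sl_f (mat_of X $ 2 $ 1)"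
  by (rule sl2_eqI, rename_tac i j, case_tac i rule: exhaust_2[THEN disjE]; case_tac j rule: exhaust_2[THEN disjE])
     (simp_all add: tens.rep_eq plus_sl2.rep_eq sl_h.rep_eq sl_e.rep_eq sl_f.rep_eq sl2_22 fps_const_m1 del: fps_const_neg)

lemma deriv_A: "deriv_R2 (A_R2 p * f) = A_R2 p * deriv_R2 f"
  by transfer (simp add: der_A_mult)

lemma A_R_const:
  "A_R2 (fps_const (a + b)) = A_R2 (fps_const a) + A_R2 (fps_const b)"
  "A_R2 (fps_const (a - b)) = A_R2 (fps_const a) - A_R2 (fps_const b)"
  "A_R2 (fps_const (- a)) = - A_R2 (fps_const a)"
  "A_R2 (fps_const (a * b)) = A_R2 (fps_const a) * A_R2 (fps_const b)"
proof -
  show p: "A_R2 (fps_const (a + b)) = A_R2 (fps_const a) + A_R2 (fps_const b)" for a b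
    by (simp only: A_R_simps flip: fps_const_add)
  show m: "A_R2 (fps_const (- a)) = - A_R2 (fps_const a)" for a
    by (simp only: A_R_simps flip: fps_const_neg)
  show "A_R2 (fps_const (a - b)) = A_R2 (fps_const a) - A_R2 (fps_const b)"
    using p[of a "- b"] by (simp add: m)
  show "A_R2 (fps_const (a * b)) = A_R2 (fps_const a) * A_R2 (fps_const b)"
    by (simp only: A_R_simps flip: fps_const_mult)
qed

lemma A_R_numeral: "A_R2 (fps_const (numeral k)) = numeral k"
  by (induction k) (simp_all only: numeral.simps A_R_const A_R_simps fps_const_1_eq_1)

lemma g2_lie_tens:
  "g2_lie (tens x f, c) (tens y g, d) = (tens (lie x y) (f * g), res2 (A_R2 (fps_const (killing x y)) * (deriv_R2 f * g)))"
proof -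
  have "lie (tens x f) (tens y g) = tens (lie x y) (f * g)"
    by (rule sl2_eqI) (simp add: mat_of_lie tens.rep_eq A_R_const algebra_simps)
  moreover have "killing (der_sl (tens x f)) (tens y g) = A_R2 (fps_const (killing x y)) * (deriv_R2 f * g)"
    unfolding killing_eq der_sl.rep_eq tens.rep_eq vec_lambda_beta deriv_A A_R_const A_R_numeral
    by (simp only: algebra_simps)
  ultimately show ?thesis by (simp add: g2_lie_def)
qed

definition J2 :: "nat \<Rightarrow> U2 set"
  where "J2 n = is_left_ideal hull {U2_gen (tens x (w2 i), 0) | x i. 2 * int n \<le> i}"

lemma J2_left: "is_left_ideal (J2 n)"
  unfolding J2_def by (rule is_left_ideal_hull)

lemmas J2_closed = left_idealD[OF J2_left]

lemma J2_mono: "m \<le> n \<Longrightarrow> J2 n \<subseteq> J2 m"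
proof -
  assume "m \<le> n"
  then have "2 * int m \<le> 2 * int n" by simp
  then show ?thesis unfolding J2_def by (intro hull_mono) (blast intro: order_trans)
qed

lemma J2_tens:
  assumes "K_of_R2 f \<in> Rge (2 * int n)"
  shows "U2_gen (tens x f, 0) \<in> J2 n"
proof -
  have "\<exists>g. K_of_R2 g = K_of_R2 f \<and> U2_gen (tens x g, 0) \<in> J2 n"
    using assms unfolding Rge_def
  proof (induction rule: AK.span_induct)
    case base
    have 0: "U2_gen (tens x 0, 0) \<in> J2 n" using J2_closed(1) incl_0 by (simp add: tens_rules zero_prod_def)
    have 1: "U2_gen (tens x (f + g), 0) \<in> J2 n" if "U2_gen (tens x f, 0) \<in> J2 n" "U2_gen (tens x g, 0) \<in> J2 n" for f g
      using J2_closed(2)[OF that] unfolding incl_rules(1)[symmetric] by (simp add: tens_rules)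
    have 2: "U2_gen (tens x (A_R2 p * f), 0) \<in> J2 n" if "U2_gen (tens x f, 0) \<in> J2 n" for f p
      using J2_closed(3)[OF that, of "U2_scal p"] unfolding incl_rules(2)[symmetric] by (simp add: tens_rules g2_scale_def)
    show ?case unfolding AK.subspace_def
    proof (safe)
      show "\<exists>g. K_of_R2 g = 0 \<and> U2_gen (tens x g, 0) \<in> J2 n"
        using 0 by (intro exI[of _ 0]) (simp add: zero_R2.rep_eq)
    next
      fix g h assume "U2_gen (tens x g, 0) \<in> J2 n" "U2_gen (tens x h, 0) \<in> J2 n"
      then show "\<exists>k. K_of_R2 k = K_of_R2 g + K_of_R2 h \<and> U2_gen (tens x k, 0) \<in> J2 n"
        using 1 by (intro exI[of _ "g + h"]) (simp add: plus_R2.rep_eq)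
    next
      fix c g assume "U2_gen (tens x g, 0) \<in> J2 n"
      then show "\<exists>k. K_of_R2 k = A_K c * K_of_R2 g \<and> U2_gen (tens x k, 0) \<in> J2 n"
        using 2 by (intro exI[of _ "A_R2 c * g"]) (simp add: times_R2.rep_eq A_R2.rep_eq)
    qed
  next
    case (step y)
    then obtain i where i: "y = w_K i" "2 * int n \<le> i" by auto
    then have "U2_gen (tens x (w2 i), 0) \<in> J2 n" unfolding J2_def by (intro hull_inc) blast
    then show ?case using i by (intro exI[of _ "w2 i"]) (simp add: w2.rep_eq)
  qed
  then show ?thesis by (simp add: K_of_R2_inject)
qed

definition RR :: "int \<Rightarrow> R2 set" where "RR N = {f. K_of_R2 f \<in> Rge N}"

lemma RR_mono: "N \<le> M \<Longrightarrow> f \<in> RR M \<Longrightarrow> f \<in> RR N"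
  unfolding RR_def using Rge_mono by blast
lemma RR_add: "f \<in> RR N \<Longrightarrow> g \<in> RR N \<Longrightarrow> f + g \<in> RR N"
  unfolding RR_def Rge_def by (simp add: plus_R2.rep_eq AK.span_add)
lemma RR_diff: "f \<in> RR N \<Longrightarrow> g \<in> RR N \<Longrightarrow> f - g \<in> RR N"
  unfolding RR_def Rge_def by (simp add: minus_R2.rep_eq AK.span_diff)
lemma RR_uminus: "f \<in> RR N \<Longrightarrow> - f \<in> RR N"
  unfolding RR_def Rge_def by (simp add: uminus_R2.rep_eq AK.span_neg)
lemma RR_mult: "f \<in> RR N \<Longrightarrow> g \<in> RR M \<Longrightarrow> f * g \<in> RR (N + M - 1)"
  unfolding RR_def by (simp add: times_R2.rep_eq Rge_mult)
lemma RR_A: "f \<in> RR N \<Longrightarrow> A_R2 p * f \<in> RR N"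
  unfolding RR_def Rge_def by (simp add: times_R2.rep_eq A_R2.rep_eq AK.span_scale)
lemma RR_ex: "\<exists>N. f \<in> RR N"
  unfolding RR_def using span_Rge[OF K_of_R2] by simp
lemma RR_w: "w2 i \<in> RR i"
  unfolding RR_def by (simp add: w2.rep_eq Rge_w)
lemma RR_numeral: "f \<in> RR N \<Longrightarrow> numeral k * f \<in> RR N"
  by (induction k) (simp_all only: numeral.simps distrib_right mult_1_left RR_add)
lemma RR_deriv_w: "deriv_R2 (w2 i) \<in> RR (i - 2)"
  unfolding RR_def by (simp add: deriv_R2.rep_eq w2.rep_eq der_w)
lemma w_K_emb: "0 \<le> i \<Longrightarrow> \<exists>f. w_K i = emb f"
proof -
  assume "0 \<le> i"
  then obtain n where n: "i = int n" by (metis nonneg_int_cases)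
  have p: "emb x powi int k = emb (x ^ k)" for x k by simp
  have s: "int k + 1 = int (k + 1)" for k by simp
  show ?thesis
  proof (cases "even n")
    case True
    then obtain k where "n = 2 * k" by (rule evenE)
    then have "w_K i = u_K (int k)" unfolding n by (simp add: w_K_def)
    also have "\<dots> = emb (tt ^ k * ss ^ k)" unfolding u_K_def p emb_simps ..
    finally show ?thesis by blast
  next
    case False
    then obtain k where "n = 2 * k + 1" by (rule oddE)
    then have "w_K i = v_K (int k)" unfolding n by (simp add: w_K_def)
    also have "\<dots> = emb (tt ^ k * ss ^ (k + 1))" unfolding v_K_def s p emb_simps ..
    finally show ?thesis by blast
  qed
qed

lemma Rge_K2: "f \<in> Rge N \<Longrightarrow> f \<in> K2"
  unfolding Rge_def
proof (induction rule: AK.span_induct)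
  case base show ?case unfolding AK.subspace_def
    using K2_emb[of 0] by (auto intro: K2_add K2_mult)
qed auto

lemma res_RR: "f \<in> RR 0 \<Longrightarrow> res2 f = 0"
proof -
  have "k \<in> K2 \<and> Res2 k = 0" if "k \<in> Rge 0" for k
    using that unfolding Rge_def
  proof (induction rule: AK.span_induct)
    case base show ?case unfolding AK.subspace_def
      using K2_emb[of 0] Res2_emb[of 0] by (auto simp: Res2_add Res2_A intro: K2_add K2_mult)
  next
    case (step x) then show ?case using w_K_emb Res2_emb by fastforce
  qed
  then show "f \<in> RR 0 \<Longrightarrow> res2 f = 0" by (simp add: RR_def res2_def Res_R2.rep_eq)
qed

lemma J2_entries:
  assumes "\<And>i j. mat_of X $ i $ j \<in> RR (2 * int n)"
  shows "U2_gen (X, 0) \<in> J2 n"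
proof -
  have s: "(a + b + c, 0) = (a, 0) + (b, 0) + (c, 0 :: complex fps)" for a b c :: "R2 sl2" by simp
  have "U2_gen (tens sl_h (mat_of X $ 1 $ 1) + tens sl_e (mat_of X $ 1 $ 2) + tens sl_f (mat_of X $ 2 $ 1), 0) \<in> J2 n"
    unfolding s incl_rules(1) by (intro J2_closed(2) J2_tens) (use assms in \<open>auto simp: RR_def\<close>)
  then show ?thesis unfolding tens_basis[symmetric] .
qed

lemma J2_cont_gen: "\<exists>m. \<forall>x i. 2 * int m \<le> i \<longrightarrow> U2_gen (tens x (w2 i), 0) * U2_gen (Y, c) \<in> J2 n"
proof -
  obtain N where N: "\<And>i j. mat_of Y $ i $ j \<in> RR N"
  proof -
    define f where "f i j = (SOME N. mat_of Y $ i $ j \<in> RR N)" for i j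
    have f: "mat_of Y $ i $ j \<in> RR (f i j)" for i j
      unfolding f_def by (rule someI_ex) (rule RR_ex)
    have "mat_of Y $ i $ j \<in> RR (min (min (f 1 1) (f 1 2)) (min (f 2 1) (f 2 2)))" for i j
      using f[of i j] by (rule RR_mono[rotated]) (use exhaust_2[of i] exhaust_2[of j] in auto)
    then show ?thesis using that by blast
  qed
  define m where "m = n + nat (\<bar>N\<bar> + 3)"
  have "U2_gen (tens x (w2 i), 0) * U2_gen (Y, c) \<in> J2 n" if i: "2 * int m \<le> i" for x i
  proof -
    let ?X = "tens x (w2 i)"
    have X: "mat_of ?X $ k $ l \<in> RR i" for k l by (simp add: tens.rep_eq RR_A RR_w)
    have DX: "mat_of (der_sl ?X) $ k $ l \<in> RR (i - 2)" for k l
      by (simp add: der_sl.rep_eq tens.rep_eq deriv_A RR_A RR_deriv_w)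
    have P: "mat_of ?X $ k $ l * mat_of Y $ k' $ l' \<in> RR (2 * int n)"
            "mat_of Y $ k' $ l' * mat_of ?X $ k $ l \<in> RR (2 * int n)" for k l k' l'
      by (rule RR_mono[OF _ RR_mult[OF X N]], use i in \<open>simp add: m_def\<close>)
         (rule RR_mono[OF _ RR_mult[OF N X]], use i in \<open>simp add: m_def\<close>)
    have "U2_gen (lie ?X Y, 0) \<in> J2 n"
      by (rule J2_entries) (auto simp: mat_of_lie intro!: RR_diff RR_add P)
    moreover have "killing (der_sl ?X) Y \<in> RR (i - 2 + N - 1)"
      unfolding killing_eq mult.assoc by (intro RR_add RR_numeral RR_mult DX N)
    then have "res2 (killing (der_sl ?X) Y) = 0"
      by (intro res_RR, elim RR_mono[rotated]) (use i in \<open>auto simp: m_def\<close>)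
    ultimately have "U2_gen (g2_lie (?X, 0) (Y, c)) \<in> J2 n" by (simp add: g2_lie_def)
    moreover have "U2_gen (Y, c) * U2_gen (?X, 0) \<in> J2 n"
      by (intro J2_closed(3) J2_tens) (use i in \<open>auto simp: m_def w2.rep_eq intro!: Rge_w\<close>)
    ultimately have "U2_gen (Y, c) * U2_gen (?X, 0) + (U2_gen (?X, 0) * U2_gen (Y, c) - U2_gen (Y, c) * U2_gen (?X, 0)) \<in> J2 n"
      unfolding incl_rules(3) by (intro J2_closed(2))
    then show ?thesis by simp
  qed
  then show ?thesis by blast
qed

lemma poly_mapping_add_induct [case_names zero add]:
  assumes "P 0" "\<And>k c f. P f \<Longrightarrow> P (Poly_Mapping.single k c + f)"
  shows "P (f :: 'a \<Rightarrow>\<^sub>0 'b::comm_monoid_add)"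
proof (induction f rule: update_induct)
  case (update f k v)
  have "Poly_Mapping.update k v f = Poly_Mapping.single k v + f"
    using update(1) by (intro poly_mapping_eqI) (auto simp: lookup_update lookup_add lookup_single in_keys_iff)
  then show ?case using assms(2)[OF update(3)] by simp
qed (use assms(1) in simp)

lemma scal_commute: "U2_scal p * x = x * U2_scal p"
proof -
  have "fscal p * f = f * fscal p" for f
    by (induction f rule: poly_mapping_add_induct)
       (simp_all add: distrib_left distrib_right fscal_def mult_single mult.commute)
  then show ?thesis
    by transfer (simp add: left_idealD(1)[OF is_ideal_left[OF U2_ideal]])
qed

lemma scal_rules: "U2_scal 0 = 0" "U2_scal 1 = 1" "U2_scal (p + q) = U2_scal p + U2_scal q" "U2_scal (p * q) = U2_scal p * U2_scal q"
  by (transfer, simp add: fscal_def single_add mult_single left_idealD(1)[OF is_ideal_left[OF U2_ideal]])+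

lemma U2_induct [case_names scal incl add mult]:
  assumes "\<And>p. P (U2_scal p)" "\<And>X. P (U2_gen X)" "\<And>x y. P x \<Longrightarrow> P y \<Longrightarrow> P (x + y)" "\<And>x y. P x \<Longrightarrow> P y \<Longrightarrow> P (x * y)"
  shows "P x"
proof -
  have ws: "P (abs_U2 (Poly_Mapping.single (FWord ws) c))" for ws c
  proof (induction ws)
    case Nil
    then show ?case using assms(1)[of c] by (simp add: U2_scal_def fscal_def zero_fword_def)
  next
    case (Cons X ws)
    have "Poly_Mapping.single (FWord (X # ws)) c = fgen X * Poly_Mapping.single (FWord ws) c"
      by (simp add: fgen_def mult_single)
    then show ?case using assms(4)[OF assms(2)[of X] Cons]
      by (simp add: U2_gen.abs_eq times_U2.abs_eq)
  qed
  have "P (abs_U2 f)" for f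
  proof (induction f rule: poly_mapping_add_induct)
    case zero
    have "abs_U2 0 = U2_scal 0" by (simp add: scal_rules zero_U2_def)
    then show ?case using assms(1) by simp
  next
    case (add k c f)
    then show ?case using assms(3)[OF ws add] by (cases k) (simp add: plus_U2.abs_eq)
  qed
  then show ?thesis by (rule U2.abs_induct)
qed

lemma J2_cont: "\<exists>m. \<forall>u\<in>J2 m. u * v \<in> J2 n"
proof (induction v arbitrary: n rule: U2_induct)
  case (scal p)
  show ?case by (intro exI[of _ n]) (auto simp: scal_commute[symmetric] J2_closed)
next
  case (incl X)
  obtain Y c where [simp]: "X = (Y, c)" by (cases X)
  obtain m where m: "\<And>x i. 2 * int m \<le> i \<Longrightarrow> U2_gen (tens x (w2 i), 0) * U2_gen X \<in> J2 n"
    using J2_cont_gen[of Y c n] by auto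
  have "u * U2_gen X \<in> J2 n" if "u \<in> J2 m" for u
    using that unfolding J2_def[of m]
  proof (rule hull_induct)
    show "is_left_ideal {u. u * U2_gen X \<in> J2 n}"
      unfolding is_left_ideal_def by (auto simp: distrib_right mult.assoc J2_closed)
  qed (use m in auto)
  then show ?case by blast
next
  case (add x y)
  obtain m m' where "\<forall>u\<in>J2 m. u * x \<in> J2 n" "\<forall>u\<in>J2 m'. u * y \<in> J2 n" using add by metis
  then have "\<forall>u\<in>J2 (max m m'). u * (x + y) \<in> J2 n"
    using J2_mono[of m "max m m'"] J2_mono[of m' "max m m'"] by (auto simp: distrib_left intro!: J2_closed(2))
  then show ?case by blast
next
  case (mult x y)
  obtain m where m: "\<forall>u\<in>J2 m. u * y \<in> J2 n" using mult(2) by metis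
  obtain m' where "\<forall>u\<in>J2 m'. u * x \<in> J2 m" using mult(1) by metis
  with m have "\<forall>u\<in>J2 m'. u * (x * y) \<in> J2 n" by (simp flip: mult.assoc)
  then show ?case by blast
qed

lift_definition augU :: "U2 \<Rightarrow> complex fps" is aug
  using aug_ideal aug_diff by force

lemma J2_proper: "1 \<notin> J2 n"
proof -
  have a: "augU (x + y) = augU x + augU y" "augU (x * y) = augU x * augU y" "augU 0 = 0" "augU 1 = 1" "augU (U2_gen X) = 0" for x y X
    by (transfer, simp add: aug_add aug_mult aug_0 aug_1 aug_fgen)+
  have "x \<in> J2 n \<Longrightarrow> augU x = 0" for x
    unfolding J2_def
  proof (erule hull_induct)
    show "is_left_ideal {x. augU x = 0}" by (auto simp: is_left_ideal_def a)
  qed (auto simp: a)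
  then show ?thesis using a(4) by force
qed

text \<open>
  An element of the inverse limit of the \<open>U2/J2 n\<close> is a sequence of cosets \<open>\<xi> n\<close> of \<open>J2 n\<close>. The transition map
  \<open>U2/J2 n \<rightarrow> U2/J2 m\<close>, \<open>m \<le> n\<close>, sends a coset to the unique coset containing it, so compatibility is inclusion.
\<close>

definition lcoset :: "'a::ab_group_add set \<Rightarrow> 'a \<Rightarrow> 'a set" where "lcoset J u = {v. v - u \<in> J}"

typedef U2bar = "{\<xi> :: nat \<Rightarrow> U2 set. (\<forall>n. \<exists>u. \<xi> n = lcoset (J2 n) u) \<and> (\<forall>m n. m \<le> n \<longrightarrow> \<xi> n \<subseteq> \<xi> m)}"
  morphisms component Abs_U2bar
proof (rule exI[of _ "\<lambda>n. lcoset (J2 n) 0"], rule CollectI, intro conjI allI impI)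
  show "\<exists>u. lcoset (J2 n) 0 = lcoset (J2 n) u" for n by blast
  show "lcoset (J2 n) 0 \<subseteq> lcoset (J2 m) 0" if "m \<le> n" for m n
    using J2_mono[OF that] by (auto simp: lcoset_def)
qed

setup_lifting type_definition_U2bar

lemma coset_self: "u \<in> lcoset (J2 n) u"
  by (simp add: lcoset_def J2_closed)

lemma coset_eqI: "u - v \<in> J2 n \<Longrightarrow> lcoset (J2 n) u = lcoset (J2 n) v"
proof -
  assume a: "u - v \<in> J2 n"
  have "x - u \<in> J2 n \<longleftrightarrow> x - v \<in> J2 n" for x
    using J2_closed(2)[OF _ a, of "x - u"] J2_closed(5)[OF _ a, of "x - v"] by auto
  then show ?thesis by (auto simp: lcoset_def)
qed

lemma coset_mono: "m \<le> n \<Longrightarrow> lcoset (J2 n) u \<subseteq> lcoset (J2 m) u"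
  using J2_mono by (auto simp: lcoset_def)

lemma coset_mem: "v \<in> lcoset (J2 n) u \<Longrightarrow> lcoset (J2 n) u = lcoset (J2 n) v"
  using coset_eqI[of v u n] by (simp add: lcoset_def)

definition compatible :: "(nat \<Rightarrow> U2 set) \<Rightarrow> bool"
  where "compatible \<xi> \<longleftrightarrow> (\<forall>n. \<exists>u. \<xi> n = lcoset (J2 n) u) \<and> (\<forall>m n. m \<le> n \<longrightarrow> \<xi> n \<subseteq> \<xi> m)"

lemma compatibleD: assumes "compatible \<xi>"
  shows "u \<in> \<xi> n \<Longrightarrow> \<xi> n = lcoset (J2 n) u" "\<exists>u. u \<in> \<xi> n" "m \<le> n \<Longrightarrow> u \<in> \<xi> n \<Longrightarrow> u \<in> \<xi> m"
    "u \<in> \<xi> n \<Longrightarrow> v \<in> \<xi> n \<Longrightarrow> u - v \<in> J2 n"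
proof -
  obtain r where r: "\<And>n. \<xi> n = lcoset (J2 n) (r n)" using assms unfolding compatible_def by metis
  show 1: "u \<in> \<xi> n \<Longrightarrow> \<xi> n = lcoset (J2 n) u" for u using r[of n] coset_mem by metis
  show "\<exists>u. u \<in> \<xi> n" using r[of n] coset_self by blast
  show "m \<le> n \<Longrightarrow> u \<in> \<xi> n \<Longrightarrow> u \<in> \<xi> m" using assms unfolding compatible_def by blast
  show "u \<in> \<xi> n \<Longrightarrow> v \<in> \<xi> n \<Longrightarrow> u - v \<in> J2 n" using 1[of v] by (simp add: lcoset_def)
qed

lemma compatibleI:
  assumes "\<And>n. \<exists>u. \<xi> n = lcoset (J2 n) u \<and> (\<forall>m\<le>n. u \<in> \<xi> m)"
  shows "compatible \<xi>"
  unfolding compatible_def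
proof (intro conjI allI impI)
  show "\<exists>u. \<xi> n = lcoset (J2 n) u" for n using assms by blast
  fix m n :: nat assume "m \<le> n"
  then obtain u v where u: "\<xi> n = lcoset (J2 n) u" "u \<in> \<xi> m" "\<xi> m = lcoset (J2 m) v" using assms by blast
  then have "\<xi> m = lcoset (J2 m) u" using coset_mem by metis
  then show "\<xi> n \<subseteq> \<xi> m" using u coset_mono[OF \<open>m \<le> n\<close>] by simp
qed

text \<open>
  Since every right multiplication \<open>u \<mapsto> u v\<close> is continuous (\<open>J2_cont\<close>), the \<open>n\<close>-th component of a product is the
  coset of \<open>u v\<close>, where \<open>v \<in> \<eta> n\<close> and \<open>u \<in> \<xi> m\<close> with \<open>m\<close> sufficiently large.
\<close>

definition bar_plus :: "(nat \<Rightarrow> U2 set) \<Rightarrow> (nat \<Rightarrow> U2 set) \<Rightarrow> nat \<Rightarrow> U2 set"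
  where "bar_plus \<xi> \<eta> n = {u + v | u v. u \<in> \<xi> n \<and> v \<in> \<eta> n}"
definition bar_uminus :: "(nat \<Rightarrow> U2 set) \<Rightarrow> nat \<Rightarrow> U2 set"
  where "bar_uminus \<xi> n = uminus ` \<xi> n"
definition bar_times :: "(nat \<Rightarrow> U2 set) \<Rightarrow> (nat \<Rightarrow> U2 set) \<Rightarrow> nat \<Rightarrow> U2 set"
  where "bar_times \<xi> \<eta> n = {x. \<exists>v\<in>\<eta> n. \<exists>M. \<forall>m\<ge>M. \<forall>u\<in>\<xi> m. x - u * v \<in> J2 n}"

lemma bar_plus: assumes "compatible \<xi>" "compatible \<eta>"
  shows "compatible (bar_plus \<xi> \<eta>)" "u \<in> \<xi> n \<Longrightarrow> v \<in> \<eta> n \<Longrightarrow> u + v \<in> bar_plus \<xi> \<eta> n"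
proof -
  note C1 = compatibleD[OF assms(1)] and C2 = compatibleD[OF assms(2)]
  show 1: "u \<in> \<xi> n \<Longrightarrow> v \<in> \<eta> n \<Longrightarrow> u + v \<in> bar_plus \<xi> \<eta> n" for u v n
    unfolding bar_plus_def by blast
  show "compatible (bar_plus \<xi> \<eta>)"
  proof (rule compatibleI)
    fix n
    obtain u v where uv: "u \<in> \<xi> n" "v \<in> \<eta> n" using C1(2) C2(2) by blast
    have "bar_plus \<xi> \<eta> n = lcoset (J2 n) (u + v)"
    proof (intro equalityI subsetI)
      fix x assume "x \<in> bar_plus \<xi> \<eta> n"
      then obtain u' v' where "x = u' + v'" "u' \<in> \<xi> n" "v' \<in> \<eta> n" unfolding bar_plus_def by blast
      then show "x \<in> lcoset (J2 n) (u + v)"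
        using J2_closed(2)[OF C1(4)[of u' n u] C2(4)[of v' n v]] uv by (simp add: lcoset_def algebra_simps)
    next
      fix x assume "x \<in> lcoset (J2 n) (u + v)"
      then have "x - v \<in> \<xi> n" using C1(1)[OF uv(1)] by (simp add: lcoset_def algebra_simps)
      then show "x \<in> bar_plus \<xi> \<eta> n" using 1[OF _ uv(2), of "x - v"] by simp
    qed
    then show "\<exists>x. bar_plus \<xi> \<eta> n = lcoset (J2 n) x \<and> (\<forall>m\<le>n. x \<in> bar_plus \<xi> \<eta> m)"
      using 1 uv C1(3) C2(3) by blast
  qed
qed

lemma bar_uminus: assumes "compatible \<xi>"
  shows "compatible (bar_uminus \<xi>)" "u \<in> \<xi> n \<Longrightarrow> - u \<in> bar_uminus \<xi> n"
proof -
  note C1 = compatibleD[OF assms(1)]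
  show 1: "u \<in> \<xi> n \<Longrightarrow> - u \<in> bar_uminus \<xi> n" for u n
    unfolding bar_uminus_def by blast
  show "compatible (bar_uminus \<xi>)"
  proof (rule compatibleI)
    fix n
    obtain u where u: "u \<in> \<xi> n" using C1(2) by blast
    have "bar_uminus \<xi> n = lcoset (J2 n) (- u)"
    proof (intro equalityI subsetI)
      fix x assume "x \<in> bar_uminus \<xi> n"
      then show "x \<in> lcoset (J2 n) (- u)"
        using C1(4)[OF u] by (auto simp: lcoset_def bar_uminus_def)
    next
      fix x assume "x \<in> lcoset (J2 n) (- u)"
      then have "- x \<in> \<xi> n" using C1(1)[OF u] J2_closed(4)[of "x + u" n] by (simp add: lcoset_def)
      then show "x \<in> bar_uminus \<xi> n" using 1[of "- x"] by simp
    qed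
    then show "\<exists>x. bar_uminus \<xi> n = lcoset (J2 n) x \<and> (\<forall>m\<le>n. x \<in> bar_uminus \<xi> m)"
      using 1 u C1(3) by blast
  qed
qed

lemma bar_times: assumes "compatible \<xi>" "compatible \<eta>"
  shows "compatible (bar_times \<xi> \<eta>)"
    "v \<in> \<eta> n \<Longrightarrow> \<forall>x\<in>J2 M. x * v \<in> J2 n \<Longrightarrow> u \<in> \<xi> M \<Longrightarrow> u * v \<in> bar_times \<xi> \<eta> n"
proof -
  note C1 = compatibleD[OF assms(1)] and C2 = compatibleD[OF assms(2)]
  have *: "u' * v - u * v \<in> J2 n"
    if "\<forall>x\<in>J2 M. x * v \<in> J2 n" "u \<in> \<xi> M" "u' \<in> \<xi> m" "m \<ge> M" for M m n u u' v
    using that(1) C1(4)[OF C1(3)[OF that(4,3)] that(2)] by (auto simp flip: left_diff_distrib)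
  show 1: "u * v \<in> bar_times \<xi> \<eta> n" if "v \<in> \<eta> n" "\<forall>x\<in>J2 M. x * v \<in> J2 n" "u \<in> \<xi> M" for u v n M
    unfolding bar_times_def using that(1) *[OF that(2,3)] J2_closed(4)
    by (auto intro!: bexI[of _ v] exI[of _ M]) (metis minus_diff_eq)
  show "compatible (bar_times \<xi> \<eta>)"
  proof (rule compatibleI)
    fix n
    obtain v where v: "v \<in> \<eta> n" using C2(2) by blast
    have "\<forall>k. \<exists>M. \<forall>x\<in>J2 M. x * v \<in> J2 k" using J2_cont by blast
    then obtain f where f: "\<And>k. \<forall>x\<in>J2 (f k). x * v \<in> J2 k" by metis
    define M where "M = Max (f ` {..n})"
    have M: "\<forall>x\<in>J2 M. x * v \<in> J2 k" if "k \<le> n" for k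
    proof -
      have "f k \<le> M" unfolding M_def using that by (intro Max_ge) auto
      then show ?thesis using f[of k] J2_mono by blast
    qed
    obtain u where u: "u \<in> \<xi> M" using C1(2) by blast
    have "bar_times \<xi> \<eta> n = lcoset (J2 n) (u * v)"
    proof (intro equalityI subsetI)
      fix x assume "x \<in> bar_times \<xi> \<eta> n"
      then obtain v' M' where v': "v' \<in> \<eta> n" and M': "\<forall>m\<ge>M'. \<forall>u\<in>\<xi> m. x - u * v' \<in> J2 n"
        unfolding bar_times_def by blast
      obtain u' where u': "u' \<in> \<xi> (max M M')" using C1(2) by blast
      have "x - u' * v' \<in> J2 n" using M' u' max.cobounded2 by blast
      moreover have "u' * (v' - v) \<in> J2 n" using C2(4)[OF v' v] J2_closed(3) by blast
      moreover have "u' * v - u * v \<in> J2 n" using *[OF M u u'] by simp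
      ultimately have "(x - u' * v') + (u' * (v' - v) + (u' * v - u * v)) \<in> J2 n"
        by (intro J2_closed(2))
      then show "x \<in> lcoset (J2 n) (u * v)" by (simp add: lcoset_def algebra_simps)
    next
      fix x assume x: "x \<in> lcoset (J2 n) (u * v)"
      have "x - u' * v \<in> J2 n" if "m \<ge> M" "u' \<in> \<xi> m" for m u'
        using J2_closed(5)[of "x - u * v" n "u' * v - u * v"] x *[OF M u that(2,1)] by (simp add: lcoset_def)
      then show "x \<in> bar_times \<xi> \<eta> n" unfolding bar_times_def using v by blast
    qed
    moreover have "u * v \<in> bar_times \<xi> \<eta> m" if "m \<le> n" for m
      using 1[OF C2(3)[OF that v] M[OF that] u] .
    ultimately show "\<exists>x. bar_times \<xi> \<eta> n = lcoset (J2 n) x \<and> (\<forall>m\<le>n. x \<in> bar_times \<xi> \<eta> m)"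
      by blast
  qed
qed

lemma bar_const: "compatible (\<lambda>n. lcoset (J2 n) u)"
  by (rule compatibleI) (auto intro: coset_self)

lemma compat_component: "compatible (component \<xi>)"
  using component[of \<xi>] by (simp add: compatible_def)

lift_definition of_U2 :: "U2 \<Rightarrow> U2bar" is "\<lambda>u n. lcoset (J2 n) u"
  using bar_const by (auto simp: compatible_def)

instantiation U2bar :: ring_1
begin
definition zero_U2bar :: U2bar where "0 = of_U2 0"
definition one_U2bar :: U2bar where "1 = of_U2 1"
lift_definition plus_U2bar :: "U2bar \<Rightarrow> U2bar \<Rightarrow> U2bar" is bar_plus
  by (rule bar_plus(1)[unfolded compatible_def])
lift_definition uminus_U2bar :: "U2bar \<Rightarrow> U2bar" is bar_uminus
  by (rule bar_uminus(1)[unfolded compatible_def])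
definition minus_U2bar :: "U2bar \<Rightarrow> U2bar \<Rightarrow> U2bar" where "\<xi> - \<eta> = \<xi> + (- \<eta>)" for \<xi> \<eta> :: U2bar
lift_definition times_U2bar :: "U2bar \<Rightarrow> U2bar \<Rightarrow> U2bar" is bar_times
  by (rule bar_times(1)[unfolded compatible_def])
instance
proof
  note C = compatibleD[OF compat_component]
  have eqI: "\<xi> = \<eta>" if "\<And>n. \<exists>x. x \<in> component \<xi> n \<and> x \<in> component \<eta> n" for \<xi> \<eta>
  proof -
    have "component \<xi> n = component \<eta> n" for n
      using that[of n] C(1)[of _ \<xi> n] C(1)[of _ \<eta> n] by metis
    then have "component \<xi> = component \<eta>" by (rule ext)
    then show ?thesis by (simp add: component_inject)
  qed
  have P: "u \<in> component \<xi> n \<Longrightarrow> v \<in> component \<eta> n \<Longrightarrow> u + v \<in> component (\<xi> + \<eta>) n" for u v \<xi> \<eta> n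
    unfolding plus_U2bar.rep_eq by (intro bar_plus(2) compat_component)
  have T: "v \<in> component \<eta> n \<Longrightarrow> \<forall>x\<in>J2 M. x * v \<in> J2 n \<Longrightarrow> u \<in> component \<xi> M \<Longrightarrow> u * v \<in> component (\<xi> * \<eta>) n" for u v \<xi> \<eta> n M
    unfolding times_U2bar.rep_eq by (rule bar_times(2)[OF compat_component compat_component])
  have M: "u \<in> component \<xi> n \<Longrightarrow> - u \<in> component (- \<xi>) n" for u \<xi> n
    unfolding uminus_U2bar.rep_eq by (intro bar_uminus(2) compat_component)
  have O: "u \<in> component (of_U2 u) n" for u n
    by (simp add: of_U2.rep_eq coset_self)
  fix a b c :: U2bar
  show "a + b + c = a + (b + c)"
  proof (rule eqI)
    fix n obtain x y z where "x \<in> component a n" "y \<in> component b n" "z \<in> component c n" using C(2) by metis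
    then have "x + y + z \<in> component (a + b + c) n" "x + (y + z) \<in> component (a + (b + c)) n" by (auto intro!: P)
    then show "\<exists>x. x \<in> component (a + b + c) n \<and> x \<in> component (a + (b + c)) n" by (auto simp: add.assoc)
  qed
  show "a + b = b + a"
  proof (rule eqI)
    fix n obtain x y where "x \<in> component a n" "y \<in> component b n" using C(2) by metis
    then have "x + y \<in> component (a + b) n" "y + x \<in> component (b + a) n" by (auto intro!: P)
    then show "\<exists>x. x \<in> component (a + b) n \<and> x \<in> component (b + a) n" by (auto simp: add.commute)
  qed
  show "0 + a = a"
  proof (rule eqI)
    fix n obtain x where "x \<in> component a n" using C(2) by metis
    then show "\<exists>x. x \<in> component (0 + a) n \<and> x \<in> component a n"
      using P[OF O[of 0 n], of x a] by (auto simp: zero_U2bar_def)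
  qed
  show "- a + a = 0"
  proof (rule eqI)
    fix n obtain x where "x \<in> component a n" using C(2) by metis
    then show "\<exists>x. x \<in> component (- a + a) n \<and> x \<in> component 0 n"
      using P[OF M[of x a n], of x a] O[of 0 n] by (auto simp: zero_U2bar_def)
  qed
  show "a - b = a + - b" by (simp add: minus_U2bar_def)
  show "a * b * c = a * (b * c)"
  proof (rule eqI)
    fix n
    obtain z where z: "z \<in> component c n" using C(2) by metis
    obtain M1 where M1: "\<forall>x\<in>J2 M1. x * z \<in> J2 n" using J2_cont by blast
    obtain y where y: "y \<in> component b M1" using C(2) by metis
    obtain M2 where M2: "\<forall>x\<in>J2 M2. x * y \<in> J2 M1" using J2_cont by blast
    obtain x where x: "x \<in> component a M2" using C(2) by metis
    have "x * y * z \<in> component (a * b * c) n" by (rule T[OF z M1 T[OF y M2 x]])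
    moreover have "\<forall>x\<in>J2 M2. x * (y * z) \<in> J2 n" using M1 M2 by (simp flip: mult.assoc)
    then have "x * (y * z) \<in> component (a * (b * c)) n" by (intro T[OF T[OF z M1 y] _ x])
    ultimately show "\<exists>x. x \<in> component (a * b * c) n \<and> x \<in> component (a * (b * c)) n"
      by (auto simp: mult.assoc)
  qed
  show "1 * a = a"
  proof (rule eqI)
    fix n obtain x where x: "x \<in> component a n" using C(2) by metis
    obtain M where "\<forall>y\<in>J2 M. y * x \<in> J2 n" using J2_cont by blast
    then have "1 * x \<in> component (1 * a) n" by (intro T[OF x]) (auto simp: one_U2bar_def O)
    then show "\<exists>x. x \<in> component (1 * a) n \<and> x \<in> component a n" using x by auto
  qed
  show "a * 1 = a"
  proof (rule eqI)
    fix n obtain x where x: "x \<in> component a n" using C(2) by metis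
    have "x * 1 \<in> component (a * 1) n" by (intro T[OF _ _ x]) (auto simp: one_U2bar_def O)
    then show "\<exists>x. x \<in> component (a * 1) n \<and> x \<in> component a n" using x by auto
  qed
  show "(a + b) * c = a * c + b * c"
  proof (rule eqI)
    fix n obtain z where z: "z \<in> component c n" using C(2) by metis
    obtain M where M: "\<forall>y\<in>J2 M. y * z \<in> J2 n" using J2_cont by blast
    obtain x y where x: "x \<in> component a M" "y \<in> component b M" using C(2) by metis
    have "(x + y) * z \<in> component ((a + b) * c) n" by (rule T[OF z M P[OF x]])
    moreover have "x * z + y * z \<in> component (a * c + b * c) n" by (intro P T[OF z M] x)
    ultimately show "\<exists>x. x \<in> component ((a + b) * c) n \<and> x \<in> component (a * c + b * c) n"
      by (auto simp: distrib_right)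
  qed
  show "a * (b + c) = a * b + a * c"
  proof (rule eqI)
    fix n obtain y z where yz: "y \<in> component b n" "z \<in> component c n" using C(2) by metis
    obtain M1 M2 where "\<forall>x\<in>J2 M1. x * y \<in> J2 n" "\<forall>x\<in>J2 M2. x * z \<in> J2 n" using J2_cont by metis
    then have M: "\<forall>x\<in>J2 (max M1 M2). x * y \<in> J2 n" "\<forall>x\<in>J2 (max M1 M2). x * z \<in> J2 n"
      using J2_mono[of M1 "max M1 M2"] J2_mono[of M2 "max M1 M2"] by auto
    obtain x where x: "x \<in> component a (max M1 M2)" using C(2) by metis
    have "x * (y + z) \<in> component (a * (b + c)) n"
      by (rule T[OF P[OF yz] _ x]) (use M in \<open>auto simp: distrib_left intro: J2_closed(2)\<close>)
    moreover have "x * y + x * z \<in> component (a * b + a * c) n"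
      by (rule P[OF T[OF yz(1) M(1) x] T[OF yz(2) M(2) x]])
    ultimately show "\<exists>x. x \<in> component (a * (b + c)) n \<and> x \<in> component (a * b + a * c) n"
      by (auto simp: distrib_left)
  qed
  show "(0::U2bar) \<noteq> 1"
  proof
    assume "(0::U2bar) = 1"
    then have "1 \<in> component (of_U2 0) 0" using O[of 1 0] by (simp add: zero_U2bar_def one_U2bar_def)
    then show False using J2_proper by (simp add: of_U2.rep_eq lcoset_def)
  qed
qed
end

text \<open>The inverse limit topology of the discrete \<open>U2/J2 n\<close>.\<close>

instantiation U2bar :: topological_space
begin
definition open_U2bar :: "U2bar set \<Rightarrow> bool"
  where "open_U2bar S \<longleftrightarrow> (\<forall>\<xi>\<in>S. \<exists>n. \<forall>\<eta>. component \<eta> n = component \<xi> n \<longrightarrow> \<eta> \<in> S)"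
instance
proof
  have mono: "component \<eta> m = component \<xi> m" if "component \<eta> n = component \<xi> n" "m \<le> n" for \<eta> \<xi> m n
  proof -
    note C = compatibleD[OF compat_component]
    obtain u where "u \<in> component \<eta> n" using C(2) by metis
    then have "u \<in> component \<eta> m" "u \<in> component \<xi> m" using C(3) that by metis+
    then show ?thesis using C(1) by metis
  qed
  show "open (UNIV :: U2bar set)" by (simp add: open_U2bar_def)
  show "open (S \<inter> T)" if ST: "open S" "open T" for S T :: "U2bar set"
    unfolding open_U2bar_def
  proof
    fix \<xi> assume "\<xi> \<in> S \<inter> T"
    then obtain n m where nm: "\<forall>\<eta>. component \<eta> n = component \<xi> n \<longrightarrow> \<eta> \<in> S" "\<forall>\<eta>. component \<eta> m = component \<xi> m \<longrightarrow> \<eta> \<in> T"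
      using ST unfolding open_U2bar_def by blast
    have "\<eta> \<in> S \<inter> T" if e: "component \<eta> (max n m) = component \<xi> (max n m)" for \<eta>
      using nm mono[OF e, of n] mono[OF e, of m] by simp
    then show "\<exists>n. \<forall>\<eta>. component \<eta> n = component \<xi> n \<longrightarrow> \<eta> \<in> S \<inter> T" by blast
  qed
  show "open (\<Union>K)" if K: "\<forall>S\<in>K. open S" for K :: "U2bar set set"
    unfolding open_U2bar_def
  proof
    fix \<xi> assume "\<xi> \<in> \<Union>K"
    then obtain S where S: "S \<in> K" "\<xi> \<in> S" by blast
    with K have "open S" by blast
    with S(2) obtain n where "\<forall>\<eta>. component \<eta> n = component \<xi> n \<longrightarrow> \<eta> \<in> S"
      unfolding open_U2bar_def by blast
    with S(1) show "\<exists>n. \<forall>\<eta>. component \<eta> n = component \<xi> n \<longrightarrow> \<eta> \<in> \<Union>K" by blast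
  qed
qed
end

lifting_forget U2bar.lifting

definition C2 :: U2 where "C2 = U2_gen (0, 1)"

definition U2hat_ideal :: "U2bar set"
  where "U2hat_ideal = is_ideal hull {of_U2 (C2 + U2_scal (fps_const (1/2)))}"

lemma U2hat_ideal: "is_ideal U2hat_ideal" unfolding U2hat_ideal_def by (rule is_ideal_hull)

quotient_type U2hat = U2bar / "\<lambda>x y. x - y \<in> U2hat_ideal"
  by (rule ideal_congs(1)[OF U2hat_ideal])

instantiation U2hat :: "{ring, monoid_mult}"
begin
lift_definition zero_U2hat :: U2hat is 0 .
lift_definition one_U2hat :: U2hat is 1 .
lift_definition plus_U2hat :: "U2hat \<Rightarrow> U2hat \<Rightarrow> U2hat" is "(+)" by (rule ideal_congs(2)[OF U2hat_ideal])
lift_definition minus_U2hat :: "U2hat \<Rightarrow> U2hat \<Rightarrow> U2hat" is "(-)" by (rule ideal_congs(3)[OF U2hat_ideal])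
lift_definition uminus_U2hat :: "U2hat \<Rightarrow> U2hat" is "uminus" by (rule ideal_congs(5)[OF U2hat_ideal])
lift_definition times_U2hat :: "U2hat \<Rightarrow> U2hat \<Rightarrow> U2hat" is "(*)" by (rule ideal_congs(4)[OF U2hat_ideal])
instance
proof
  note Z = left_idealD(1)[OF is_ideal_left[OF U2hat_ideal]]
  fix a b c :: U2hat
  show "a + b + c = a + (b + c)" by transfer (simp add: add.assoc Z)
  show "a + b = b + a" by transfer (simp add: add.commute Z)
  show "0 + a = a" by transfer (simp add: Z)
  show "- a + a = 0" by transfer (simp add: Z)
  show "a - b = a + - b" by transfer (simp add: Z)
  show "a * b * c = a * (b * c)" by transfer (simp add: mult.assoc Z)
  show "1 * a = a" "a * 1 = a" by (transfer; simp add: Z)+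
  show "(a + b) * c = a * c + b * c" by transfer (simp add: distrib_right Z)
  show "a * (b + c) = a * b + a * c" by transfer (simp add: distrib_left Z)
qed
end

definition centre :: "'a::semigroup_mult set"
  where "centre = {x. \<forall>y. y * x = x * y}"

definition w_coord :: "R2 \<Rightarrow> int \<Rightarrow> complex fps"
  where "w_coord f = (THE c. finite {i. c i \<noteq> 0} \<and> f = (\<Sum>i | c i \<noteq> 0. A_R2 (c i) * w2 i))"

definition xw :: "complex sl2 \<Rightarrow> int \<Rightarrow> U2"
  where "xw x i = U2_gen (tens x (w2 i), 0)"

text \<open>\<open>nprod_w x i y j\<close> is \<open>:(x w2\<^sub>i)(y w2\<^sub>j):\<close>, and \<open>nprod x f y g\<close> is its bilinear extension \<open>:(x f)(y g):\<close>.\<close>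

definition nprod_w :: "complex sl2 \<Rightarrow> int \<Rightarrow> complex sl2 \<Rightarrow> int \<Rightarrow> U2"
  where "nprod_w x i y j = (if i \<le> j then xw x i * xw y j else xw y j * xw x i)"

definition nprod :: "complex sl2 \<Rightarrow> R2 \<Rightarrow> complex sl2 \<Rightarrow> R2 \<Rightarrow> U2"
  where "nprod x f y g =
    (\<Sum>i | w_coord f i \<noteq> 0. \<Sum>j | w_coord g j \<noteq> 0. U2_scal (w_coord f i * w_coord g j) * nprod_w x i y j)"

definition is_sl2_basis :: "('i::finite \<Rightarrow> complex sl2) \<Rightarrow> bool"
  where "is_sl2_basis J \<longleftrightarrow> (\<forall>x. \<exists>!c. x = (\<Sum>\<alpha>\<in>UNIV. sl_scale (c \<alpha>) (J \<alpha>)))"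

definition is_killing_dual :: "('i::finite \<Rightarrow> complex sl2) \<Rightarrow> ('i \<Rightarrow> complex sl2) \<Rightarrow> bool"
  where "is_killing_dual J J' \<longleftrightarrow> (\<forall>\<alpha> \<beta>. killing (J \<alpha>) (J' \<beta>) = (if \<alpha> = \<beta> then 1 else 0))"

text \<open>
  The series is summed in the completion of \<open>U2\<close> and its sum is mapped to the quotient \<open>U2hat\<close>. In doubled indices
  \<open>-n - 1/2\<close> is \<open>-i - 1\<close>.
\<close>

definition sugawara2 :: "('i::finite \<Rightarrow> complex sl2) \<Rightarrow> ('i \<Rightarrow> complex sl2) \<Rightarrow> int \<Rightarrow> U2hat"
  where "sugawara2 J J' k = abs_U2hat (THE S.
    ((\<lambda>(i, \<alpha>). of_U2 (nprod (J \<alpha>) (w2 i) (J' \<alpha>) (z2 (- i - 1) * w2 k))) has_sum S) UNIV)"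

end

theory Submission
  imports Defs
begin

text \<open>
  Write \<open>h = w2 k\<close> and \<open>f\<^sub>i = w2 i\<close>. The elements \<open>f'\<^sub>i = z2 (- i - 1)\<close> form the dual basis of the \<open>f\<^sub>i\<close> under the
  residue pairing \<open>res2 (f g)\<close>, and \<open>\<Sum>\<^sub>\<alpha> J \<alpha> \<otimes> J' \<alpha>\<close> is the Casimir tensor of \<open>\<gg>\<close>. Because that tensor is symmetric,
  normal ordering changes a summand of the Sugawara series only by a multiple of \<open>C2\<close>
  (\<open>normal_ordering_central\<close>), so the commutator of a current \<open>x g\<close> with a finite truncation of the series
  can be computed without it. There are two kinds of contributions (\<open>commutator_casimir_current\<close>).

  \<^item> The cocycle enters once through each factor, and by duality each time yields \<open>C2\<close> times the current
    \<open>x (g' h)\<close>, in total \<open>2 C2 x (g' h)\<close> (\<open>commutator_partial_sum\<close>).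

  \<^item> Invariance of the Casimir tensor turns the quadratic terms into
    \<open>\<Sum>\<^sub>i (T (g f\<^sub>i) (f'\<^sub>i h) - T f\<^sub>i (g f'\<^sub>i h))\<close>, where \<open>T\<close> is \<open>twisted_casimir x\<close>. Only boundary terms of the truncation
    survive. Those at \<open>- \<infinity>\<close> tend to \<open>0\<close>, while those at \<open>+ \<infinity>\<close> have their factors in the wrong order;
    exchanging them leaves \<open>x (g' h)\<close>, since the Casimir element acts on \<open>\<gg>\<close> by \<open>1\<close>
    (\<open>twisted_casimir_swap\<close>, \<open>anomaly_w_1\<close>, \<open>anomaly_w_m2\<close>).

  Thus \<open>[x g, S] = (2 C2 + 1) x (g' h)\<close> for the sum \<open>S\<close> of the series (\<open>commutator_current\<close>). The
  computation is carried out for the algebra generators \<open>g = s\<close> and \<open>g = 1/(ts)\<close> of \<open>R2\<close>; both sides are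
  compatible with brackets of currents, which gives all other \<open>g\<close>.

  The factor \<open>2 C2 + 1\<close> is \<open>0\<close> in \<open>U2hat\<close>. An arbitrary element of the completion is a convergent series of
  elements of \<open>J2 n\<close> with \<open>n\<close> growing, and \<open>x g \<mapsto> x (g' h)\<close> preserves smallness, so the quotients of the
  commutators by \<open>2 C2 + 1\<close> again form a convergent series. Hence \<open>[\<xi>, S]\<close> is a multiple of \<open>2 C2 + 1\<close> for
  every \<open>\<xi>\<close> (\<open>commutator_U2bar\<close>).
\<close>

section \<open>The residue pairing\<close>

lemma fls_deriv_power_int:
  fixes x :: "'a::field fls"
  assumes "x \<noteq> 0"
  shows "fls_deriv (x powi n) = of_int n * x powi (n - 1) * fls_deriv x"
proof (induction n rule: int_induct[where k = 0])
  case (step1 i)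
  have "x powi (i + 1) = x powi i * x" "x powi i = x powi (i - 1) * x"
    using assms by (simp_all add: power_int_add power_int_diff)
  then show ?case using step1(2) by (simp add: algebra_simps)
next
  case (step2 i)
  have e: "x powi i = x powi (i - 1) * x" "x powi (i - 1) = x powi (i - 2) * x"
    using assms by (simp_all add: power_int_diff power2_eq_square)
  then have "fls_deriv (x powi (i - 1)) * x + x powi (i - 1) * fls_deriv x
      = of_int i * x powi (i - 1) * fls_deriv x"
    using step2(2) by (simp add: algebra_simps)
  then have "fls_deriv (x powi (i - 1)) * x = (of_int (i - 1) * x powi (i - 2) * fls_deriv x) * x"
    using e(2) by (simp add: algebra_simps)
  then have "fls_deriv (x powi (i - 1)) = of_int (i - 1) * x powi (i - 2) * fls_deriv x"
    using assms by (metis mult_right_cancel)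
  then show ?case by simp
qed simp

lemma expand_1: "shom \<phi> \<Longrightarrow> expand_K2 \<phi> 1 = 1"
  using expand_emb[of \<phi> 1] unfolding shom_def by (metis emb_simps(2) A_Q_simps(2) shom_def)

lemma expand_powi:
  assumes \<phi>: "shom \<phi>" and x: "x \<in> K2" "inverse x \<in> K2" "x \<noteq> 0"
  shows "expand_K2 \<phi> (x powi n) = expand_K2 \<phi> x powi n"
proof -
  have p: "expand_K2 \<phi> (y ^ k) = expand_K2 \<phi> y ^ k" if "y \<in> K2" for y k
    by (induction k) (simp_all add: expand_1 \<phi> expand_mult K2_power that)
  have "expand_K2 \<phi> x * expand_K2 \<phi> (inverse x) = 1"
    using expand_mult[OF \<phi> x(1,2)] x(3) expand_1[OF \<phi>] by simp
  then have "expand_K2 \<phi> (inverse x) = inverse (expand_K2 \<phi> x)"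
    by (metis inverse_unique)
  then show ?thesis using x p by (simp add: power_int_def)
qed

text \<open>
  Such an expansion carries \<open>\<partial>/\<partial>t + \<partial>/\<partial>s\<close> to the derivative in the outer variable, and derivatives of
  Laurent series have no residue.
\<close>

lemma residue_expand_der_w:
  assumes \<phi>: "shom \<phi>" and A: "\<And>p. expand_K2 \<phi> (A_K p) = fls_const (fps_to_fls p)"
    and t: "fls_deriv (to_Q (\<phi> tt)) = 1" and s: "fls_deriv (to_Q (\<phi> ss)) = 1"
  shows "fls_nth (expand_K2 \<phi> (der_K (w_K i))) (- 1) = 0"
proof -
  define D where "D f \<longleftrightarrow> f \<in> K2 \<and> der_K f \<in> K2 \<and> expand_K2 \<phi> (der_K f) = fls_deriv (expand_K2 \<phi> f)" for f
  have mult: "D (f * g)" if "D f" "D g" for f g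
    using that by (simp add: D_def der_mult K2_mult K2_add expand_add[OF \<phi>] expand_mult[OF \<phi>])
  have powi: "D (emb x powi n)"
    if x: "emb x \<noteq> 0" "inverse (emb x) \<in> K2" "der_ts x = 1" "fls_deriv (to_Q (\<phi> x)) = 1"
      and K: "\<And>n. emb x powi n \<in> K2" for x n
  proof -
    have d: "der_K (emb x powi n) = A_K (of_int n) * emb x powi (n - 1)"
      using x by (simp add: der_powi der_emb A_K_of_int)
    have "expand_K2 \<phi> (emb x) * expand_K2 \<phi> (inverse (emb x)) = 1"
      using expand_mult[OF \<phi>, of "emb x" "inverse (emb x)"] x expand_1[OF \<phi>] by simp
    then have "to_Q (\<phi> x) \<noteq> 0" by (auto simp: expand_emb[OF \<phi>])
    then have "fls_deriv (to_Q (\<phi> x) powi n) = of_int n * to_Q (\<phi> x) powi (n - 1)"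
      using x(4) by (simp add: fls_deriv_power_int)
    then show ?thesis unfolding D_def d
      using x K by (simp add: K2_mult expand_mult[OF \<phi>] A expand_powi[OF \<phi>] expand_emb[OF \<phi>]
        fps_to_fls_of_int fls_of_int)
  qed
  have T: "D (emb tt powi n)" and S: "D (emb ss powi n)" for n
    by (rule powi; use s t K2_inverse_ts K2_powi in simp)+
  have "D (w_K i)"
    unfolding w_K_def u_K_def v_K_def using mult T S by auto
  then show ?thesis unfolding D_def using fls_deriv_residue by metis
qed

lemma to_Q_ss: "to_Q ss = fls_X"
proof -
  have "Abs_fps (\<lambda>n. fps_to_fls (fps_nth (ss :: complex fps fps) n)) = fps_X"
    by (rule fps_ext) (simp add: fps_X_def)
  then show ?thesis unfolding to_Q_def by simp
qed

lemma to_Q_diff: "to_Q (f - g) = to_Q f - to_Q g"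
  using A_Q_simps(3)[of f "- g"] by (simp del: A_Q_simps(3))

lemmas E_t_generators =
  subst2_X_inner[of ss "ss - tt", simplified] subst2_X_outer[of ss "ss - tt", simplified]
lemmas E_s_generators =
  subst2_X_inner[of "ss + tt" ss, simplified] subst2_X_outer[of "ss + tt" ss, simplified]

lemma Res2_der_w: "Res2 (der_K (w_K i)) = 0"
proof -
  have "fls_nth (E_t (der_K (w_K i))) (- 1) = 0"
    unfolding E_t_def
    by (rule residue_expand_der_w[OF shom_t])
       (simp_all add: E_t_A[unfolded E_t_def] E_t_generators to_Q_diff to_Q_ss A_Q_const)
  moreover have "fls_nth (E_s (der_K (w_K i))) (- 1) = 0"
    unfolding E_s_def
    by (rule residue_expand_der_w[OF shom_s])
       (simp_all add: E_s_A[unfolded E_s_def] E_s_generators to_Q_ss A_Q_const)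
  ultimately show ?thesis by (simp add: Res2_def)
qed

lemma residue_inverse_unit:
  fixes f :: "complex fps fps"
  assumes "fps_nth f 0 \<noteq> 0"
  shows "fls_nth (inverse (to_Q f)) (- 1) = 0"
proof -
  have "fls_nth (to_Q f) 0 \<noteq> 0" using assms by (simp add: to_Q_def)
  moreover have "fls_nth (to_Q f) n = 0" if "n < 0" for n
    using that by (rule fls_nth_A_Q_neg)
  ultimately have "fls_subdegree (to_Q f) = 0"
    by (intro fls_subdegree_eqI) auto
  then have "fls_subdegree (inverse (to_Q f)) = 0" by simp
  then show ?thesis by (intro fls_eq0_below_subdegree) simp
qed

lemma Res2_inverse_t: "Res2 (inverse (emb tt)) = 1"
  and Res2_inverse_s: "Res2 (inverse (emb ss)) = 1"
proof -
  have inv: "expand_K2 \<phi> (inverse (emb x)) = inverse (to_Q (\<phi> x))"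
    if "shom \<phi>" "inverse (emb x) \<in> K2" "emb x \<noteq> 0" for \<phi> x
    using expand_powi[of \<phi> "emb x" "-1"] that by (simp add: expand_emb)
  have nz: "fps_nth (ss - tt) 0 \<noteq> (0::complex fps)" "fps_nth (ss + tt) 0 \<noteq> (0::complex fps)" by simp_all
  have X: "fls_nth (inverse (fls_X :: complex fls fls)) (- 1) = 1"
    by (simp add: fls_inverse_X)
  show "Res2 (inverse (emb tt)) = 1"
    unfolding Res2_def E_t_def E_s_def inv[OF shom_t K2_inverse_ts(1) tsn0(3)] inv[OF shom_s K2_inverse_ts(1) tsn0(3)]
    unfolding E_t_generators E_s_generators residue_inverse_unit[OF nz(2)] to_Q_ss X by simp
  show "Res2 (inverse (emb ss)) = 1"
    unfolding Res2_def E_t_def E_s_def inv[OF shom_t K2_inverse_ts(2) tsn0(4)] inv[OF shom_s K2_inverse_ts(2) tsn0(4)]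
    unfolding E_t_generators E_s_generators residue_inverse_unit[OF nz(1)] to_Q_ss X by simp
qed

lemma w_K_even: "w_K (2 * n) = u_K n" and w_K_odd: "w_K (2 * n + 1) = v_K n"
  by (simp_all add: w_K_def)

text \<open>
  For \<open>i \<ge> 0\<close> there are no poles. For \<open>i < 0\<close>, the vanishing of the residues of derivatives is a recursion
  that starts with \<open>1/(ts)\<close> and \<open>1/t\<close>. The residue of \<open>1/(ts)\<close> vanishes since \<open>a/(ts) = 1/s - 1/t\<close> and \<open>Q\<close>
  is a field.
\<close>

lemma Res2_w: "Res2 (w_K i) = (if i = - 1 then 1 else 0)"
proof -
  define X where "X = fps_to_fls (fps_X :: complex fps)"
  have X: "X \<noteq> 0" unfolding X_def by simp
  define r q where "r n = Res2 (u_K n)" and "q n = Res2 (v_K n)" for n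
  have aK: "A_K p * f \<in> K2" if "f \<in> K2" for p f using that by (simp add: K2_mult)
  have rq: "of_int n * (2 * q (n - 1) + X * r (n - 1)) = 0" for n
  proof -
    have "der_K (u_K n) = A_K (of_int (2 * n)) * v_K (n - 1) + A_K (of_int n * fps_X) * u_K (n - 1)"
      unfolding A_K_mult A_K_of_int der_u by (simp add: algebra_simps)
    then have "0 = of_int (2 * n) * q (n - 1) + of_int n * X * r (n - 1)"
      using Res2_der_w[of "2 * n"] unfolding w_K_even q_def r_def X_def
      by (simp add: Res2_add aK Res2_A fls_times_fps_to_fls fps_to_fls_of_int del: A_K_mult of_int_mult)
    then show ?thesis by (simp add: algebra_simps)
  qed
  have qr: "of_int (2 * n + 1) * r n = of_int n * X * q (n - 1)" for n
  proof -
    have "der_K (v_K n) = A_K (of_int (2 * n + 1)) * u_K n + A_K (- of_int n * fps_X) * v_K (n - 1)"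
      unfolding A_K_mult A_K_minus A_K_of_int der_v by (simp add: algebra_simps)
    then have "Res2 (A_K (of_int (2 * n + 1)) * u_K n + A_K (- of_int n * fps_X) * v_K (n - 1)) = 0"
      using Res2_der_w[of "2 * n + 1"] unfolding w_K_odd by simp
    then have "of_int (2 * n + 1) * r n + - of_int n * X * q (n - 1) = 0"
      unfolding q_def r_def X_def Res2_add[OF aK aK, OF u_K2 v_K2] Res2_A[OF u_K2] Res2_A[OF v_K2]
      by (simp add: fls_times_fps_to_fls)
    then show ?thesis by (simp add: algebra_simps)
  qed
  have q1: "q (- 1) = 1" unfolding q_def v_K_def by (simp add: power_int_minus Res2_inverse_t)
  have r1: "r (- 1) = 0"
  proof -
    have "y_K (- 1) = inverse (emb ss)" by (simp add: y_K_def power_int_minus)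
    then have "inverse (emb ss) = v_K (- 1) + A_K fps_X * u_K (- 1)"
      using uv_rules(5)[of "-1"] by simp
    then have "1 = q (- 1) + X * r (- 1)"
      using Res2_inverse_s unfolding q_def r_def X_def by (simp add: Res2_add aK Res2_A)
    then show ?thesis using q1 X by simp
  qed
  have down: "r (- 1 - int m) = 0 \<and> (m \<noteq> 0 \<longrightarrow> q (- 1 - int m) = 0)" for m
  proof (induction m)
    case (Suc m)
    define n where "n = - 1 - int m"
    have e: "- 1 - int (Suc m) = n - 1" and n: "(of_int n :: complex fls) \<noteq> 0" "r n = 0"
      using Suc by (simp_all add: n_def del: of_int_diff)
    have "of_int n * X * q (n - 1) = 0" using qr[of n] n by simp
    then have "q (n - 1) = 0" using X n by (simp del: of_int_eq_0_iff)
    then show ?case unfolding e using rq[of n] X n by (simp del: of_int_eq_0_iff)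
  qed (simp add: r1)
  have neg: "r n = 0" "n \<noteq> - 1 \<Longrightarrow> q n = 0" if "n < 0" for n
    using down[of "nat (- 1 - n)"] that by simp_all
  have pos: "r n = 0" "q n = 0" if "0 \<le> n" for n
    using w_K_emb[of "2 * n"] w_K_emb[of "2 * n + 1"] that Res2_emb
    unfolding r_def q_def w_K_even w_K_odd by fastforce+
  show ?thesis
  proof (cases "even i")
    case True
    then obtain n where i: "i = 2 * n" by (rule evenE)
    moreover have "i \<noteq> - 1" using True by auto
    moreover have "r n = 0" using neg(1)[of n] pos(1)[of n] by (cases "n < 0") simp_all
    ultimately show ?thesis by (simp add: w_K_even r_def)
  next
    case False
    then obtain n where i: "i = 2 * n + 1" by (rule oddE)
    then show ?thesis using neg(2)[of n] pos(2)[of n] q1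
      unfolding i w_K_odd q_def[symmetric] by (cases "n = - 1"; cases "n < 0") simp_all
  qed
qed

lemma R2_induct [case_names w add scale]:
  assumes w: "\<And>i. P (w2 i)" and add: "\<And>f g. P f \<Longrightarrow> P g \<Longrightarrow> P (f + g)"
    and scale: "\<And>p f. P f \<Longrightarrow> P (A_R2 p * f)"
  shows "P f"
proof -
  have "\<exists>g. K_of_R2 g = K_of_R2 f \<and> P g"
    using K_of_R2[of f]
  proof (induction rule: AK.span_induct)
    case base
    show ?case unfolding AK.subspace_def
    proof safe
      show "\<exists>g. K_of_R2 g = 0 \<and> P g"
        using scale[OF w, of 0 0] by (intro exI[of _ 0]) (simp add: zero_R2.rep_eq)
      show "\<exists>k. K_of_R2 k = K_of_R2 g + K_of_R2 h \<and> P k" if "P g" "P h" for g h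
        using add[OF that] by (intro exI[of _ "g + h"]) (simp add: plus_R2.rep_eq)
      show "\<exists>k. K_of_R2 k = A_K c * K_of_R2 g \<and> P k" if "P g" for c g
        using scale[OF that] by (intro exI[of _ "A_R2 c * g"]) (simp add: times_R2.rep_eq A_R2.rep_eq)
    qed
  next
    case (step x)
    then show ?case using w w2.rep_eq by force
  qed
  then show ?thesis by (simp add: K_of_R2_inject)
qed

lemma K_of_R2_K2: "K_of_R2 f \<in> K2"
proof (induction f rule: R2_induct)
  case (w i) then show ?case by (simp add: w2.rep_eq)
next
  case (add f g) then show ?case by (simp add: plus_R2.rep_eq K2_add)
next
  case (scale p f) then show ?case by (simp add: times_R2.rep_eq A_R2.rep_eq K2_mult)
qed

text \<open>
  Residues on \<open>R2\<close> lie in \<open>A\<close> because those of the basis \<open>w2\<close> are \<open>0\<close> or \<open>1\<close>, so \<open>res2\<close> is linear over \<open>A\<close>.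
\<close>

lemma Res_R2_eq: "Res_R2 f = fps_to_fls (res2 f)"
proof -
  have "\<exists>p. Res_R2 f = fps_to_fls p"
  proof (induction f rule: R2_induct)
    case (w i)
    have "Res_R2 (w2 i) = fps_to_fls (if i = - 1 then 1 else 0)"
      by (simp add: Res_R2.rep_eq w2.rep_eq Res2_w)
    then show ?case by blast
  next
    case (add f g)
    then obtain p q where "Res_R2 f = fps_to_fls p" "Res_R2 g = fps_to_fls q" by blast
    then have "Res_R2 (f + g) = fps_to_fls (p + q)"
      by (simp add: Res_R2.rep_eq plus_R2.rep_eq Res2_add K_of_R2_K2)
    then show ?case by blast
  next
    case (scale c f)
    then obtain p where "Res_R2 f = fps_to_fls p" by blast
    then have "Res_R2 (A_R2 c * f) = fps_to_fls (c * p)"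
      by (simp add: Res_R2.rep_eq times_R2.rep_eq A_R2.rep_eq Res2_A K_of_R2_K2 fls_times_fps_to_fls)
    then show ?case by blast
  qed
  then show ?thesis unfolding res2_def by auto
qed

lemma res2_eqI: "Res_R2 f = fps_to_fls p \<Longrightarrow> res2 f = p"
  by (simp add: Res_R2_eq)

lemma res2_add [simp]: "res2 (f + g) = res2 f + res2 g"
  by (rule res2_eqI, simp only: Res_R2.rep_eq plus_R2.rep_eq Res2_add[OF K_of_R2_K2 K_of_R2_K2])
     (simp only: Res_R2.rep_eq[symmetric] Res_R2_eq fps_to_fls_plus)

lemma res2_A [simp]: "res2 (A_R2 p * f) = p * res2 f"
  by (rule res2_eqI, simp only: Res_R2.rep_eq times_R2.rep_eq A_R2.rep_eq Res2_A[OF K_of_R2_K2])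
     (simp only: Res_R2.rep_eq[symmetric] Res_R2_eq fls_times_fps_to_fls)

lemma res2_0 [simp]: "res2 0 = 0"
  using res2_A[of 0 0] by simp

lemma res2_w: "res2 (w2 i) = (if i = - 1 then 1 else 0)"
  by (rule res2_eqI) (simp add: Res_R2.rep_eq w2.rep_eq Res2_w)

abbreviation a2 :: R2 where "a2 \<equiv> A_R2 fps_X"

lemma w2_0: "w2 0 = 1"
  by transfer (rule w_K_0)

lemma w2_mult: "w2 i * w2 j = (if odd i \<and> odd j then w2 (i + j) - a2 * w2 (i + j - 1) else w2 (i + j))"
  by transfer (simp add: w_mult)

lemma z2_eq: "z2 i = (if even i then w2 i else w2 i + a2 * w2 (i - 1))"
  by transfer (simp add: z_K)

text \<open>
  For odd \<open>i\<close> and \<open>j\<close>, the term with \<open>a\<close> in \<open>z2 j\<close> cancels the one in the product \<open>w2 i * w2 j\<close>.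
\<close>

lemma w2_mult_z2: "w2 i * z2 j = (if even i \<and> odd j then z2 (i + j) else w2 (i + j))"
  by (auto simp: z2_eq w2_mult distrib_left mult.left_commute[of "w2 i"] add_diff_eq)

lemma res2_w_z: "res2 (w2 i * z2 j) = (if i + j = - 1 then 1 else 0)"
proof -
  have "i + j \<noteq> 0" "odd (i + j)" if "even i" "odd j" using that by (presburger, simp)
  moreover have "res2 (z2 k) = (if k = - 1 then 1 else 0)" if "odd k" for k
    using that by (auto simp: z2_eq res2_w)
  ultimately show ?thesis by (simp add: w2_mult_z2 res2_w)
qed

lemma res2_z_w: "res2 (z2 i * w2 j) = (if i + j = - 1 then 1 else 0)"
  using res2_w_z[of j i] by (simp add: mult.commute add.commute)

text \<open>
  Stated for all long symmetric truncations, because the Sugawara series will be cut off at such truncations.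
\<close>

definition eventual_expansion :: "(int \<Rightarrow> R2) \<Rightarrow> (int \<Rightarrow> R2) \<Rightarrow> R2 \<Rightarrow> bool"
  where "eventual_expansion p q f \<longleftrightarrow>
    (\<exists>N0. \<forall>N\<ge>N0. (\<Sum>i\<in>{-N..N}. A_R2 (res2 (f * p i)) * q i) = f)"

lemma eventual_expansion_add:
  assumes "eventual_expansion p q f" "eventual_expansion p q g"
  shows "eventual_expansion p q (f + g)"
proof -
  obtain N0 N1 where
    "\<And>N. N \<ge> N0 \<Longrightarrow> (\<Sum>i\<in>{-N..N}. A_R2 (res2 (f * p i)) * q i) = f"
    "\<And>N. N \<ge> N1 \<Longrightarrow> (\<Sum>i\<in>{-N..N}. A_R2 (res2 (g * p i)) * q i) = g"
    using assms unfolding eventual_expansion_def by blast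
  then have "(\<Sum>i\<in>{-N..N}. A_R2 (res2 ((f + g) * p i)) * q i) = f + g" if "N \<ge> max N0 N1" for N
    using that by (simp add: distrib_right sum.distrib)
  then show ?thesis unfolding eventual_expansion_def by blast
qed

lemma eventual_expansion_scale:
  assumes "eventual_expansion p q f"
  shows "eventual_expansion p q (A_R2 c * f)"
proof -
  obtain N0 where "\<And>N. N \<ge> N0 \<Longrightarrow> (\<Sum>i\<in>{-N..N}. A_R2 (res2 (f * p i)) * q i) = f"
    using assms unfolding eventual_expansion_def by blast
  then have "(\<Sum>i\<in>{-N..N}. A_R2 (res2 (A_R2 c * f * p i)) * q i) = A_R2 c * f" if "N \<ge> N0" for N
    using that by (simp add: mult.assoc flip: sum_distrib_left)
  then show ?thesis unfolding eventual_expansion_def by blast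
qed

lemma eventual_expansion_dual:
  assumes "\<And>i. res2 (q j * p i) = (if i = j then 1 else 0)"
  shows "eventual_expansion p q (q j)"
proof -
  have "(\<Sum>i\<in>{-N..N}. A_R2 (res2 (q j * p i)) * q i) = q j" if "N \<ge> \<bar>j\<bar>" for N
  proof -
    have "(\<Sum>i\<in>{-N..N}. A_R2 (res2 (q j * p i)) * q i) = (\<Sum>i\<in>{-N..N}. if i = j then q j else 0)"
      by (intro sum.cong refl) (simp add: assms)
    then show ?thesis using that by auto
  qed
  then show ?thesis unfolding eventual_expansion_def by blast
qed

lemma expand_in_w: "eventual_expansion (\<lambda>i. z2 (- i - 1)) w2 f"
proof (induction f rule: R2_induct)
  case (w j)
  show ?case by (rule eventual_expansion_dual) (simp add: res2_w_z)
qed (intro eventual_expansion_add eventual_expansion_scale; assumption)+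

lemma expand_in_z: "eventual_expansion w2 (\<lambda>i. z2 (- i - 1)) f"
proof (induction f rule: R2_induct)
  case (w j)
  have z: "eventual_expansion w2 (\<lambda>i. z2 (- i - 1)) (z2 j)" for j
    using eventual_expansion_dual[of "\<lambda>i. z2 (- i - 1)" "- j - 1" w2] by (simp add: res2_z_w)
  show ?case
  proof (cases "even j")
    case True
    then have "w2 j = z2 j" by (simp add: z2_eq)
    with z show ?thesis by simp
  next
    case False
    then have "w2 j = z2 j + A_R2 (- fps_X) * z2 (j - 1)" by (simp add: z2_eq)
    with z show ?thesis by (simp only: eventual_expansion_add eventual_expansion_scale)
  qed
qed (intro eventual_expansion_add eventual_expansion_scale; assumption)+

lemma
  shows w_coord_eq: "w_coord f i = res2 (f * z2 (- i - 1))"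
    and w_coord_sum: "f = (\<Sum>i | w_coord f i \<noteq> 0. A_R2 (w_coord f i) * w2 i)"
proof -
  let ?c = "\<lambda>i. res2 (f * z2 (- i - 1))"
  obtain N where N: "f = (\<Sum>i\<in>{-N..N}. A_R2 (?c i) * w2 i)"
    using expand_in_w[of f] unfolding eventual_expansion_def by (metis order_refl)
  have coeff: "res2 ((\<Sum>i\<in>S. A_R2 (c i) * w2 i) * z2 (- j - 1)) = (if j \<in> S then c j else 0)"
    if "finite S" for S c j
  proof -
    have "res2 ((\<Sum>i\<in>S. A_R2 (c i) * w2 i) * z2 (- j - 1))
        = (\<Sum>i\<in>S. c i * res2 (w2 i * z2 (- j - 1)))"
      by (induction S rule: infinite_finite_induct) (simp_all add: distrib_right mult.assoc)
    also have "\<dots> = (\<Sum>i\<in>S. if i = j then c j else 0)"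
      by (intro sum.cong refl) (auto simp: res2_w_z)
    finally show ?thesis using that by simp
  qed
  have supp: "{i. ?c i \<noteq> 0} \<subseteq> {-N..N}"
  proof safe
    fix j assume "?c j \<noteq> 0"
    moreover have "?c j = (if j \<in> {-N..N} then ?c j else 0)"
      using coeff[of "{-N..N}" ?c j] unfolding N[symmetric] by simp
    ultimately show "j \<in> {-N..N}" by metis
  qed
  then have fin: "finite {i. ?c i \<noteq> 0}" by (rule finite_subset) simp
  have sum: "f = (\<Sum>i | ?c i \<noteq> 0. A_R2 (?c i) * w2 i)"
    by (rule trans[OF N sum.mono_neutral_right[OF _ supp]]) auto
  have "w_coord f = ?c"
    unfolding w_coord_def
  proof (rule the_equality)
    show "finite {i. ?c i \<noteq> 0} \<and> f = (\<Sum>i | ?c i \<noteq> 0. A_R2 (?c i) * w2 i)" using fin sum by (rule conjI)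
    fix c assume c: "finite {i. c i \<noteq> 0} \<and> f = (\<Sum>i | c i \<noteq> 0. A_R2 (c i) * w2 i)"
    show "c = ?c"
    proof
      fix j
      have "?c j = res2 ((\<Sum>i | c i \<noteq> 0. A_R2 (c i) * w2 i) * z2 (- j - 1))"
        by (subst conjunct2[OF c]) (rule refl)
      also have "\<dots> = c j" using coeff[OF conjunct1[OF c], of c j] by simp
      finally show "c j = ?c j" by simp
    qed
  qed
  then have c: "w_coord f j = ?c j" for j by (rule fun_cong)
  show "w_coord f i = ?c i" by (rule c)
  show "f = (\<Sum>i | w_coord f i \<noteq> 0. A_R2 (w_coord f i) * w2 i)" unfolding c by (rule sum)
qed

lemma w_coord_w: "w_coord (w2 i) j = (if j = i then 1 else 0)"
  by (auto simp: w_coord_eq res2_w_z)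

lemma deriv_R2_mult: "deriv_R2 (f * g) = deriv_R2 f * g + f * deriv_R2 g"
  by transfer (rule der_mult)

lemma RR_z: "z2 i \<in> RR (i - 1)"
proof -
  have w: "w2 j \<in> RR (i - 1)" if "i - 1 \<le> j" for j using RR_mono[OF that RR_w] .
  show ?thesis unfolding z2_eq by (auto intro!: RR_add RR_A w)
qed

lemma w_coord_RR: "f \<in> RR N \<Longrightarrow> j + 3 \<le> N \<Longrightarrow> w_coord f j = 0"
  unfolding w_coord_eq
  using res_RR[OF RR_mono[OF _ RR_mult[OF _ RR_z]], of N "- j - 1" f] by simp

section \<open>The Casimir tensor of sl2\<close>

definition commutator :: "'a::ring \<Rightarrow> 'a \<Rightarrow> 'a"
  where "commutator u v = u * v - v * u"

lemma commutator_add_right: "commutator u (v + w) = commutator u v + commutator u w"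
  and commutator_add_left: "commutator (u + v) w = commutator u w + commutator v w"
  and commutator_mult_right: "commutator u (v * w) = commutator u v * w + v * commutator u w"
  and commutator_mult_left: "commutator (u * v) w = u * commutator v w + commutator u w * v"
  and commutator_diff_left: "commutator (u - v) w = commutator u w - commutator v w"
  by (simp_all add: commutator_def algebra_simps)

lemma commutator_sum_right: "commutator u (sum f S) = (\<Sum>x\<in>S. commutator u (f x))"
  by (simp add: commutator_def sum_distrib_left sum_distrib_right sum_subtractf)

lemmas sl2_entries = plus_sl2.rep_eq zero_sl2.rep_eq minus_sl2.rep_eq uminus_sl2.rep_eq
  sl_scale.rep_eq sl_h.rep_eq sl_e.rep_eq sl_f.rep_eq tens.rep_eq

lemma lie_bilinear:
  "lie (x + y) z = lie x z + lie y z" "lie x (y + z) = lie x y + lie x z"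
  "lie (sl_scale c x) y = sl_scale c (lie x y)" "lie x (sl_scale c y) = sl_scale c (lie x y)"
  "lie x 0 = 0" "lie 0 x = 0"
  by (rule sl2_eqI; simp add: mat_of_lie sl2_entries algebra_simps)+

lemma killing_bilinear:
  "killing (x + y) z = killing x z + killing y z" "killing x (y + z) = killing x y + killing x z"
  "killing (sl_scale c x) y = c * killing x y" "killing x (sl_scale c y) = c * killing x y"
  "killing x 0 = 0" "killing 0 x = 0"
  by (simp_all add: killing_eq sl2_entries algebra_simps)

lemma killing_sym: "killing x y = killing y x"
  by (simp add: killing_eq)

lemma killing_invariant: "killing (lie x y) z = killing x (lie y z)"
  unfolding killing_eq mat_of_lie sl2_22 by (simp add: algebra_simps)

lemma sl_scale_rules: "sl_scale (c + d) x = sl_scale c x + sl_scale d x"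
  "sl_scale c (x + y) = sl_scale c x + sl_scale c y" "sl_scale c 0 = 0" "sl_scale 0 x = 0" "sl_scale 1 x = x"
  "sl_scale c (sl_scale d x) = sl_scale (c * d) x"
  by (rule sl2_eqI; simp add: sl2_entries algebra_simps)+

lemma additive_sum:
  fixes L :: "'a::ab_group_add \<Rightarrow> 'b::ab_group_add"
  assumes "\<And>x y. L (x + y) = L x + L y"
  shows "L (sum f S) = (\<Sum>x\<in>S. L (f x))"
proof -
  have "L 0 = 0" using assms[of 0 0] by simp
  then show ?thesis by (induction S rule: infinite_finite_induct) (simp_all add: assms)
qed

lemma killing_sum:
  "killing (sum f S) y = (\<Sum>i\<in>S. killing (f i) y)" "killing x (sum f S) = (\<Sum>i\<in>S. killing x (f i))"
  using additive_sum[of "\<lambda>x. killing x y" f S] additive_sum[of "killing x" f S]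
  by (simp_all add: killing_bilinear)

lemma sl2_coordinates:
  fixes x :: "complex sl2"
  shows "x = sl_scale (killing x (sl_scale (1/8) sl_h)) sl_h + sl_scale (killing x (sl_scale (1/4) sl_f)) sl_e
    + sl_scale (killing x (sl_scale (1/4) sl_e)) sl_f"
  using sl2_basis[of x] by (simp add: killing_eq sl2_entries)

lemma killing_nondegenerate:
  fixes x y :: "complex sl2"
  assumes "\<And>z. killing z x = killing z y"
  shows "x = y"
  by (subst sl2_coordinates[of x], subst sl2_coordinates[of y]) (simp only: killing_sym[of x] killing_sym[of y] assms)

text \<open>
  A biadditive map with \<open>B (c x) y = B x (c y)\<close> is a map out of \<open>\<gg> \<otimes> \<gg>\<close>.
\<close>

definition balanced :: "(complex sl2 \<Rightarrow> complex sl2 \<Rightarrow> 'b::ab_group_add) \<Rightarrow> bool"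
  where "balanced B \<longleftrightarrow> (\<forall>x y z. B (x + y) z = B x z + B y z) \<and> (\<forall>x y z. B x (y + z) = B x y + B x z)
    \<and> (\<forall>c x y. B (sl_scale c x) y = B x (sl_scale c y))"

lemma balancedD:
  assumes "balanced B"
  shows "B (x + y) z = B x z + B y z" "B x (y + z) = B x y + B x z"
    "B (sl_scale c x) y = B x (sl_scale c y)"
    "B (sum f S) y = (\<Sum>i\<in>S. B (f i) y)" "B x (sum f S) = (\<Sum>i\<in>S. B x (f i))"
  using assms additive_sum[of "\<lambda>x. B x y" f S] additive_sum[of "B x" f S]
  by (auto simp: balanced_def)

locale killing_dual_bases =
  fixes J J' :: "'i::finite \<Rightarrow> complex sl2"
  assumes basis: "is_sl2_basis J" and dual: "is_killing_dual J J'"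
begin

lemma expand_in_J: "(\<Sum>\<alpha>\<in>UNIV. sl_scale (killing x (J' \<alpha>)) (J \<alpha>)) = x"
proof -
  obtain c where c: "x = (\<Sum>\<alpha>\<in>UNIV. sl_scale (c \<alpha>) (J \<alpha>))"
    using basis unfolding is_sl2_basis_def by blast
  have "killing x (J' \<beta>) = c \<beta>" for \<beta>
  proof -
    have "killing x (J' \<beta>) = (\<Sum>\<alpha>\<in>UNIV. c \<alpha> * killing (J \<alpha>) (J' \<beta>))"
      unfolding c by (simp add: killing_bilinear killing_sum)
    also have "\<dots> = (\<Sum>\<alpha>\<in>UNIV. if \<alpha> = \<beta> then c \<beta> else 0)"
      using dual by (intro sum.cong refl) (auto simp: is_killing_dual_def)
    finally show ?thesis by simp
  qed
  then show ?thesis using c by simp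
qed

lemma expand_in_J': "(\<Sum>\<alpha>\<in>UNIV. sl_scale (killing x (J \<alpha>)) (J' \<alpha>)) = x"
proof (rule killing_nondegenerate)
  fix z
  have "killing z (\<Sum>\<alpha>\<in>UNIV. sl_scale (killing x (J \<alpha>)) (J' \<alpha>))
      = (\<Sum>\<alpha>\<in>UNIV. killing z (J' \<alpha>) * killing x (J \<alpha>))"
    by (simp add: killing_bilinear killing_sum mult.commute)
  also have "\<dots> = killing x (\<Sum>\<alpha>\<in>UNIV. sl_scale (killing z (J' \<alpha>)) (J \<alpha>))"
    by (simp add: killing_bilinear killing_sum)
  also have "\<dots> = killing z x" unfolding expand_in_J by (rule killing_sym)
  finally show "killing z (\<Sum>\<alpha>\<in>UNIV. sl_scale (killing x (J \<alpha>)) (J' \<alpha>)) = killing z x" .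
qed

text \<open>
  The tensor \<open>\<Sum>\<^sub>\<alpha> J \<alpha> \<otimes> J' \<alpha>\<close> does not depend on the basis, and it is annihilated by \<open>\<gg>\<close>
  because the Killing form is invariant.
\<close>

lemma casimir_standard:
  assumes B: "balanced B"
  shows "(\<Sum>\<alpha>\<in>UNIV. B (J \<alpha>) (J' \<alpha>))
    = B sl_h (sl_scale (1/8) sl_h) + B sl_e (sl_scale (1/4) sl_f) + B sl_f (sl_scale (1/4) sl_e)"
proof -
  note B' = balancedD[OF B]
  have s: "(\<Sum>\<alpha>\<in>UNIV. B (sl_scale (killing (J \<alpha>) y) x) (J' \<alpha>)) = B x y" for x y
    using expand_in_J'[of y] by (simp add: B'(3) killing_sym[of "J _"] flip: B'(5))
  have "(\<Sum>\<alpha>\<in>UNIV. B (J \<alpha>) (J' \<alpha>)) = (\<Sum>\<alpha>\<in>UNIV. B (sl_scale (killing (J \<alpha>) (sl_scale (1/8) sl_h)) sl_h) (J' \<alpha>)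
    + B (sl_scale (killing (J \<alpha>) (sl_scale (1/4) sl_f)) sl_e) (J' \<alpha>)
    + B (sl_scale (killing (J \<alpha>) (sl_scale (1/4) sl_e)) sl_f) (J' \<alpha>))"
    by (simp only: B'(1)[symmetric] sl2_coordinates[symmetric])
  then show ?thesis by (simp only: sum.distrib s)
qed

lemma casimir_invariant:
  assumes B: "balanced B"
  shows "(\<Sum>\<alpha>\<in>UNIV. B (lie x (J \<alpha>)) (J' \<alpha>)) = - (\<Sum>\<alpha>\<in>UNIV. B (J \<alpha>) (lie x (J' \<alpha>)))"
proof -
  note B' = balancedD[OF B]
  have "(\<Sum>\<alpha>\<in>UNIV. B (J \<alpha>) (lie x (J' \<alpha>)))
      = (\<Sum>\<alpha>\<in>UNIV. B (J \<alpha>) (\<Sum>\<beta>\<in>UNIV. sl_scale (killing (lie x (J' \<alpha>)) (J \<beta>)) (J' \<beta>)))"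
    by (simp only: expand_in_J')
  also have "\<dots> = (\<Sum>\<beta>\<in>UNIV. \<Sum>\<alpha>\<in>UNIV. B (J \<alpha>) (sl_scale (killing (lie x (J' \<alpha>)) (J \<beta>)) (J' \<beta>)))"
    unfolding B'(5) by (rule sum.swap)
  also have "\<dots> = (\<Sum>\<beta>\<in>UNIV. B (\<Sum>\<alpha>\<in>UNIV. sl_scale (killing (lie x (J' \<alpha>)) (J \<beta>)) (J \<alpha>)) (J' \<beta>))"
    by (simp only: B'(3) B'(4))
  also have "\<dots> = (\<Sum>\<beta>\<in>UNIV. B (- lie x (J \<beta>)) (J' \<beta>))"
  proof -
    have "killing (lie x y) z = killing (- lie x z) y" for y z
      unfolding killing_eq uminus_sl2.rep_eq vector_uminus_component mat_of_lie sl2_22 by (simp add: algebra_simps)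
    then show ?thesis using expand_in_J by simp
  qed
  also have "\<dots> = - (\<Sum>\<beta>\<in>UNIV. B (lie x (J \<beta>)) (J' \<beta>))"
  proof -
    have "B (- y) z = - B y z" for y z
      using B'(1)[of y "- y" z] B'(1)[of 0 0 z] by (simp add: eq_neg_iff_add_eq_0 add.commute)
    then show ?thesis by (simp add: sum_negf)
  qed
  finally show ?thesis by simp
qed

lemma casimir_lie: "(\<Sum>\<alpha>\<in>UNIV. lie (J \<alpha>) (J' \<alpha>)) = 0"
proof -
  have "(\<Sum>\<alpha>\<in>UNIV. lie (J \<alpha>) (J' \<alpha>)) = lie sl_h (sl_scale (1/8) sl_h)
      + lie sl_e (sl_scale (1/4) sl_f) + lie sl_f (sl_scale (1/4) sl_e)"
    by (rule casimir_standard) (simp add: balanced_def lie_bilinear)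
  also have "\<dots> = 0"
    by (rule sl2_eqI) (simp add: mat_of_lie sl2_entries)
  finally show ?thesis .
qed

text \<open>The Casimir element acts on the adjoint representation by \<open>1\<close>, the Killing form being the trace form.\<close>

lemma casimir_adjoint: "(\<Sum>\<alpha>\<in>UNIV. lie (lie x (J \<alpha>)) (J' \<alpha>)) = x"
proof -
  have "(\<Sum>\<alpha>\<in>UNIV. lie (lie x (J \<alpha>)) (J' \<alpha>)) = lie (lie x sl_h) (sl_scale (1/8) sl_h)
      + lie (lie x sl_e) (sl_scale (1/4) sl_f) + lie (lie x sl_f) (sl_scale (1/4) sl_e)"
    by (rule casimir_standard) (simp add: balanced_def lie_bilinear)
  also have "\<dots> = x"
  proof (rule sl2_eqI)
    fix i j :: 2
    show "mat_of (lie (lie x sl_h) (sl_scale (1/8) sl_h)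
      + lie (lie x sl_e) (sl_scale (1/4) sl_f) + lie (lie x sl_f) (sl_scale (1/4) sl_e)) $ i $ j = mat_of x $ i $ j"
      using exhaust_2[of i] exhaust_2[of j] by (auto simp: mat_of_lie sl2_entries sl2_22)
  qed
  finally show ?thesis .
qed

lemma casimir_killing: "(\<Sum>\<alpha>\<in>UNIV. killing (lie x (J \<alpha>)) (J' \<alpha>)) = 0"
  unfolding killing_invariant
  by (simp add: killing_bilinear casimir_lie flip: killing_sum(2))

end

section \<open>Currents\<close>

definition current :: "complex sl2 \<Rightarrow> R2 \<Rightarrow> U2"
  where "current x f = U2_gen (tens x f, 0)"

lemma xw_eq_current: "xw x i = current x (w2 i)"
  by (simp add: xw_def current_def)

lemma current_add_right: "current x (f + g) = current x f + current x g"
  and current_add_left: "current (x + y) f = current x f + current y f"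
proof -
  have "tens (x + y) f = tens x f + tens y f"
    by (rule sl2_eqI) (simp add: sl2_entries A_R_const distrib_right)
  then show "current (x + y) f = current x f + current y f"
    "current x (f + g) = current x f + current x g"
    unfolding current_def incl_rules(1)[symmetric] by (simp_all add: tens_rules)
qed

lemma current_A: "current x (A_R2 p * f) = U2_scal p * current x f"
  unfolding current_def incl_rules(2)[symmetric] by (simp add: tens_rules g2_scale_def)

lemma current_scale: "current (sl_scale c x) f = U2_scal (fps_const c) * current x f"
proof -
  have "tens (sl_scale c x) f = tens x (A_R2 (fps_const c) * f)"
    by (rule sl2_eqI) (simp add: sl2_entries A_R_const mult_ac)
  then show ?thesis unfolding current_A[symmetric] by (simp add: current_def)
qed

lemma current_0 [simp]: "current x 0 = 0" and current_0_left: "current 0 f = 0"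
  using current_add_right[of x 0 0] current_add_left[of 0 0 f] by simp_all

lemma current_sum_right: "current x (sum f S) = (\<Sum>i\<in>S. current x (f i))"
  by (rule additive_sum) (rule current_add_right)

lemma current_sum_left: "current (sum x S) f = (\<Sum>i\<in>S. current (x i) f)"
  by (rule additive_sum) (rule current_add_left)

lemma current_minus_right: "current x (- f) = - current x f"
  using current_add_right[of x f "- f"] by (simp add: eq_neg_iff_add_eq_0 add.commute)

lemma current_diff_right: "current x (f - g) = current x f - current x g"
  using current_add_right[of x f "- g"] by (simp add: current_minus_right)

lemma U2_gen_eq: "U2_gen (X, c) = U2_gen (X, 0) + U2_scal c * C2"
proof -
  have "(X, c) = (X, 0) + g2_scale c (0, 1)"
    by (simp add: g2_scale_def sl_scale_rules)
  then show ?thesis unfolding C2_def by (simp only: incl_rules)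
qed

lemma U2_gen_currents:
  "U2_gen (X, c) = current sl_h (mat_of X $ 1 $ 1) + current sl_e (mat_of X $ 1 $ 2)
    + current sl_f (mat_of X $ 2 $ 1) + U2_scal c * C2"
  using tens_basis[of X] unfolding U2_gen_eq[of X c] current_def incl_rules(1)[symmetric] by simp

lemma C2_commute: "C2 * u = u * C2"
proof (induction u rule: U2_induct)
  case (scal p) show ?case by (rule scal_commute[symmetric])
next
  case (incl X)
  have "g2_lie (0, 1) X = 0"
    by (cases X) (simp add: g2_lie_def lie_bilinear killing_eq der_sl.rep_eq zero_sl2.rep_eq deriv_A[of 0 0, simplified] zero_prod_def)
  then show ?case using incl_rules(3)[of "(0, 1)" X] by (simp add: C2_def)
next
  case (add x y) then show ?case by (simp add: distrib_left distrib_right)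
next
  case (mult x y) then show ?case by (metis mult.assoc)
qed

lemma current_commutator:
  "commutator (current x f) (current y g)
    = current (lie x y) (f * g) + U2_scal (fps_const (killing x y) * res2 (deriv_R2 f * g)) * C2"
  unfolding commutator_def current_def incl_rules(3) g2_lie_tens by (subst U2_gen_eq) simp

lemma current_swap:
  "current x f * current y g = current y g * current x f + current (lie x y) (f * g)
    + U2_scal (fps_const (killing x y) * res2 (deriv_R2 f * g)) * C2"
  using current_commutator[of x f y g] unfolding commutator_def by (simp add: algebra_simps)

lemma current_J2: "f \<in> RR (2 * int n) \<Longrightarrow> current x f \<in> J2 n"
  unfolding current_def RR_def by (simp add: J2_tens)

lemma balanced_current: "balanced (\<lambda>x y. current x f * current y g)"
  unfolding balanced_def by (simp add: current_add_left current_scale distrib_left distrib_right)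
    (metis mult.assoc scal_commute)

lemma scal_sum: "U2_scal (sum f S) = (\<Sum>x\<in>S. U2_scal (f x))"
  by (induction S rule: infinite_finite_induct) (simp_all add: scal_rules)

lemma fps_const_sum: "fps_const (sum f S) = (\<Sum>x\<in>S. fps_const (f x))"
  by (induction S rule: infinite_finite_induct) (simp_all flip: fps_const_add)

lemma J2_sum: "(\<And>i. i \<in> S \<Longrightarrow> f i \<in> J2 n) \<Longrightarrow> sum f S \<in> J2 n"
  by (induction S rule: infinite_finite_induct) (simp_all add: J2_closed)

context killing_dual_bases
begin

definition casimir_current :: "R2 \<Rightarrow> R2 \<Rightarrow> U2"
  where "casimir_current f g = (\<Sum>\<alpha>\<in>UNIV. current (J \<alpha>) f * current (J' \<alpha>) g)"

definition twisted_casimir :: "complex sl2 \<Rightarrow> R2 \<Rightarrow> R2 \<Rightarrow> U2"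
  where "twisted_casimir x f g = (\<Sum>\<alpha>\<in>UNIV. current (lie x (J \<alpha>)) f * current (J' \<alpha>) g)"

lemma casimir_current_swap:
  "(\<Sum>\<alpha>\<in>UNIV. current (J' \<alpha>) g * current (J \<alpha>) f)
    = casimir_current f g - U2_scal (\<Sum>\<alpha>\<in>UNIV. fps_const (killing (J \<alpha>) (J' \<alpha>)) * res2 (deriv_R2 f * g)) * C2"
  unfolding casimir_current_def current_swap[of "J _"] sum.distrib current_sum_left[symmetric] casimir_lie
  by (simp add: current_0_left scal_sum sum_distrib_right)

text \<open>
  The current \<open>x (f g)\<close> is the quantum correction behind the critical level: it appears with coefficient \<open>1\<close>
  because the Casimir element acts by \<open>1\<close> on \<open>\<gg>\<close>. There is no central term, as
  \<open>\<Sum>\<^sub>\<alpha> \<kappa>([x, J \<alpha>], J' \<alpha>) = \<kappa>(x, \<Sum>\<^sub>\<alpha> [J \<alpha>, J' \<alpha>])\<close>.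
\<close>

lemma twisted_casimir_swap:
  "twisted_casimir x f g = (\<Sum>\<alpha>\<in>UNIV. current (J' \<alpha>) g * current (lie x (J \<alpha>)) f) + current x (f * g)"
proof -
  have "(\<Sum>\<alpha>\<in>UNIV. U2_scal (fps_const (killing (lie x (J \<alpha>)) (J' \<alpha>)) * res2 (deriv_R2 f * g)) * C2) = 0"
    unfolding sum_distrib_right[symmetric] scal_sum[symmetric] fps_const_sum[symmetric] casimir_killing
    by (simp add: scal_rules)
  then show ?thesis
    unfolding twisted_casimir_def current_swap[of "lie x (J _)"] sum.distrib current_sum_left[symmetric] casimir_adjoint
    by simp
qed

lemma twisted_casimir_J2:
  assumes "g \<in> RR (2 * int n)"
  shows "twisted_casimir x f g \<in> J2 n"
  unfolding twisted_casimir_def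
  by (rule J2_sum) (intro J2_closed(3) current_J2 assms)

lemma twisted_casimir_mod_J2:
  assumes "f \<in> RR (2 * int n)"
  shows "twisted_casimir x f g - current x (f * g) \<in> J2 n"
  unfolding twisted_casimir_swap add_diff_cancel_right'
  by (rule J2_sum) (intro J2_closed(3) current_J2 assms)

text \<open>
  The terms in \<open>C2\<close> come from the two cocycle contributions; the quadratic terms would cancel if multiplication
  by \<open>g\<close> could be moved across the tensor product.
\<close>

lemma commutator_casimir_current:
  "commutator (current x g) (casimir_current f f')
    = twisted_casimir x (g * f) f' - twisted_casimir x f (g * f')
    + C2 * (U2_scal (res2 (deriv_R2 g * f)) * current x f' + U2_scal (res2 (deriv_R2 g * f')) * current x f)"
proof -
  let ?p = "res2 (deriv_R2 g * f)" and ?q = "res2 (deriv_R2 g * f')"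
  have twist: "(\<Sum>\<alpha>\<in>UNIV. current (J \<alpha>) f * current (lie x (J' \<alpha>)) (g * f')) = - twisted_casimir x f (g * f')"
    unfolding twisted_casimir_def using casimir_invariant[OF balanced_current[of f "g * f'"], of x] by simp
  have left: "U2_scal (fps_const (killing x (J \<alpha>)) * ?p) * C2 * current (J' \<alpha>) f'
      = C2 * (U2_scal ?p * current (sl_scale (killing x (J \<alpha>)) (J' \<alpha>)) f')" for \<alpha>
    unfolding current_scale scal_rules by (metis C2_commute mult.assoc scal_commute)
  have right: "current (J \<alpha>) f * (U2_scal (fps_const (killing x (J' \<alpha>)) * ?q) * C2)
      = C2 * (U2_scal ?q * current (sl_scale (killing x (J' \<alpha>)) (J \<alpha>)) f)" for \<alpha>
    unfolding current_scale scal_rules by (metis C2_commute mult.assoc scal_commute)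
  have "commutator (current x g) (casimir_current f f')
    = (\<Sum>\<alpha>\<in>UNIV. current (lie x (J \<alpha>)) (g * f) * current (J' \<alpha>) f'
        + U2_scal (fps_const (killing x (J \<alpha>)) * ?p) * C2 * current (J' \<alpha>) f'
        + (current (J \<alpha>) f * current (lie x (J' \<alpha>)) (g * f')
        + current (J \<alpha>) f * (U2_scal (fps_const (killing x (J' \<alpha>)) * ?q) * C2)))"
    unfolding casimir_current_def commutator_sum_right commutator_mult_right current_commutator
    by (simp only: distrib_left distrib_right)
  then show ?thesis
    unfolding left right sum.distrib twist
    unfolding sum_distrib_left[symmetric] current_sum_left[symmetric] expand_in_J expand_in_J'
    by (simp add: twisted_casimir_def distrib_left)
qed

end

section \<open>Truncated Sugawara operators\<close>

lemma commutator_C2: "commutator u (U2_scal p * C2) = 0"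
  unfolding commutator_def by (metis C2_commute mult.assoc scal_commute right_minus_eq)

lemma nprod_w2_left:
  "nprod x (w2 i) y g = (\<Sum>j | w_coord g j \<noteq> 0. U2_scal (w_coord g j) * nprod_w x i y j)"
proof -
  have "{i'. w_coord (w2 i) i' \<noteq> 0} = {i}" by (auto simp: w_coord_w)
  then show ?thesis by (simp add: nprod_def w_coord_w)
qed

lemma current_w_expansion:
  "current x f = (\<Sum>j | w_coord f j \<noteq> 0. U2_scal (w_coord f j) * current x (w2 j))"
  by (subst w_coord_sum[of f]) (simp add: current_sum_right current_A)

text \<open>
  Normal ordering puts the factor with the larger index on the right, and \<open>J2 n\<close> is a left ideal.
\<close>

lemma nprod_J2:
  assumes "2 * int n \<le> i \<or> g \<in> RR (2 * int n + 3)"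
  shows "nprod x (w2 i) y g \<in> J2 n"
  unfolding nprod_w2_left
proof (rule J2_sum, rule J2_closed(3))
  fix j assume "j \<in> {j. w_coord g j \<noteq> 0}"
  then have "w_coord g j \<noteq> 0" by simp
  then have *: "2 * int n \<le> i \<or> 2 * int n \<le> j"
    using assms w_coord_RR[of g "2 * int n + 3" j] by linarith
  have J: "2 * int n \<le> l \<Longrightarrow> xw y l \<in> J2 n" for l y
    unfolding xw_eq_current by (rule current_J2, rule RR_mono[OF _ RR_w])
  show "nprod_w x i y j \<in> J2 n"
    unfolding nprod_w_def using * by (auto intro!: J2_closed(3) J)
qed

lemma sum_telescope_int:
  fixes D :: "int \<Rightarrow> 'a::ab_group_add"
  assumes "a \<le> b"
  shows "(\<Sum>i\<in>{a..b}. D (i + 1) - D i) = D (b + 1) - D a"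
  using assms
proof (induction b rule: int_ge_induct)
  case (step b)
  have "{a..b + 1} = insert (b + 1) {a..b}" using step(1) by auto
  then show ?case using step by simp
qed simp

lemma w2_1_mult:
  "w2 1 * w2 i = w2 (i + 1) - (if odd i then a2 * w2 i else 0)"
  "w2 1 * z2 (- i - 1) = z2 (- i) - (if odd i then a2 * z2 (- i - 1) else 0)"
proof -
  show "w2 1 * w2 i = w2 (i + 1) - (if odd i then a2 * w2 i else 0)"
    by (simp add: w2_mult add.commute)
  show "w2 1 * z2 (- i - 1) = z2 (- i) - (if odd i then a2 * z2 (- i - 1) else 0)"
    unfolding w2_mult_z2 by (simp add: z2_eq)
qed

lemma w2_m2_mult: "w2 (- 2) * w2 i = w2 (i - 2)" "w2 (- 2) * z2 i = z2 (i - 2)"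
  by (simp_all add: w2_mult w2_mult_z2) (auto simp: z2_eq)

lemma deriv_R2_w_1: "deriv_R2 (w2 1) = 1"
proof -
  have "w_K 1 = v_K 0" using w_K_odd[of 0] by simp
  moreover have "u_K 0 = 1" by (simp add: u_K_def)
  ultimately show ?thesis using der_v[of 0] by (transfer) simp
qed

lemma deriv_R2_w_m2: "deriv_R2 (w2 (- 2)) = - (w2 (- 3) + z2 (- 3))"
proof -
  have "w_K (- 2) = u_K (- 1)" "w_K (- 3) = v_K (- 2)" "z_K (- 3) = v_K (- 2) + a_K * u_K (- 2)"
    using w_K_even[of "- 1"] w_K_odd[of "- 2"] w_K_even[of "- 2"] z_K[of "- 3"] by simp_all
  then have "der_K (w_K (- 2)) = - (w_K (- 3) + z_K (- 3))"
    using der_u[of "- 1"] by simp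
  then have "K_of_R2 (deriv_R2 (w2 (- 2))) = K_of_R2 (- (w2 (- 3) + z2 (- 3)))"
    by (simp only: deriv_R2.rep_eq w2.rep_eq z2.rep_eq uminus_R2.rep_eq plus_R2.rep_eq)
  then show ?thesis unfolding K_of_R2_inject .
qed

lemma RR_mult_w: "f \<in> RR N \<Longrightarrow> f * w2 k \<in> RR (N + k - 1)"
  by (rule RR_mult[OF _ RR_w])

context killing_dual_bases
begin

lemma twisted_casimir_diff:
  "twisted_casimir x (f - f') g = twisted_casimir x f g - twisted_casimir x f' g"
  "twisted_casimir x f (g - g') = twisted_casimir x f g - twisted_casimir x f g'"
  by (simp_all add: twisted_casimir_def current_diff_right algebra_simps sum_subtractf)

lemma twisted_casimir_0: "twisted_casimir x 0 g = 0" "twisted_casimir x f 0 = 0"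
  by (simp_all add: twisted_casimir_def)

lemma twisted_casimir_A:
  "twisted_casimir x (A_R2 p * f) g = twisted_casimir x f (A_R2 p * g)"
  unfolding twisted_casimir_def current_A by (metis mult.assoc scal_commute)

definition sugawara_term :: "int \<Rightarrow> int \<Rightarrow> U2"
  where "sugawara_term k i = (\<Sum>\<alpha>\<in>UNIV. nprod (J \<alpha>) (w2 i) (J' \<alpha>) (z2 (- i - 1) * w2 k))"

text \<open>
  Interchanging the factors of \<open>J \<alpha> f\<close> and \<open>J' \<alpha> g\<close> and summing over \<open>\<alpha>\<close> produces no current,
  since \<open>\<Sum>\<^sub>\<alpha> [J \<alpha>, J' \<alpha>] = 0\<close>, so the normal ordering affects only a central summand.
\<close>

lemma normal_ordering_central:
  "\<exists>p. (\<Sum>\<alpha>\<in>UNIV. nprod (J \<alpha>) (w2 i) (J' \<alpha>) g) = casimir_current (w2 i) g + U2_scal p * C2"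
proof -
  define c where "c = w_coord g"
  have "\<exists>p. (\<Sum>\<alpha>\<in>UNIV. nprod_w (J \<alpha>) i (J' \<alpha>) j) = casimir_current (w2 i) (w2 j) + U2_scal p * C2" for j
  proof (cases "i \<le> j")
    case True
    then show ?thesis
      by (intro exI[of _ 0]) (simp add: nprod_w_def xw_eq_current casimir_current_def scal_rules)
  next
    case False
    have "U2_scal (- p) = - U2_scal p" for p
      using scal_rules(3)[of p "- p"] by (simp add: scal_rules eq_neg_iff_add_eq_0 add.commute)
    then have "- (U2_scal p * C2) = U2_scal (- p) * C2" for p by simp
    with False show ?thesis
      unfolding nprod_w_def xw_eq_current by (simp add: casimir_current_swap diff_conv_add_uminus del: add_uminus_conv_diff) blast
  qed
  then obtain p where p: "\<And>j. (\<Sum>\<alpha>\<in>UNIV. nprod_w (J \<alpha>) i (J' \<alpha>) j)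
      = casimir_current (w2 i) (w2 j) + U2_scal (p j) * C2" by metis
  have "(\<Sum>\<alpha>\<in>UNIV. nprod (J \<alpha>) (w2 i) (J' \<alpha>) g)
      = (\<Sum>j | c j \<noteq> 0. U2_scal (c j) * (\<Sum>\<alpha>\<in>UNIV. nprod_w (J \<alpha>) i (J' \<alpha>) j))"
    unfolding nprod_w2_left c_def sum_distrib_left by (rule sum.swap)
  also have "\<dots> = (\<Sum>j | c j \<noteq> 0. U2_scal (c j) * casimir_current (w2 i) (w2 j))
      + U2_scal (\<Sum>j | c j \<noteq> 0. c j * p j) * C2"
    unfolding p by (simp add: distrib_left sum.distrib scal_sum scal_rules sum_distrib_right mult.assoc)
  also have "(\<Sum>j | c j \<noteq> 0. U2_scal (c j) * casimir_current (w2 i) (w2 j)) = casimir_current (w2 i) g"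
  proof -
    have "U2_scal q * (u * v) = u * (U2_scal q * v)" for q u v
      by (metis mult.assoc scal_commute)
    then have "(\<Sum>j | c j \<noteq> 0. U2_scal (c j) * casimir_current (w2 i) (w2 j))
        = (\<Sum>j | c j \<noteq> 0. \<Sum>\<alpha>\<in>UNIV. current (J \<alpha>) (w2 i) * (U2_scal (c j) * current (J' \<alpha>) (w2 j)))"
      by (simp add: casimir_current_def sum_distrib_left)
    also have "\<dots> = (\<Sum>\<alpha>\<in>UNIV. current (J \<alpha>) (w2 i) * (\<Sum>j | c j \<noteq> 0. U2_scal (c j) * current (J' \<alpha>) (w2 j)))"
      unfolding sum_distrib_left by (rule sum.swap)
    finally show ?thesis unfolding c_def casimir_current_def current_w_expansion[symmetric] .
  qed
  finally show ?thesis by blast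
qed

lemma commutator_sugawara_term:
  "commutator u (sugawara_term k i) = commutator u (casimir_current (w2 i) (z2 (- i - 1) * w2 k))"
proof -
  obtain p where "sugawara_term k i = casimir_current (w2 i) (z2 (- i - 1) * w2 k) + U2_scal p * C2"
    unfolding sugawara_term_def using normal_ordering_central by blast
  then show ?thesis by (simp add: commutator_add_right commutator_C2)
qed

text \<open>
  In each of the two sums of central terms the duality of \<open>w2 i\<close> and \<open>z2 (- i - 1)\<close> reassembles
  \<open>g' w2 k\<close>, once the truncation is long enough for the expansion of \<open>g'\<close> or \<open>g' w2 k\<close>.
\<close>

lemma commutator_partial_sum:
  "\<exists>N0. \<forall>N\<ge>N0. commutator (current x g) (\<Sum>i\<in>{-N..N}. sugawara_term k i)
    = 2 * C2 * current x (deriv_R2 g * w2 k)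
      + (\<Sum>i\<in>{-N..N}. twisted_casimir x (g * w2 i) (z2 (- i - 1) * w2 k)
          - twisted_casimir x (w2 i) (g * (z2 (- i - 1) * w2 k)))"
proof -
  let ?h = "w2 k" and ?g = "deriv_R2 g"
  obtain N0 where N0: "\<And>N. N \<ge> N0 \<Longrightarrow> (\<Sum>i\<in>{-N..N}. A_R2 (res2 (?g * w2 i)) * z2 (- i - 1)) = ?g"
    using expand_in_z unfolding eventual_expansion_def by blast
  obtain N1 where N1: "\<And>N. N \<ge> N1 \<Longrightarrow> (\<Sum>i\<in>{-N..N}. A_R2 (res2 ((?g * ?h) * z2 (- i - 1))) * w2 i) = ?g * ?h"
    using expand_in_w unfolding eventual_expansion_def by blast
  have "commutator (current x g) (\<Sum>i\<in>{-N..N}. sugawara_term k i)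
    = 2 * C2 * current x (?g * ?h)
      + (\<Sum>i\<in>{-N..N}. twisted_casimir x (g * w2 i) (z2 (- i - 1) * ?h)
          - twisted_casimir x (w2 i) (g * (z2 (- i - 1) * ?h)))" if "max N0 N1 \<le> N" for N
  proof -
    have "(\<Sum>i\<in>{-N..N}. U2_scal (res2 (?g * w2 i)) * current x (z2 (- i - 1) * ?h))
        = current x ((\<Sum>i\<in>{-N..N}. A_R2 (res2 (?g * w2 i)) * z2 (- i - 1)) * ?h)"
      unfolding sum_distrib_right mult.assoc by (simp only: current_sum_right current_A)
    then have c1: "(\<Sum>i\<in>{-N..N}. U2_scal (res2 (?g * w2 i)) * current x (z2 (- i - 1) * ?h)) = current x (?g * ?h)"
      using N0 that by simp
    have "(\<Sum>i\<in>{-N..N}. U2_scal (res2 (?g * (z2 (- i - 1) * ?h))) * current x (w2 i))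
        = current x (\<Sum>i\<in>{-N..N}. A_R2 (res2 ((?g * ?h) * z2 (- i - 1))) * w2 i)"
      unfolding current_sum_right current_A by (simp add: mult_ac)
    then have c2: "(\<Sum>i\<in>{-N..N}. U2_scal (res2 (?g * (z2 (- i - 1) * ?h))) * current x (w2 i)) = current x (?g * ?h)"
      using N1 that by simp
    show ?thesis
      unfolding commutator_sum_right commutator_sugawara_term commutator_casimir_current sum.distrib
        sum_distrib_left[symmetric] c1 c2 by (simp add: distrib_left distrib_right mult_2)
  qed
  then show ?thesis by blast
qed

lemma twisted_casimir_high:
  "\<exists>N0. \<forall>N\<ge>N0. twisted_casimir x (w2 (N + c)) (z2 (- N + d) * w2 k) - current x (w2 (N + c) * z2 (- N + d) * w2 k) \<in> J2 n"
proof -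
  have "twisted_casimir x (w2 (N + c)) (z2 (- N + d) * w2 k) - current x (w2 (N + c) * z2 (- N + d) * w2 k) \<in> J2 n"
    if "N \<ge> 2 * int n - c" for N
    unfolding mult.assoc
    by (rule twisted_casimir_mod_J2, rule RR_mono[OF _ RR_w]) (use that in simp)
  then show ?thesis by blast
qed

lemma twisted_casimir_low:
  "\<exists>N0. \<forall>N\<ge>N0. twisted_casimir x (w2 (- N + c)) (z2 (N + d) * w2 k) \<in> J2 n"
proof -
  have "twisted_casimir x (w2 (- N + c)) (z2 (N + d) * w2 k) \<in> J2 n"
    if "N \<ge> 2 * int n - d - k + 2" for N
    by (rule twisted_casimir_J2, rule RR_mono[OF _ RR_mult_w[OF RR_z]]) (use that in simp)
  then show ?thesis by blast
qed

text \<open>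
  Multiplication by \<open>g\<close> is self-adjoint for the residue pairing, so formally the two-sided infinite sum
  is \<open>0\<close>; its truncations retain boundary terms. For the generators \<open>s\<close> and \<open>1/(ts)\<close> of \<open>R2\<close> they telescope.
  The lower boundary terms tend to \<open>0\<close>; the upper ones do so only after their factors have been
  interchanged, which leaves the current \<open>x (g' w2 k)\<close>.
\<close>

definition anomaly :: "complex sl2 \<Rightarrow> R2 \<Rightarrow> int \<Rightarrow> int \<Rightarrow> U2"
  where "anomaly x g k N = (\<Sum>i\<in>{-N..N}. twisted_casimir x (g * w2 i) (z2 (- i - 1) * w2 k)
          - twisted_casimir x (w2 i) (g * (z2 (- i - 1) * w2 k)))"

lemma anomaly_w_1:
  "\<exists>N0. \<forall>N\<ge>N0. anomaly x (w2 1) k N - current x (deriv_R2 (w2 1) * w2 k) \<in> J2 n"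
proof -
  define D where "D i = twisted_casimir x (w2 i) (z2 (- i) * w2 k)" for i
  have step: "twisted_casimir x (w2 1 * w2 i) (z2 (- i - 1) * w2 k)
      - twisted_casimir x (w2 i) (w2 1 * (z2 (- i - 1) * w2 k)) = D (i + 1) - D i" for i
  proof -
    have "w2 1 * (z2 (- i - 1) * w2 k) = z2 (- i) * w2 k - (if odd i then a2 * (z2 (- i - 1) * w2 k) else 0)"
      unfolding mult.assoc[symmetric] w2_1_mult by (simp add: left_diff_distrib)
    moreover have "- (i + 1) = - i - 1" by simp
    ultimately show ?thesis
      unfolding D_def w2_1_mult(1)
      by (simp add: twisted_casimir_diff twisted_casimir_A twisted_casimir_0)
  qed
  obtain N1 where N1: "\<And>N. N \<ge> N1 \<Longrightarrow> D (N + 1) - current x (w2 (N + 1) * z2 (- N + - 1) * w2 k) \<in> J2 n"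
    using twisted_casimir_high[of x 1 "- 1" k n] unfolding D_def by auto
  obtain N2 where N2: "\<And>N. N \<ge> N2 \<Longrightarrow> D (- N) \<in> J2 n"
    using twisted_casimir_low[of x 0 0 k n] unfolding D_def by auto
  have "anomaly x (w2 1) k N - current x (deriv_R2 (w2 1) * w2 k) \<in> J2 n" if N: "N \<ge> max 0 (max N1 N2)" for N
  proof -
    have "w2 (N + 1) * z2 (- N + - 1) = 1" unfolding w2_mult_z2 by (simp add: w2_0)
    then have "D (N + 1) - current x (w2 k) \<in> J2 n" using N1[of N] N by simp
    then have "(D (N + 1) - current x (w2 k)) - D (- N) \<in> J2 n" using J2_closed(5)[OF _ N2[of N]] N by simp
    moreover have "anomaly x (w2 1) k N = D (N + 1) - D (- N)"
      unfolding anomaly_def step by (rule sum_telescope_int) (use N in simp)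
    ultimately show ?thesis by (simp add: deriv_R2_w_1 diff_diff_eq add.commute)
  qed
  then show ?thesis by blast
qed

lemma anomaly_w_m2:
  "\<exists>N0. \<forall>N\<ge>N0. anomaly x (w2 (- 2)) k N - current x (deriv_R2 (w2 (- 2)) * w2 k) \<in> J2 n"
proof -
  define D where "D i = twisted_casimir x (w2 (i - 2)) (z2 (- i - 1) * w2 k)" for i
  define E where "E i = - (D i + D (i + 1))" for i
  have step: "twisted_casimir x (w2 (- 2) * w2 i) (z2 (- i - 1) * w2 k)
      - twisted_casimir x (w2 i) (w2 (- 2) * (z2 (- i - 1) * w2 k)) = E (i + 1) - E i" for i
  proof -
    have "w2 (- 2) * (z2 (- i - 1) * w2 k) = z2 (- (i + 2) - 1) * w2 k"
      unfolding mult.assoc[symmetric] w2_m2_mult by simp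
    then show ?thesis unfolding E_def D_def w2_m2_mult(1) by simp
  qed
  have eqs: "- (N + 1) - 1 = - N + - 2" "- (N + 2) - 1 = - N + - 3" "N + 1 - 2 = N + - 1" "N + 2 - 2 = N + 0"
    "- (- N) - 1 = N + - 1" "- N - 2 = - N + - 2" "- (- N + 1) - 1 = N + - 2" "- N + 1 - 2 = - N + - 1" for N :: int
    by simp_all
  obtain N1 where N1: "\<And>N. N \<ge> N1 \<Longrightarrow> D (N + 1) - current x (w2 (N + - 1) * z2 (- N + - 2) * w2 k) \<in> J2 n"
    using twisted_casimir_high[of x "- 1" "- 2" k n] unfolding D_def eqs by auto
  obtain N2 where N2: "\<And>N. N \<ge> N2 \<Longrightarrow> D (N + 2) - current x (w2 (N + 0) * z2 (- N + - 3) * w2 k) \<in> J2 n"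
    using twisted_casimir_high[of x 0 "- 3" k n] unfolding D_def eqs by auto
  obtain N3 where N3: "\<And>N. N \<ge> N3 \<Longrightarrow> D (- N) \<in> J2 n"
    using twisted_casimir_low[of x "- 2" "- 1" k n] unfolding D_def eqs by auto
  obtain N4 where N4: "\<And>N. N \<ge> N4 \<Longrightarrow> D (- N + 1) \<in> J2 n"
    using twisted_casimir_low[of x "- 1" "- 2" k n] unfolding D_def eqs by auto
  have "anomaly x (w2 (- 2)) k N - current x (deriv_R2 (w2 (- 2)) * w2 k) \<in> J2 n"
    if N: "N \<ge> max 0 (max (max N1 N2) (max N3 N4))" for N
  proof -
    let ?P = "w2 (N + - 1) * z2 (- N + - 2)" and ?Q = "w2 (N + 0) * z2 (- N + - 3)"
    have PQ: "deriv_R2 (w2 (- 2)) = - (?P + ?Q)"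
      by (auto simp: deriv_R2_w_m2 w2_mult_z2 add.commute)
    have in_J2: "(D (- N) + D (- N + 1)) - ((D (N + 1) - current x (?P * w2 k)) + (D (N + 2) - current x (?Q * w2 k))) \<in> J2 n"
      using J2_closed(5)[OF J2_closed(2)[OF N3[of N] N4[of N]] J2_closed(2)[OF N1[of N] N2[of N]]] N by simp
    have "anomaly x (w2 (- 2)) k N = E (N + 1) - E (- N)"
      unfolding anomaly_def step by (rule sum_telescope_int) (use N in simp)
    moreover have "D (N + 1 + 1) = D (N + 2)" by (simp add: add.assoc)
    moreover have "current x (- (?P + ?Q) * w2 k) = - (current x (?P * w2 k) + current x (?Q * w2 k))"
      by (simp only: current_minus_right current_add_right distrib_right mult_minus_left)
    ultimately have "anomaly x (w2 (- 2)) k N - current x (- (?P + ?Q) * w2 k)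
      = (D (- N) + D (- N + 1)) - ((D (N + 1) - current x (?P * w2 k)) + (D (N + 2) - current x (?Q * w2 k)))"
      by (simp only: E_def) simp
    with in_J2 show ?thesis unfolding PQ by (simp only:)
  qed
  then show ?thesis by blast
qed

lemma commutator_truncated:
  assumes "g = w2 1 \<or> g = w2 (- 2)"
  shows "\<exists>N0. \<forall>N\<ge>N0. commutator (current x g) (\<Sum>i\<in>{-N..N}. sugawara_term k i)
    - (2 * C2 + 1) * current x (deriv_R2 g * w2 k) \<in> J2 n"
proof -
  obtain N0 where N0: "\<And>N. N \<ge> N0 \<Longrightarrow> anomaly x g k N - current x (deriv_R2 g * w2 k) \<in> J2 n"
    using assms anomaly_w_1[of x k n] anomaly_w_m2[of x k n] by blast
  obtain N1 where N1: "\<And>N. N \<ge> N1 \<Longrightarrow> commutator (current x g) (\<Sum>i\<in>{-N..N}. sugawara_term k i)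
    = 2 * C2 * current x (deriv_R2 g * w2 k) + anomaly x g k N"
    using commutator_partial_sum unfolding anomaly_def by blast
  have "commutator (current x g) (\<Sum>i\<in>{-N..N}. sugawara_term k i)
    - (2 * C2 + 1) * current x (deriv_R2 g * w2 k) \<in> J2 n" if "N \<ge> max N0 N1" for N
    using N0[of N] N1[of N] that by (simp add: distrib_right)
  then show ?thesis by blast
qed

text \<open>For \<open>i\<close> large the first factor of a normally ordered term lies in \<open>J2 n\<close>, for \<open>- i\<close> large the second one.\<close>

lemma finite_sugawara_terms:
  "finite {(i, \<alpha>). nprod (J \<alpha>) (w2 i) (J' \<alpha>) (z2 (- i - 1) * w2 k) \<notin> J2 n}"
proof (rule finite_subset)
  have "i \<in> {k - 2 * int n - 6 .. 2 * int n}"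
    if *: "nprod (J \<alpha>) (w2 i) (J' \<alpha>) (z2 (- i - 1) * w2 k) \<notin> J2 n" for i \<alpha>
  proof (rule ccontr)
    assume "i \<notin> {k - 2 * int n - 6 .. 2 * int n}"
    then have "2 * int n \<le> i \<or> 2 * int n + 3 \<le> - i - 1 - 1 + k - 1" by auto
    then have "2 * int n \<le> i \<or> z2 (- i - 1) * w2 k \<in> RR (2 * int n + 3)"
      using RR_mono[OF _ RR_mult_w[OF RR_z]] by blast
    then show False using * nprod_J2 by blast
  qed
  then show "{(i, \<alpha>). nprod (J \<alpha>) (w2 i) (J' \<alpha>) (z2 (- i - 1) * w2 k) \<notin> J2 n}
    \<subseteq> {k - 2 * int n - 6 .. 2 * int n} \<times> UNIV" by auto
qed simp

end

section \<open>The completed algebra\<close>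

lemmas component_mem = compatibleD[OF compat_component]

lemma component_eqI: "(\<And>n. \<exists>x. x \<in> component \<xi> n \<and> x \<in> component \<eta> n) \<Longrightarrow> \<xi> = \<eta>"
  by (metis component_mem(1) component_inject ext)

lemma component_add: "u \<in> component \<xi> n \<Longrightarrow> v \<in> component \<eta> n \<Longrightarrow> u + v \<in> component (\<xi> + \<eta>) n"
  unfolding plus_U2bar.rep_eq by (intro bar_plus(2) compat_component)

lemma component_diff: "u \<in> component \<xi> n \<Longrightarrow> v \<in> component \<eta> n \<Longrightarrow> u - v \<in> component (\<xi> - \<eta>) n"
  using component_add[of u \<xi> n "- v" "- \<eta>"] bar_uminus(2)[OF compat_component, of v \<eta> n]
  by (simp add: uminus_U2bar.rep_eq)

lemma component_mult:
  "v \<in> component \<eta> n \<Longrightarrow> \<forall>x\<in>J2 M. x * v \<in> J2 n \<Longrightarrow> u \<in> component \<xi> M \<Longrightarrow> u * v \<in> component (\<xi> * \<eta>) n"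
  unfolding times_U2bar.rep_eq by (rule bar_times(2)[OF compat_component compat_component])

lemma component_of_U2: "u \<in> component (of_U2 u) n"
  by (simp add: of_U2.rep_eq coset_self)

lemma of_U2_add: "of_U2 (u + v) = of_U2 u + of_U2 v"
  by (rule component_eqI) (blast intro: component_add component_of_U2)

lemma of_U2_diff: "of_U2 (u - v) = of_U2 u - of_U2 v"
  by (rule component_eqI) (blast intro: component_diff component_of_U2)

lemma of_U2_mult: "of_U2 (u * v) = of_U2 u * of_U2 v"
  by (rule component_eqI) (use J2_cont[of v] in \<open>blast intro: component_mult component_of_U2\<close>)

lemma of_U2_0: "of_U2 0 = 0"
  by (simp add: zero_U2bar_def)

lemma of_U2_sum: "of_U2 (sum f S) = (\<Sum>x\<in>S. of_U2 (f x))"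
  by (rule additive_sum) (rule of_U2_add)

lemma of_U2_commutator: "of_U2 (commutator u v) = commutator (of_U2 u) (of_U2 v)"
  by (simp add: commutator_def of_U2_diff of_U2_mult)

text \<open>The kernel of the projection to \<open>U2/J2 n\<close>.\<close>

definition nbhd :: "nat \<Rightarrow> U2bar set"
  where "nbhd n = {\<xi>. 0 \<in> component \<xi> n}"

lemma nbhd_of_U2: "of_U2 u \<in> nbhd n \<longleftrightarrow> u \<in> J2 n"
  using J2_closed(4)[of u n] J2_closed(4)[of "- u" n]
  by (auto simp: nbhd_def of_U2.rep_eq lcoset_def)

lemma nbhd_0: "0 \<in> nbhd n"
  using nbhd_of_U2[of 0 n] J2_closed(1) by (simp add: of_U2_0)

lemma nbhd_add: "\<xi> \<in> nbhd n \<Longrightarrow> \<eta> \<in> nbhd n \<Longrightarrow> \<xi> + \<eta> \<in> nbhd n"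
  using component_add[of 0 \<xi> n 0 \<eta>] by (simp add: nbhd_def)

lemma nbhd_diff: "\<xi> \<in> nbhd n \<Longrightarrow> \<eta> \<in> nbhd n \<Longrightarrow> \<xi> - \<eta> \<in> nbhd n"
  using component_diff[of 0 \<xi> n 0 \<eta>] by (simp add: nbhd_def)

lemma nbhd_mult_left: "\<xi> \<in> nbhd n \<Longrightarrow> \<eta> * \<xi> \<in> nbhd n"
proof -
  assume "\<xi> \<in> nbhd n"
  moreover obtain u where "u \<in> component \<eta> 0" using component_mem(2) by blast
  ultimately show ?thesis
    using component_mult[of 0 \<xi> n 0 u \<eta>] J2_closed(1) by (simp add: nbhd_def)
qed

lemma nbhd_mult_right: "\<exists>m. \<forall>\<xi>\<in>nbhd m. \<xi> * \<eta> \<in> nbhd n"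
proof -
  obtain v where v: "v \<in> component \<eta> n" using component_mem(2) by blast
  obtain m where "\<forall>x\<in>J2 m. x * v \<in> J2 n" using J2_cont by blast
  then show ?thesis using component_mult[OF v, of m 0] by (auto simp: nbhd_def)
qed

lemma nbhd_antimono: "m \<le> n \<Longrightarrow> \<xi> \<in> nbhd n \<Longrightarrow> \<xi> \<in> nbhd m"
  using component_mem(3) by (auto simp: nbhd_def)

lemma nbhd_separated: "(\<And>n. \<xi> \<in> nbhd n) \<Longrightarrow> \<xi> = 0"
  using component_of_U2[of 0] by (intro component_eqI) (auto simp: nbhd_def of_U2_0)

lemma dense_U2: "\<exists>u. \<xi> - of_U2 u \<in> nbhd n"
proof -
  obtain u where "u \<in> component \<xi> n" using component_mem(2) by blast
  then show ?thesis using component_diff[OF _ component_of_U2, of u \<xi> n u] by (auto simp: nbhd_def)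
qed

lemma component_eq_iff: "component \<eta> n = component \<xi> n \<longleftrightarrow> \<eta> - \<xi> \<in> nbhd n"
proof
  assume e: "component \<eta> n = component \<xi> n"
  obtain u where "u \<in> component \<xi> n" using component_mem(2) by blast
  then show "\<eta> - \<xi> \<in> nbhd n" using component_diff[of u \<eta> n u \<xi>] e by (simp add: nbhd_def)
next
  assume "\<eta> - \<xi> \<in> nbhd n"
  moreover obtain u where u: "u \<in> component \<xi> n" using component_mem(2) by blast
  ultimately have "u \<in> component \<eta> n" using component_add[of 0 "\<eta> - \<xi>" n u \<xi>] by (simp add: nbhd_def)
  with u show "component \<eta> n = component \<xi> n" using component_mem(1) by metis
qed

lemma U2bar_complete:
  assumes "\<And>n. \<xi> (Suc n) - \<xi> n \<in> nbhd n"
  shows "\<exists>\<zeta>. \<forall>n. \<zeta> - \<xi> n \<in> nbhd n"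
proof -
  define c where "c n = component (\<xi> n) n" for n
  have "c (Suc n) \<subseteq> c n" for n
    using assms[of n] component_mem(3)[of n "Suc n" _ "\<xi> (Suc n)"] unfolding c_def component_eq_iff[symmetric] by auto
  then have "c n \<subseteq> c m" if "m \<le> n" for m n using that by (rule lift_Suc_antimono_le)
  moreover have "\<exists>u. c n = lcoset (J2 n) u" for n
    using compat_component[of "\<xi> n"] by (simp add: c_def compatible_def)
  ultimately have "component (Abs_U2bar c) = c" by (intro Abs_U2bar_inverse) blast
  then have "component (Abs_U2bar c) n = component (\<xi> n) n" for n by (simp add: c_def)
  then show ?thesis unfolding component_eq_iff by blast
qed

lemma of_U2_central:
  assumes "\<And>v. u * v = v * u"
  shows "of_U2 u * \<xi> = \<xi> * of_U2 u"
proof -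
  have "of_U2 u * \<xi> - \<xi> * of_U2 u \<in> nbhd n" for n
  proof -
    obtain m where m: "\<And>\<nu>. \<nu> \<in> nbhd m \<Longrightarrow> \<nu> * of_U2 u \<in> nbhd n" using nbhd_mult_right by blast
    obtain v where v: "\<xi> - of_U2 v \<in> nbhd (max m n)" using dense_U2 by blast
    have "of_U2 u * of_U2 v = of_U2 v * of_U2 u" using assms[of v] by (metis of_U2_mult)
    then have "of_U2 u * \<xi> - \<xi> * of_U2 u = of_U2 u * (\<xi> - of_U2 v) - (\<xi> - of_U2 v) * of_U2 u"
      by (simp add: algebra_simps)
    then show ?thesis
      using nbhd_diff[OF nbhd_mult_left m] v nbhd_antimono[of _ "max m n"] by simp
  qed
  from nbhd_separated[OF this] show ?thesis by simp
qed

lemma has_sum_U2bar_iff: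
  fixes f :: "'x \<Rightarrow> U2bar"
  shows "(f has_sum S) UNIV \<longleftrightarrow> (\<forall>n. \<exists>X. finite X \<and> (\<forall>Y. finite Y \<and> X \<subseteq> Y \<longrightarrow> sum f Y - S \<in> nbhd n))"
proof -
  have opn: "open {\<eta>. \<eta> - S \<in> nbhd n}" for n
    unfolding open_U2bar_def component_eq_iff
  proof
    fix \<xi> assume "\<xi> \<in> {\<eta>. \<eta> - S \<in> nbhd n}"
    then have "\<eta> - S \<in> nbhd n" if "\<eta> - \<xi> \<in> nbhd n" for \<eta>
      using nbhd_add[OF that, of "\<xi> - S"] by simp
    then show "\<exists>m. \<forall>\<eta>. \<eta> - \<xi> \<in> nbhd m \<longrightarrow> \<eta> \<in> {\<eta>. \<eta> - S \<in> nbhd n}" by blast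
  qed
  have "((\<lambda>F. sum f F) \<longlongrightarrow> S) (finite_subsets_at_top UNIV)
      \<longleftrightarrow> (\<forall>n. \<forall>\<^sub>F F in finite_subsets_at_top UNIV. sum f F - S \<in> nbhd n)"
    unfolding tendsto_def
  proof (intro iffI allI impI)
    fix n assume "\<forall>T. open T \<longrightarrow> S \<in> T \<longrightarrow> (\<forall>\<^sub>F F in finite_subsets_at_top UNIV. sum f F \<in> T)"
    moreover have "S \<in> {\<eta>. \<eta> - S \<in> nbhd n}" by (simp add: nbhd_0)
    ultimately have "\<forall>\<^sub>F F in finite_subsets_at_top UNIV. sum f F \<in> {\<eta>. \<eta> - S \<in> nbhd n}"
      using opn[of n] by blast
    then show "\<forall>\<^sub>F F in finite_subsets_at_top UNIV. sum f F - S \<in> nbhd n" by simp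
  next
    fix T assume ev: "\<forall>n. \<forall>\<^sub>F F in finite_subsets_at_top UNIV. sum f F - S \<in> nbhd n" and "open T" "S \<in> T"
    then obtain n where n: "\<And>\<eta>. \<eta> - S \<in> nbhd n \<Longrightarrow> \<eta> \<in> T"
      unfolding open_U2bar_def component_eq_iff by blast
    show "\<forall>\<^sub>F F in finite_subsets_at_top UNIV. sum f F \<in> T"
      by (rule eventually_mono[OF ev[rule_format, of n]]) (rule n)
  qed
  then show ?thesis unfolding has_sum_def eventually_finite_subsets_at_top by simp
qed

text \<open>
  As in any complete non-archimedean group, a family that tends to \<open>0\<close> is summable.
\<close>

lemma has_sum_U2bar:
  fixes f :: "'x \<Rightarrow> U2"
  assumes fin: "\<And>n. finite {x. f x \<notin> J2 n}"
  obtains S where "((\<lambda>x. of_U2 (f x)) has_sum S) UNIV"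
    "\<And>S'. ((\<lambda>x. of_U2 (f x)) has_sum S') UNIV \<Longrightarrow> S' = S"
    "\<And>n Y. finite Y \<Longrightarrow> {x. f x \<notin> J2 n} \<subseteq> Y \<Longrightarrow> of_U2 (sum f Y) - S \<in> nbhd n"
proof -
  define F where "F n = {x. f x \<notin> J2 n}" for n
  have mono: "F n \<subseteq> F (Suc n)" for n using J2_mono[of n "Suc n"] by (auto simp: F_def)
  have tail: "of_U2 (sum f Y) - of_U2 (sum f (F n)) \<in> nbhd n" if "finite Y" "F n \<subseteq> Y" for n Y
  proof -
    have "sum f Y - sum f (F n) = sum f (Y - F n)" using sum_diff[OF that, of f] by simp
    also have "\<dots> \<in> J2 n" by (rule J2_sum) (auto simp: F_def)
    finally show ?thesis by (simp add: nbhd_of_U2 flip: of_U2_diff)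
  qed
  have finF: "finite (F n)" for n using fin by (simp add: F_def)
  obtain S where S: "\<And>n. S - of_U2 (sum f (F n)) \<in> nbhd n"
    using U2bar_complete[of "\<lambda>n. of_U2 (sum f (F n))", OF tail[OF finF mono]] by blast
  have lim: "of_U2 (sum f Y) - S \<in> nbhd n" if "finite Y" "F n \<subseteq> Y" for n Y
    using nbhd_diff[OF tail[OF that] S[of n]] by simp
  show ?thesis
  proof
    show hs: "((\<lambda>x. of_U2 (f x)) has_sum S) UNIV"
      unfolding has_sum_U2bar_iff of_U2_sum[symmetric] using lim finF by blast
    show "of_U2 (sum f Y) - S \<in> nbhd n" if "finite Y" "{x. f x \<notin> J2 n} \<subseteq> Y" for n Y
      using lim that by (simp add: F_def)
    fix S' assume hs': "((\<lambda>x. of_U2 (f x)) has_sum S') UNIV"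
    have "S' - S \<in> nbhd n" for n
    proof -
      obtain X where X: "finite X" "\<And>Y. finite Y \<Longrightarrow> X \<subseteq> Y \<Longrightarrow> of_U2 (sum f Y) - S' \<in> nbhd n"
        using hs' unfolding has_sum_U2bar_iff of_U2_sum[symmetric] by meson
      have "of_U2 (sum f (X \<union> F n)) - S - (of_U2 (sum f (X \<union> F n)) - S') \<in> nbhd n"
        using X finF by (intro nbhd_diff lim X) auto
      then show ?thesis by simp
    qed
    from nbhd_separated[OF this] show "S' = S" by simp
  qed
qed

lemma sugawara2_limit:
  fixes J J' :: "'i::finite \<Rightarrow> complex sl2"
  assumes "killing_dual_bases J J'"
  obtains S where "sugawara2 J J' k = abs_U2hat S"
    "\<And>n. \<exists>N0. \<forall>N\<ge>N0. of_U2 (\<Sum>i\<in>{-N..N}. killing_dual_bases.sugawara_term J J' k i) - S \<in> nbhd n"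
proof -
  interpret killing_dual_bases J J' by fact
  define f where "f = (\<lambda>(i, \<alpha>). nprod (J \<alpha>) (w2 i) (J' \<alpha>) (z2 (- i - 1) * w2 k))"
  have fin: "finite {x. f x \<notin> J2 n}" for n
  proof -
    have "{x. f x \<notin> J2 n} = {(i, \<alpha>). nprod (J \<alpha>) (w2 i) (J' \<alpha>) (z2 (- i - 1) * w2 k) \<notin> J2 n}"
      by (auto simp: f_def)
    then show ?thesis using finite_sugawara_terms[of k n] by simp
  qed
  from has_sum_U2bar[of f, OF fin] obtain S where S: "((\<lambda>x. of_U2 (f x)) has_sum S) UNIV"
    "\<And>S'. ((\<lambda>x. of_U2 (f x)) has_sum S') UNIV \<Longrightarrow> S' = S"
    "\<And>n Y. finite Y \<Longrightarrow> {x. f x \<notin> J2 n} \<subseteq> Y \<Longrightarrow> of_U2 (sum f Y) - S \<in> nbhd n" by blast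
  have "sugawara2 J J' k = abs_U2hat S"
  proof -
    have "(\<lambda>(i, \<alpha>). of_U2 (nprod (J \<alpha>) (w2 i) (J' \<alpha>) (z2 (- i - 1) * w2 k))) = (\<lambda>x. of_U2 (f x))"
      by (auto simp: f_def)
    then show ?thesis unfolding sugawara2_def using the_equality[of "\<lambda>S. ((\<lambda>x. of_U2 (f x)) has_sum S) UNIV", OF S(1,2)] by simp
  qed
  moreover have "\<exists>N0. \<forall>N\<ge>N0. of_U2 (\<Sum>i\<in>{-N..N}. sugawara_term k i) - S \<in> nbhd n" for n
  proof -
    have sum: "sum f ({-N..N} \<times> UNIV) = (\<Sum>i\<in>{-N..N}. sugawara_term k i)" for N
      unfolding sugawara_term_def f_def sum.cartesian_product ..
    define N0 where "N0 = Max (insert 0 ((\<lambda>x. \<bar>fst x\<bar>) ` {x. f x \<notin> J2 n}))"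
    have "{x. f x \<notin> J2 n} \<subseteq> {-N..N} \<times> UNIV" if "N \<ge> N0" for N
    proof
      fix x assume "x \<in> {x. f x \<notin> J2 n}"
      then have "\<bar>fst x\<bar> \<le> N0" unfolding N0_def using fin by (intro Max_ge) auto
      with that show "x \<in> {-N..N} \<times> UNIV" by (cases x) auto
    qed
    then have "of_U2 (\<Sum>i\<in>{-N..N}. sugawara_term k i) - S \<in> nbhd n" if "N \<ge> N0" for N
      unfolding sum[symmetric] using that by (intro S(3)) auto
    then show ?thesis by blast
  qed
  ultimately show ?thesis using that by blast
qed

section \<open>Centrality at the critical level\<close>

text \<open>As an \<open>A\<close>-algebra \<open>R2\<close> is generated by \<open>s\<close> and \<open>1/(ts)\<close>.\<close>

lemma R2_algebra_induct [case_names s inverse_ts add scale mult]: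
  assumes s: "P (w2 1)" and m2: "P (w2 (- 2))"
    and add: "\<And>f g. P f \<Longrightarrow> P g \<Longrightarrow> P (f + g)" and scale: "\<And>p f. P f \<Longrightarrow> P (A_R2 p * f)"
    and mult: "\<And>f g. P f \<Longrightarrow> P g \<Longrightarrow> P (f * g)"
  shows "P f"
proof -
  have "w2 2 = w2 1 * w2 1 + a2 * w2 1" by (simp add: w2_mult)
  then have p2: "P (w2 2)" using add mult scale s by metis
  have "w2 0 = w2 2 * w2 (- 2)" by (simp add: w2_mult)
  then have p0: "P (w2 0)" using mult p2 m2 by metis
  have even: "P (w2 (2 * n))" for n
  proof (induction n rule: int_induct[where k = 0])
    case (step1 n)
    have "w2 (2 * (n + 1)) = w2 (2 * n) * w2 2" by (simp add: w2_mult algebra_simps)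
    then show ?case using mult step1(2) p2 by metis
  next
    case (step2 n)
    have "w2 (2 * (n - 1)) = w2 (2 * n) * w2 (- 2)" by (simp add: w2_mult algebra_simps)
    then show ?case using mult step2(2) m2 by metis
  qed (simp add: p0)
  have "P (w2 i)" for i
  proof (cases "even i")
    case True
    then show ?thesis using even by (metis evenE)
  next
    case False
    then obtain n where n: "i = 2 * n + 1" by (rule oddE)
    have "w2 i = w2 (2 * n) * w2 1" unfolding n by (simp add: w2_mult)
    then show ?thesis using mult even s by metis
  qed
  then show ?thesis by (induction f rule: R2_induct) (use add scale in blast)+
qed

lemma sl2_perfect:
  fixes x :: "complex sl2"
  shows "\<exists>a b c d e f. x = lie a b + lie c d + lie e f"
proof -
  have "x = lie (sl_scale (mat_of x $ 1 $ 1) sl_e) sl_f + lie (sl_scale (mat_of x $ 1 $ 2 / 2) sl_h) sl_e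
    + lie (sl_scale (- mat_of x $ 2 $ 1 / 2) sl_h) sl_f"
  proof (rule sl2_eqI)
    fix i j :: 2
    show "mat_of x $ i $ j = mat_of (lie (sl_scale (mat_of x $ 1 $ 1) sl_e) sl_f
      + lie (sl_scale (mat_of x $ 1 $ 2 / 2) sl_h) sl_e
      + lie (sl_scale (- mat_of x $ 2 $ 1 / 2) sl_h) sl_f) $ i $ j"
      using exhaust_2[of i] exhaust_2[of j] by (auto simp: mat_of_lie sl2_entries sl2_22)
  qed
  then show ?thesis by blast
qed

lemma jacobi_commutator:
  "commutator (commutator u v) w = commutator u (commutator v w) - commutator v (commutator u w)"
  by (simp add: commutator_def algebra_simps)

text \<open>This is \<open>2 (C2 + 1/2)\<close>, which becomes \<open>0\<close> in \<open>U2hat\<close>.\<close>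

definition critical :: U2bar
  where "critical = of_U2 (2 * C2 + 1)"

lemma critical_central: "critical * \<xi> = \<xi> * critical"
  unfolding critical_def by (rule of_U2_central) (simp add: distrib_left distrib_right mult_2 mult_2_right C2_commute)

lemma commutator_critical:
  "commutator u (critical * v) = critical * commutator u v"
  "commutator (critical * u) v = critical * commutator u v"
  by (simp_all add: commutator_def right_diff_distrib mult.assoc)
     (metis critical_central mult.assoc)+

lemma commutator_scal: "commutator (of_U2 (U2_scal p)) \<xi> = 0"
  unfolding commutator_def using of_U2_central[of "U2_scal p" \<xi>] scal_commute by simp

lemma commutator_C2_bar: "commutator (of_U2 C2) \<xi> = 0"
  unfolding commutator_def using of_U2_central[of C2 \<xi>] C2_commute by simp

text \<open>
  \<open>S\<close> is the sum of the Sugawara series in \<open>U2bar\<close>, as a limit of symmetric truncations.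
\<close>

locale sugawara_limit = killing_dual_bases J J' for J J' :: "'i::finite \<Rightarrow> complex sl2" +
  fixes k :: int and S :: U2bar
  assumes limit: "\<exists>N0. \<forall>N\<ge>N0. of_U2 (\<Sum>i\<in>{-N..N}. sugawara_term k i) - S \<in> nbhd n"
begin

lemma commutator_limit:
  assumes "\<And>n. \<exists>N0. \<forall>N\<ge>N0. commutator u (\<Sum>i\<in>{-N..N}. sugawara_term k i) - v \<in> J2 n"
  shows "commutator (of_U2 u) S = of_U2 v"
proof -
  have "commutator (of_U2 u) S - of_U2 v \<in> nbhd n" for n
  proof -
    obtain m where m: "\<And>\<nu>. \<nu> \<in> nbhd m \<Longrightarrow> \<nu> * of_U2 u \<in> nbhd n" using nbhd_mult_right by blast
    obtain N0 where N0: "\<And>N. N \<ge> N0 \<Longrightarrow> of_U2 (\<Sum>i\<in>{-N..N}. sugawara_term k i) - S \<in> nbhd (max m n)"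
      using limit by blast
    obtain N1 where N1: "\<And>N. N \<ge> N1 \<Longrightarrow> commutator u (\<Sum>i\<in>{-N..N}. sugawara_term k i) - v \<in> J2 n"
      using assms by blast
    define P where "P = (\<Sum>i\<in>{- max N0 N1..max N0 N1}. sugawara_term k i)"
    have P: "of_U2 P - S \<in> nbhd m" "of_U2 P - S \<in> nbhd n"
      using nbhd_antimono[OF _ N0[of "max N0 N1"]] by (simp_all add: P_def)
    have "of_U2 (commutator u P - v) \<in> nbhd n" unfolding nbhd_of_U2 P_def by (rule N1) simp
    moreover have "commutator (of_U2 u) S - of_U2 v
      = of_U2 (commutator u P - v) - (of_U2 u * (of_U2 P - S) - (of_U2 P - S) * of_U2 u)"
      by (simp add: of_U2_diff of_U2_commutator) (simp add: commutator_def algebra_simps)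
    ultimately show ?thesis by (simp only: nbhd_diff nbhd_mult_left m P)
  qed
  from nbhd_separated[OF this] show ?thesis by simp
qed

text \<open>
  The case of the two generators suffices: both sides are compatible with brackets of currents, by the Jacobi
  identity and because \<open>x f \<mapsto> x (f' w2 k)\<close> is a derivation of the current algebra, and \<open>\<gg> = [\<gg>, \<gg>]\<close>.
\<close>

lemma commutator_current:
  "commutator (of_U2 (current x g)) S = critical * of_U2 (current x (deriv_R2 g * w2 k))"
proof (induction g arbitrary: x rule: R2_algebra_induct)
  case s
  show ?case unfolding critical_def of_U2_mult[symmetric]
    by (rule commutator_limit) (rule commutator_truncated, simp)
next
  case inverse_ts
  show ?case unfolding critical_def of_U2_mult[symmetric]
    by (rule commutator_limit) (rule commutator_truncated, simp)
next
  case (add f g)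
  then show ?case
    by (simp add: current_add_right of_U2_add commutator_add_left deriv_R_add distrib_right distrib_left)
next
  case (scale p f)
  have "critical * (of_U2 (U2_scal p) * \<xi>) = of_U2 (U2_scal p) * (critical * \<xi>)" for \<xi>
    by (metis critical_central mult.assoc)
  with scale show ?case
    by (simp add: current_A deriv_A of_U2_mult commutator_mult_left commutator_scal mult.assoc)
next
  case (mult f g)
  let ?h = "w2 k"
  have bracket: "commutator (of_U2 (current (lie y z) (f * g))) S
      = critical * of_U2 (current (lie y z) (deriv_R2 (f * g) * ?h))" for y z
  proof -
    have "of_U2 (current (lie y z) (f * g)) = commutator (of_U2 (current y f)) (of_U2 (current z g))
        - of_U2 (U2_scal (fps_const (killing y z) * res2 (deriv_R2 f * g))) * of_U2 C2"
      by (simp add: current_commutator of_U2_add of_U2_mult flip: of_U2_commutator)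
    then have "commutator (of_U2 (current (lie y z) (f * g))) S
      = commutator (of_U2 (current y f)) (commutator (of_U2 (current z g)) S)
        - commutator (of_U2 (current z g)) (commutator (of_U2 (current y f)) S)"
      by (simp add: commutator_diff_left commutator_mult_left commutator_scal commutator_C2_bar jacobi_commutator)
    also have "\<dots> = critical * of_U2 (commutator (current y f) (current z (deriv_R2 g * ?h))
        - commutator (current z g) (current y (deriv_R2 f * ?h)))"
      unfolding mult.IH by (simp only: commutator_critical of_U2_commutator of_U2_diff right_diff_distrib)
    also have "commutator (current y f) (current z (deriv_R2 g * ?h))
        - commutator (current z g) (current y (deriv_R2 f * ?h)) = current (lie y z) (deriv_R2 (f * g) * ?h)"
    proof -
      have "lie z y = sl_scale (- 1) (lie y z)" 
        by (rule sl2_eqI) (simp add: mat_of_lie sl2_entries)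
      then have "current (lie z y) F = - current (lie y z) F" for F
        using current_A[of "lie y z" "- 1" F] by (simp add: current_scale fps_const_m1 current_minus_right del: fps_const_neg)
      moreover have "deriv_R2 g * (deriv_R2 f * ?h) = deriv_R2 f * (deriv_R2 g * ?h)" by (simp only: mult_ac)
      ultimately show ?thesis
        unfolding current_commutator killing_sym[of z y] deriv_R2_mult distrib_right current_add_right
        by (simp add: mult_ac)
    qed
    finally show ?thesis .
  qed
  obtain a b c d e f where "x = lie a b + lie c d + lie e f" using sl2_perfect by blast
  then show ?case by (simp add: current_add_left of_U2_add commutator_add_left bracket distrib_left)
qed

lemma commutator_U2: "\<exists>d. commutator (of_U2 u) S = critical * d"
proof (induction u rule: U2_induct)
  case (scal p)
  show ?case by (rule exI[of _ 0]) (simp add: commutator_scal)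
next
  case (incl X)
  obtain Y c where X: "X = (Y, c)" by (cases X)
  have "commutator (of_U2 (U2_gen X)) S
    = critical * (of_U2 (current sl_h (deriv_R2 (mat_of Y $ 1 $ 1) * w2 k))
      + of_U2 (current sl_e (deriv_R2 (mat_of Y $ 1 $ 2) * w2 k))
      + of_U2 (current sl_f (deriv_R2 (mat_of Y $ 2 $ 1) * w2 k)))"
    unfolding X U2_gen_currents
    by (simp add: of_U2_add of_U2_mult commutator_add_left commutator_mult_left commutator_scal
      commutator_C2_bar commutator_current distrib_left)
  then show ?case by blast
next
  case (add u v)
  then show ?case by (metis of_U2_add commutator_add_left distrib_left)
next
  case (mult u v)
  then obtain d e where "commutator (of_U2 u) S = critical * d" "commutator (of_U2 v) S = critical * e" by blast
  then have "commutator (of_U2 (u * v)) S = critical * (of_U2 u * e + d * of_U2 v)"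
    unfolding of_U2_mult commutator_mult_left
    by (simp add: distrib_left mult.assoc) (metis critical_central mult.assoc)
  then show ?case by blast
qed

text \<open>
  The quotient \<open>d\<close> of \<open>commutator_U2\<close> can be chosen small when \<open>u\<close> is small: for a generator \<open>x (w2 i)\<close> of
  \<open>J2 m\<close> it is \<open>x ((w2 i)' w2 k)\<close>, and the left ideal generated by such elements inherits the property.
\<close>

lemma commutator_J2:
  "\<exists>m\<ge>n. \<forall>u\<in>J2 m. \<exists>d\<in>nbhd n. commutator (of_U2 u) S = critical * d"
proof -
  \<comment> \<open>the derivative and the product with \<open>w2 k\<close> lower the order by at most \<open>\<bar>k\<bar> + 3\<close>, in doubled indices\<close>
  define m where "m = n + nat \<bar>k\<bar> + 2"
  have "m \<ge> n" by (simp add: m_def)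
  define I where "I = {u \<in> J2 n. \<exists>d\<in>nbhd n. commutator (of_U2 u) S = critical * d}"
  have "u \<in> I" if "u \<in> J2 m" for u
    using that unfolding J2_def[of m]
  proof (rule hull_induct[where P = "\<lambda>u. u \<in> I"])
    show "is_left_ideal {u. u \<in> I}"
      unfolding is_left_ideal_def
    proof (intro conjI ballI allI; (elim CollectE)?; (intro CollectI)?)
      show "0 \<in> I"
        unfolding I_def using J2_closed(1) nbhd_0 by (auto intro!: bexI[of _ 0] simp: of_U2_0 commutator_def)
      show "u + v \<in> I" if "u \<in> I" "v \<in> I" for u v
      proof -
        from that obtain d e where "u \<in> J2 n" "v \<in> J2 n" "d \<in> nbhd n" "e \<in> nbhd n"
          "commutator (of_U2 u) S = critical * d" "commutator (of_U2 v) S = critical * e" unfolding I_def by blast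
        then show ?thesis unfolding I_def
          by (auto intro!: J2_closed(2) bexI[of _ "d + e"] nbhd_add simp: of_U2_add commutator_add_left distrib_left)
      qed
      show "v * u \<in> I" if "u \<in> I" for u v
      proof -
        from that obtain d where d: "u \<in> J2 n" "d \<in> nbhd n" "commutator (of_U2 u) S = critical * d" unfolding I_def by blast
        obtain e where e: "commutator (of_U2 v) S = critical * e" using commutator_U2 by blast
        have "commutator (of_U2 (v * u)) S = critical * (of_U2 v * d + e * of_U2 u)"
          unfolding of_U2_mult commutator_mult_left d e
          by (simp add: distrib_left mult.assoc) (metis critical_central mult.assoc)
        moreover have "of_U2 v * d + e * of_U2 u \<in> nbhd n"
          using d by (intro nbhd_add nbhd_mult_left) (simp_all add: nbhd_of_U2)
        ultimately show ?thesis unfolding I_def using d J2_closed(3) by blast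
      qed
    qed
  next
    fix u assume "u \<in> {U2_gen (tens x (w2 i), 0) | x i. 2 * int m \<le> i}"
    then obtain x i where u: "u = current x (w2 i)" and i: "2 * int m \<le> i" unfolding current_def by blast
    have "w2 i \<in> RR (2 * int n)" by (rule RR_mono[OF _ RR_w]) (use i in \<open>simp add: m_def\<close>)
    moreover have "deriv_R2 (w2 i) * w2 k \<in> RR (2 * int n)"
      by (rule RR_mono[OF _ RR_mult_w[OF RR_deriv_w]]) (use i in \<open>simp add: m_def\<close>)
    ultimately have "u \<in> J2 n" "of_U2 (current x (deriv_R2 (w2 i) * w2 k)) \<in> nbhd n"
      unfolding u nbhd_of_U2 by (simp_all add: current_J2)
    then show "u \<in> I" unfolding I_def u using commutator_current by blast
  qed
  then show ?thesis using \<open>m \<ge> n\<close> unfolding I_def by blast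
qed

text \<open>
  The ideal that defines \<open>U2hat\<close> is generated algebraically, so membership in it is not obviously preserved
  by limits. Instead of the commutators, the quotients along an approximating sequence are passed to the limit,
  which gives an exact quotient \<open>\<zeta>\<close>.
\<close>

lemma commutator_U2bar: "\<exists>\<zeta>. commutator \<xi> S = critical * \<zeta>"
proof -
  have "\<forall>n. \<exists>m. m \<ge> n \<and> (\<forall>u\<in>J2 m. \<exists>d\<in>nbhd n. commutator (of_U2 u) S = critical * d)"
    using commutator_J2 by blast
  then obtain m where m: "\<And>n. m n \<ge> n"
    "\<And>n u. u \<in> J2 (m n) \<Longrightarrow> \<exists>d\<in>nbhd n. commutator (of_U2 u) S = critical * d" by metis
  \<comment> \<open>approximations of \<open>\<xi>\<close> whose successive differences have small quotients\<close>
  define M where "M n = Max (m ` {..n})" for n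
  have M: "m n \<le> M n" "M n \<le> M (Suc n)" for n
    unfolding M_def by (auto intro!: Max_ge Max_mono)
  have "\<forall>n. \<exists>u. \<xi> - of_U2 u \<in> nbhd (M n)" using dense_U2 by blast
  then obtain e where e: "\<And>n. \<xi> - of_U2 (e n) \<in> nbhd (M n)" by metis
  have "\<exists>d\<in>nbhd n. commutator (of_U2 (e (Suc n) - e n)) S = critical * d" for n
  proof (rule m(2))
    have "(\<xi> - of_U2 (e n)) - (\<xi> - of_U2 (e (Suc n))) \<in> nbhd (m n)"
      by (rule nbhd_diff; rule nbhd_antimono[OF _ e]) (use M[of n] in linarith)+
    then show "e (Suc n) - e n \<in> J2 (m n)" by (simp flip: of_U2_diff nbhd_of_U2)
  qed
  then obtain d where d: "\<And>n. d n \<in> nbhd n" "\<And>n. commutator (of_U2 (e (Suc n) - e n)) S = critical * d n"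
    by metis
  obtain d0 where d0: "commutator (of_U2 (e 0)) S = critical * d0" using commutator_U2 by blast
  define D where "D n = d0 + (\<Sum>j<n. d j)" for n
  have D: "commutator (of_U2 (e n)) S = critical * D n" for n
  proof (induction n)
    case (Suc n)
    have "of_U2 (e (Suc n)) = of_U2 (e n) + of_U2 (e (Suc n) - e n)" by (simp flip: of_U2_add)
    then show ?case using Suc d(2)[of n] by (simp add: commutator_add_left D_def distrib_left add.assoc)
  qed (simp add: D_def d0)
  obtain \<zeta> where \<zeta>: "\<And>n. \<zeta> - D n \<in> nbhd n"
    using U2bar_complete[of D] d(1) by (auto simp: D_def)
  have "commutator \<xi> S - critical * \<zeta> \<in> nbhd n" for n
  proof -
    obtain l where l: "\<And>\<nu>. \<nu> \<in> nbhd l \<Longrightarrow> \<nu> * S \<in> nbhd n" using nbhd_mult_right by blast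
    let ?N = "max l n"
    have N: "?N \<le> M ?N" using m(1)[of ?N] M(1)[of ?N] by simp
    have "\<xi> - of_U2 (e ?N) \<in> nbhd l" "\<xi> - of_U2 (e ?N) \<in> nbhd n"
      using e[of ?N] N by (auto elim!: nbhd_antimono[rotated])
    moreover have "\<zeta> - D ?N \<in> nbhd n" using \<zeta>[of ?N] by (auto elim!: nbhd_antimono[rotated])
    moreover have "commutator \<xi> S - critical * \<zeta>
      = (\<xi> - of_U2 (e ?N)) * S - S * (\<xi> - of_U2 (e ?N)) - critical * (\<zeta> - D ?N)"
      using D[of ?N] by (simp add: commutator_def algebra_simps)
    ultimately show ?thesis by (simp only: nbhd_diff nbhd_mult_left l)
  qed
  from nbhd_separated[OF this] show ?thesis by (intro exI[of _ \<zeta>]) simp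
qed

lemma abs_U2hat_central: "abs_U2hat S \<in> centre"
proof -
  let ?c = "of_U2 (C2 + U2_scal (fps_const (1/2)))"
  have half: "critical = ?c + ?c"
  proof -
    have "U2_scal (fps_const (1/2)) + U2_scal (fps_const (1/2)) = 1"
      by (simp add: scal_rules(2) flip: scal_rules(3))
    then have "2 * C2 + 1 = (C2 + U2_scal (fps_const (1/2))) + (C2 + U2_scal (fps_const (1/2)))"
      by (simp add: mult_2 algebra_simps)
    then show ?thesis unfolding critical_def by (simp only: of_U2_add)
  qed
  have "\<xi> * S - S * \<xi> \<in> U2hat_ideal" for \<xi>
  proof -
    obtain \<zeta> where "commutator \<xi> S = critical * \<zeta>" using commutator_U2bar by blast
    then have "\<xi> * S - S * \<xi> = ?c * (\<zeta> + \<zeta>)"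
      unfolding half by (simp add: commutator_def distrib_left distrib_right)
    moreover have "?c \<in> U2hat_ideal" unfolding U2hat_ideal_def by (rule hull_inc) simp
    ultimately show ?thesis using U2hat_ideal by (simp add: is_ideal_def)
  qed
  then have comm: "abs_U2hat \<xi> * abs_U2hat S = abs_U2hat S * abs_U2hat \<xi>" for \<xi>
    unfolding times_U2hat.abs_eq U2hat.abs_eq_iff .
  have "y * abs_U2hat S = abs_U2hat S * y" for y
    by (induction y rule: U2hat.abs_induct) (rule comm)
  then show ?thesis unfolding centre_def by blast
qed

end

theorem proposition4p12:
  fixes J J' :: "'i::finite \<Rightarrow> complex sl2" and k :: int
  assumes "is_sl2_basis J" and "is_killing_dual J J'"
  shows "sugawara2 J J' k \<in> centre"
proof -
  have bases: "killing_dual_bases J J'" using assms by (rule killing_dual_bases.intro)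
  obtain S where S: "sugawara2 J J' k = abs_U2hat S"
    "\<And>n. \<exists>N0. \<forall>N\<ge>N0. of_U2 (\<Sum>i\<in>{-N..N}. killing_dual_bases.sugawara_term J J' k i) - S \<in> nbhd n"
    using sugawara2_limit[OF bases] by blast
  interpret sugawara_limit J J' k S
    by (intro sugawara_limit.intro sugawara_limit_axioms.intro bases S(2))
  show ?thesis unfolding S(1) by (rule abs_U2hat_central)
qed

end
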